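(* Let $\Lambda\subset\mathbb{R}^2$ be the attractor of a homogeneous uniform fibre Gatzouras-Lalley system with contraction ratios $0<a<b<1$ (as defined in the context). If $\frac{\log a}{\log b}\notin\mathbb{Q}$, then $$\dim_H(\mathrm{proj}_\theta\Lambda)=\min(\dim_H\Lambda,1)\qquad\text{for all }\theta\in(0,\pi)\setminus\{\pi/2\}.$$
   Context: $\dim_H$ denotes Hausdorff dimension, $\mathrm{proj}_\theta$ is orthogonal projection of $\mathbb{R}^2$ onto the line through the origin making angle $\theta$ with the positive $x$-axis, and $I=[0,1]$. Homogeneous uniform fibre Gatzouras-Lalley system: fix positive integers $m,n$, constants $0<a<b<1$, and reals $c_{ij},d_i$ ($1\le i\le m$, $1\le j\le n$). The maps are $S_{ij}(x,y)=(ax+c_{ij},\,by+d_i)$, where the intervals $\{bI+d_i\}_{i=1}^m$ are contained in $I$ and have pairwise disjoint interiors, and for each $i$ the intervals $\{aI+c_{ij}\}_{j=1}^n$ are contained in $I$ and have pairwise disjoint interiors. The attractor $\Lambda$ is the unique non-empty compact set with $\Lambda=\bigcup_{i,j}S_{ij}(\Lambda)$. *)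

theory Defs
  imports "HOL-Analysis.Analysis"
begin

(* The two special cases make s = 0 the counting measure, because 0 powr 0 = 0 in HOL. *)
definition hausdorff_gauge :: "real \<Rightarrow> 'a::metric_space set \<Rightarrow> ennreal" where
  "hausdorff_gauge s U =
     (if U = {} then 0 else if s = 0 then 1 else ennreal (diameter U powr s))"

(* Boundedness is required separately, because diameter is 0 on unbounded sets. *)
definition delta_covers :: "real \<Rightarrow> 'a::metric_space set \<Rightarrow> (nat \<Rightarrow> 'a set) set" where
  "delta_covers \<delta> A =
     {U. A \<subseteq> (\<Union>k. U k) \<and> (\<forall>k. bounded (U k) \<and> diameter (U k) \<le> \<delta>)}"

definition hausdorff_premeasure :: "real \<Rightarrow> real \<Rightarrow> 'a::metric_space set \<Rightarrow> ennreal" where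
  "hausdorff_premeasure s \<delta> A = (INF U\<in>delta_covers \<delta> A. \<Sum>k. hausdorff_gauge s (U k))"

definition hausdorff_measure :: "real \<Rightarrow> 'a::metric_space set \<Rightarrow> ennreal" where
  "hausdorff_measure s A = (SUP \<delta>\<in>{0<..}. hausdorff_premeasure s \<delta> A)"

definition hausdorff_dim :: "'a::metric_space set \<Rightarrow> ennreal" where
  "hausdorff_dim A = (INF s\<in>{s. 0 \<le> s \<and> hausdorff_measure s A = 0}. ennreal s)"

definition proj_line :: "real \<Rightarrow> real \<times> real \<Rightarrow> real \<times> real" where
  "proj_line \<theta> v = (v \<bullet> (cos \<theta>, sin \<theta>)) *\<^sub>R (cos \<theta>, sin \<theta>)"

(* The families are indexed, so two intervals with different indices may not coincide. *)
definition gatzouras_lalley ::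
  "nat \<Rightarrow> nat \<Rightarrow> real \<Rightarrow> real \<Rightarrow> (nat \<Rightarrow> nat \<Rightarrow> real) \<Rightarrow> (nat \<Rightarrow> real) \<Rightarrow> bool" where
  "gatzouras_lalley m n a b c d \<longleftrightarrow>
     0 < m \<and> 0 < n \<and> 0 < a \<and> a < b \<and> b < 1 \<and>
     (\<forall>i\<in>{1..m}. (\<lambda>t. b * t + d i) ` {0..1} \<subseteq> {0..1}) \<and>
     disjoint_family_on (\<lambda>i. interior ((\<lambda>t. b * t + d i) ` {0..1})) {1..m} \<and>
     (\<forall>i\<in>{1..m}.
        (\<forall>j\<in>{1..n}. (\<lambda>t. a * t + c i j) ` {0..1} \<subseteq> {0..1}) \<and>
        disjoint_family_on (\<lambda>j. interior ((\<lambda>t. a * t + c i j) ` {0..1})) {1..n})"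

definition GL_map ::
  "real \<Rightarrow> real \<Rightarrow> (nat \<Rightarrow> nat \<Rightarrow> real) \<Rightarrow> (nat \<Rightarrow> real) \<Rightarrow> nat \<Rightarrow> nat \<Rightarrow>
   real \<times> real \<Rightarrow> real \<times> real" where
  "GL_map a b c d i j = (\<lambda>(x, y). (a * x + c i j, b * y + d i))"

definition is_GL_attractor ::
  "nat \<Rightarrow> nat \<Rightarrow> real \<Rightarrow> real \<Rightarrow> (nat \<Rightarrow> nat \<Rightarrow> real) \<Rightarrow> (nat \<Rightarrow> real) \<Rightarrow>
   (real \<times> real) set \<Rightarrow> bool" where
  "is_GL_attractor m n a b c d \<Lambda> \<longleftrightarrow>
     \<Lambda> \<noteq> {} \<and> compact \<Lambda> \<and> \<Lambda> = (\<Union>i\<in>{1..m}. \<Union>j\<in>{1..n}. GL_map a b c d i j ` \<Lambda>)"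

end

theory Submission
  imports Defs
begin

text \<open>Write \<open>z = x + t * y\<close> with \<open>t = tan \<theta>\<close>, \<open>\<kappa> = ln a / ln b\<close>, \<open>s = ln n / - ln a + ln m / - ln b\<close> and
  \<open>\<gamma> = min s 1\<close>. An approximate square of side \<open>a ^ k\<close> is given by \<open>k\<close> column digits and about \<open>\<kappa> * k\<close> row
  digits; covering by these gives \<open>dim \<Lambda> \<le> s\<close>, so it remains to bound the dimension of the projection
  from below by \<open>\<gamma>\<close>.

  Rescaled to unit size, the next \<open>q\<close> column digits and \<open>\<kappa> * q\<close> row digits inside an approximate square
  place points at a product set, seen by the projection with slope \<open>t * b powr (- frac (\<kappa> * k))\<close>.
  The column positions depend on the square only through a block \<open>u\<close> of \<open>q\<close> row digits that was chosen
  much earlier. Averaging over slopes (Marstrand's theorem) shows that for most slopes, most blocks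
  \<open>u\<close> are good, in the sense that at scale \<open>a ^ q\<close> only a proportion \<open>a powr (q * (\<gamma> - \<epsilon>))\<close> of the pairs
  of points collide. As \<open>\<kappa>\<close> is irrational, the slopes are equidistributed, so bad slopes occur at a
  small proportion of the steps. At all other steps only good blocks are allowed, which at most halves
  the number of blocks. The proportion of colliding pairs is submultiplicative up to a constant
  per step, hence at scale \<open>r\<close> it is at most \<open>r powr (\<gamma> - 3 * \<epsilon>)\<close>, and Chebyshev's inequality turns this
  correlation estimate into a mass distribution.\<close>

section \<open>Hausdorff measure and dimension\<close>

text \<open>The obstacle is that two approximate squares with different row words carry different
  column sets, so near pairs between them compare two unrelated product sets under an unknown
  relative translation. Counting near pairs, an L2 quantity, survives this: cross counts are
  dominated by the self-counts of the two blocks, whatever the translation, and each self-count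
  concerns one block \<open>u\<close> alone. The exceptional slopes of Marstrand's theorem still
  depend on \<open>u\<close>. Summing the self-counts over all \<open>u\<close> and over a finite
  grid of slopes before applying Markov's inequality removes this dependence: one small set of grid
  slopes serves all blocks, and for every other slope at least half of the blocks are good. The
  constants (3 for comparing two blocks, powers of 2 for discarded blocks, powers of
  \<open>m\<close> for rounding \<open>\<kappa> * q\<close>) are paid once per step of
  \<open>q\<close> digits, so for large \<open>q\<close> they amount to at most a factor
  \<open>a powr (- q * \<epsilon>)\<close> per step.\<close>

lemma hausdorff_measure_eq_0I:
  assumes "\<And>\<delta> \<eta>. 0 < \<delta> \<Longrightarrow> 0 < \<eta> \<Longrightarrow> \<exists>U\<in>delta_covers \<delta> A. (\<Sum>k. hausdorff_gauge s (U k)) \<le> ennreal \<eta>"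
  shows "hausdorff_measure s A = 0"
proof -
  have "hausdorff_premeasure s \<delta> A \<le> 0" if d: "0 < \<delta>" for \<delta>
  proof (rule ennreal_le_epsilon)
    fix e :: real assume "0 < e"
    then obtain U where "U \<in> delta_covers \<delta> A" "(\<Sum>k. hausdorff_gauge s (U k)) \<le> ennreal e"
      using assms[OF d \<open>0 < e\<close>] by blast
    then show "hausdorff_premeasure s \<delta> A \<le> 0 + ennreal e"
      unfolding hausdorff_premeasure_def by (simp add: INF_lower2)
  qed
  then have "hausdorff_measure s A \<le> 0"
    unfolding hausdorff_measure_def by (intro SUP_least) auto
  then show ?thesis by simp
qed

lemma hausdorff_measure_eq_0D:
  assumes "hausdorff_measure s A = 0" "0 < \<delta>" "0 < \<eta>"
  obtains U where "U \<in> delta_covers \<delta> A" "(\<Sum>k. hausdorff_gauge s (U k)) < ennreal \<eta>"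
proof -
  have "hausdorff_premeasure s \<delta> A \<le> hausdorff_measure s A"
    unfolding hausdorff_measure_def using assms(2) by (intro SUP_upper) auto
  also have "\<dots> < ennreal \<eta>" using assms by simp
  finally show ?thesis
    unfolding hausdorff_premeasure_def INF_less_iff using that by blast
qed

lemma hausdorff_dim_leI:
  assumes "0 \<le> r" "\<And>s. r < s \<Longrightarrow> hausdorff_measure s A = 0"
  shows "hausdorff_dim A \<le> ennreal r"
proof (rule ennreal_le_epsilon)
  fix e :: real assume "0 < e"
  then have "hausdorff_dim A \<le> ennreal (r + e)"
    unfolding hausdorff_dim_def using assms by (intro INF_lower) auto
  then show "hausdorff_dim A \<le> ennreal r + ennreal e"
    using \<open>0 < e\<close> assms by simp
qed

lemma hausdorff_dim_geI:
  assumes "\<And>s. 0 \<le> s \<Longrightarrow> s < r \<Longrightarrow> hausdorff_measure s A \<noteq> 0"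
  shows "ennreal r \<le> hausdorff_dim A"
  unfolding hausdorff_dim_def
  using assms by (intro INF_greatest) (force intro!: ennreal_leI)

text \<open>Box counting with a common size \<open>r\<close>. A single \<eta> bounds both the size
  and the sum; it is instantiated by \<open>min \<delta> \<eta>\<close>.\<close>

lemma hausdorff_measure_eq_0_finite_covers:
  assumes "0 < s"
    and "\<And>\<eta>. 0 < \<eta> \<Longrightarrow> \<exists>F r. finite F \<and> A \<subseteq> \<Union>F \<and> (\<forall>V\<in>F. bounded V \<and> diameter V \<le> r)
            \<and> r \<le> \<eta> \<and> real (card F) * r powr s \<le> \<eta>"
  shows "hausdorff_measure s A = 0"
proof (rule hausdorff_measure_eq_0I)
  fix \<delta> \<eta> :: real assume "0 < \<delta>" "0 < \<eta>"
  then obtain F r where F: "finite F" "A \<subseteq> \<Union>F" "\<And>V. V \<in> F \<Longrightarrow> bounded V \<and> diameter V \<le> r"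
      "r \<le> min \<delta> \<eta>" "real (card F) * r powr s \<le> min \<delta> \<eta>"
    using assms(2)[of "min \<delta> \<eta>"] by auto
  obtain f where f: "bij_betw f {..<card F} F"
    using F(1) ex_bij_betw_nat_finite by (metis lessThan_atLeast0)
  \<comment> \<open>Covers are sequences; empty sets, whose gauge is 0, fill the tail.\<close>
  define U where "U k = (if k < card F then f k else {})" for k
  have fF: "f k \<in> F" if "k < card F" for k
    using f that by (auto simp: bij_betw_def)
  have "A \<subseteq> (\<Union>k. U k)"
  proof
    fix x assume "x \<in> A"
    then obtain V where "V \<in> F" "x \<in> V" using F by auto
    then obtain k where "k < card F" "x \<in> f k" using f by (auto simp: bij_betw_def)
    then show "x \<in> (\<Union>k. U k)" by (auto simp: U_def)
  qed
  then have "U \<in> delta_covers \<delta> A"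
    using F(3)[OF fF] F(4) \<open>0 < \<delta>\<close> by (fastforce simp: delta_covers_def U_def diameter_empty)
  moreover have "(\<Sum>k. hausdorff_gauge s (U k)) \<le> ennreal \<eta>"
  proof -
    have "(\<Sum>k. hausdorff_gauge s (U k)) = (\<Sum>k<card F. hausdorff_gauge s (U k))"
      by (rule suminf_finite) (auto simp: U_def hausdorff_gauge_def)
    also have "\<dots> \<le> (\<Sum>k<card F. ennreal (r powr s))"
      using F(3)[OF fF] assms(1)
      by (intro sum_mono)
        (auto simp: U_def hausdorff_gauge_def diameter_ge_0 intro!: ennreal_leI powr_mono2)
    also have "\<dots> = ennreal (real (card F) * r powr s)"
      by (simp add: ennreal_mult ennreal_of_nat_eq_real_of_nat)
    also have "\<dots> \<le> ennreal \<eta>" using F(5) by (intro ennreal_leI) auto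
    finally show ?thesis .
  qed
  ultimately show "\<exists>U\<in>delta_covers \<delta> A. (\<Sum>k. hausdorff_gauge s (U k)) \<le> ennreal \<eta>" by blast
qed

lemma diameter_image_le:
  assumes "\<And>x y. dist (f x) (f y) \<le> dist x y" "bounded U"
  shows "bounded (f ` U)" "diameter (f ` U) \<le> diameter U"
proof -
  show "bounded (f ` U)"
  proof (cases "U = {}")
    case False
    then obtain x where x: "x \<in> U" by auto
    obtain e where "\<forall>y\<in>U. dist x y \<le> e" using assms(2) bounded_any_center by blast
    then have "\<forall>y\<in>f ` U. dist (f x) y \<le> e" using assms(1) order_trans by blast
    then show ?thesis unfolding bounded_def by blast
  qed simp
  show "diameter (f ` U) \<le> diameter U"
  proof (cases "U = {}")
    case False
    then show ?thesis
      unfolding diameter_def[of "f ` U"]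
      using assms(1) diameter_bounded_bound[OF assms(2)]
      by (auto intro!: cSUP_least order_trans[OF assms(1)])
  qed simp
qed

lemma hausdorff_dim_image_le:
  assumes "\<And>x y. dist (f x) (f y) \<le> dist x y"
  shows "hausdorff_dim (f ` A) \<le> hausdorff_dim A"
  unfolding hausdorff_dim_def
proof (rule INF_superset_mono)
  show "{s. 0 \<le> s \<and> hausdorff_measure s A = 0} \<subseteq> {s. 0 \<le> s \<and> hausdorff_measure s (f ` A) = 0}"
  proof safe
    fix s :: real assume s: "0 \<le> s" "hausdorff_measure s A = 0"
    show "hausdorff_measure s (f ` A) = 0"
    proof (rule hausdorff_measure_eq_0I)
      fix \<delta> \<eta> :: real assume "0 < \<delta>" "0 < \<eta>"
      then obtain U where U: "U \<in> delta_covers \<delta> A" "(\<Sum>k. hausdorff_gauge s (U k)) < ennreal \<eta>"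
        using hausdorff_measure_eq_0D[OF s(2)] by blast
      have b: "bounded (U k)" "diameter (U k) \<le> \<delta>" for k using U by (auto simp: delta_covers_def)
      have "(\<lambda>k. f ` U k) \<in> delta_covers \<delta> (f ` A)"
        using U(1) diameter_image_le[OF assms b(1)] order_trans[OF diameter_image_le(2)[OF assms b(1)] b(2)]
        unfolding delta_covers_def by blast
      moreover have "hausdorff_gauge s (f ` U k) \<le> hausdorff_gauge s (U k)" for k
        using diameter_image_le[OF assms b(1)] s(1)
        by (auto simp: hausdorff_gauge_def intro!: ennreal_leI powr_mono2 diameter_ge_0)
      then have "(\<Sum>k. hausdorff_gauge s (f ` U k)) \<le> (\<Sum>k. hausdorff_gauge s (U k))"
        by (intro suminf_le) auto
      ultimately show "\<exists>V\<in>delta_covers \<delta> (f ` A). (\<Sum>k. hausdorff_gauge s (V k)) \<le> ennreal \<eta>"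
        using U(2) by (intro bexI[of _ "\<lambda>k. f ` U k"]) auto
    qed
  qed
qed auto

lemma power_scale_exists:
  fixes \<rho> x :: real
  assumes "0 < \<rho>" "\<rho> < 1" "0 < x" "x \<le> 1"
  obtains p :: nat where "\<rho> ^ Suc p < x" "x \<le> \<rho> ^ p"
proof -
  define p where "p = (LEAST p. \<rho> ^ Suc p < x)"
  obtain N where "\<rho> ^ N < x" using real_arch_pow_inv[OF assms(3,2)] by blast
  moreover have "\<rho> ^ Suc N \<le> \<rho> ^ N" using assms by (intro power_decreasing) auto
  ultimately have ex: "\<rho> ^ Suc N < x" by linarith
  have 1: "\<rho> ^ Suc p < x" unfolding p_def using ex by (rule LeastI)
  have 2: "x \<le> \<rho> ^ p"
  proof (cases p)
    case (Suc k)
    then have "\<not> \<rho> ^ Suc k < x" using not_less_Least[of k "\<lambda>p. \<rho> ^ Suc p < x"] p_def by simp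
    then show ?thesis using Suc by simp
  qed (use assms in auto)
  show ?thesis using that 1 2 by blast
qed

text \<open>A mass distribution principle in which the measure is replaced by finite point families.\<close>

lemma finitary_mass_distribution:
  fixes A :: "'a::metric_space set"
  assumes "compact A" "0 < \<rho>" "\<rho> < 1" "0 < C" "0 \<le> s'" "s' \<le> s" "0 < s"
    and fam: "\<And>P::nat. \<exists>(\<Omega>::'w set) pt G. finite \<Omega> \<and> \<Omega> \<noteq> {} \<and> pt ` \<Omega> \<subseteq> A \<and> G \<subseteq> \<Omega> \<and>
        card \<Omega> \<le> 2 * card G \<and>
        (\<forall>\<omega>\<in>G. \<forall>p\<le>P. real (card {\<omega>'\<in>\<Omega>. dist (pt \<omega>) (pt \<omega>') \<le> \<rho> ^ p})
            \<le> C * (\<rho> ^ p) powr s * real (card \<Omega>))"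
  shows "hausdorff_measure s' A \<noteq> 0"
proof
  assume H0: "hausdorff_measure s' A = 0"
  \<comment> \<open>The factor \<open>2 / \<rho>\<close> pays for passing from the radius
    \<open>r k\<close> to a power of \<rho> above \<open>2 * r k\<close>.\<close>
  define D where "D = C * (2 / \<rho>) powr s"
  have D: "0 < D" using assms by (simp add: D_def)
  \<comment> \<open>Chosen so that the balls together hold at most a quarter of the family, whereas
    \<open>G\<close> is at least half of it.\<close>
  define \<eta> where "\<eta> = 1 / (4 * D * (2 powr s + 1))"
  have \<eta>: "0 < \<eta>" using D by (auto simp: \<eta>_def intro!: mult_pos_pos add_pos_pos)
  \<comment> \<open>Diameter at most \<open>1/4\<close> will give \<open>2 * r k \<le> 1\<close>,
    which rounding to a power of \<rho> requires.\<close>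
  obtain U where U: "U \<in> delta_covers (1/4) A" "(\<Sum>k. hausdorff_gauge s' (U k)) < ennreal \<eta>"
    using hausdorff_measure_eq_0D[OF H0 _ \<eta>, of "1/4"] by auto
  define g where "g k = enn2real (hausdorff_gauge s' (U k))" for k
  have fin: "hausdorff_gauge s' (U k) < top" for k by (auto simp: hausdorff_gauge_def)
  have g: "ennreal (g k) = hausdorff_gauge s' (U k)" for k using fin by (simp add: g_def)
  have gpos: "0 \<le> g k" for k by (simp add: g_def)
  have Ub: "bounded (U k)" "diameter (U k) \<le> 1/4" for k using U(1) by (auto simp: delta_covers_def)
  have gsum: "sum g T \<le> \<eta>" if "finite T" for T
  proof -
    have "ennreal (sum g T) = (\<Sum>k\<in>T. hausdorff_gauge s' (U k))"
      by (simp add: sum_ennreal[symmetric] gpos g)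
    also have "\<dots> \<le> (\<Sum>k. hausdorff_gauge s' (U k))" using that by (intro sum_le_suminf) auto
    also have "\<dots> \<le> ennreal \<eta>" using U(2) by simp
    finally show ?thesis using \<eta> by (simp add: ennreal_le_iff)
  qed
  define N where "N = {k. U k \<noteq> {}}"
  have dg: "diameter (U k) powr s \<le> g k" if "k \<in> N" for k
  proof -
    have "diameter (U k) powr s \<le> (if s' = 0 then 1 else diameter (U k) powr s')"
    proof (cases "s' = 0")
      case True
      have "diameter (U k) powr s \<le> 1 powr s" using Ub(2)[of k] assms
        by (intro powr_mono2) (auto simp: diameter_ge_0 Ub)
      then show ?thesis using True by simp
    next
      case False
      then show ?thesis using Ub(2)[of k] assms
        by (auto simp: powr_mono' diameter_ge_0 Ub)
    qed
    also have "\<dots> = g k" using that by (auto simp: g_def hausdorff_gauge_def N_def)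
    finally show ?thesis .
  qed
  \<comment> \<open>Sets of diameter 0 need a positive radius before compactness can be applied to
    open balls; the \<open>s\<close>-th powers of the \<open>e k\<close> sum to at most
    \<eta>.\<close>
  define e where "e k = min (1/2) ((\<eta> / 2 ^ Suc k) powr (1 / s))" for k :: nat
  have e: "0 < e k" "e k \<le> 1/2" "e k powr s \<le> \<eta> / 2 ^ Suc k" for k
  proof -
    show "0 < e k" "e k \<le> 1/2" using \<eta> by (auto simp: e_def)
    have "e k powr s \<le> ((\<eta> / 2 ^ Suc k) powr (1 / s)) powr s"
      using assms \<eta> by (intro powr_mono2) (auto simp: e_def)
    then show "e k powr s \<le> \<eta> / 2 ^ Suc k" using assms \<eta> by (simp add: powr_powr)
  qed
  define x where "x k = (SOME y. y \<in> U k)" for k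
  have x: "x k \<in> U k" if "k \<in> N" for k
    using that unfolding x_def N_def by (auto intro: someI)
  define r where "r k = (if diameter (U k) = 0 then e k else 2 * diameter (U k))" for k
  have r: "0 < r k" "2 * r k \<le> 1" "diameter (U k) < r k" for k
    using e[of k] Ub[of k] diameter_ge_0[of "U k"] by (auto simp: r_def)
  have rs: "r k powr s \<le> 2 powr s * g k + \<eta> / 2 ^ Suc k" if "k \<in> N" for k
  proof (cases "diameter (U k) = 0")
    case True
    then show ?thesis using e(3)[of k] gpos[of k] by (simp add: r_def add_increasing)
  next
    case False
    have "2 powr s * diameter (U k) powr s \<le> 2 powr s * g k"
      using dg[OF that] by (intro mult_left_mono) auto
    then show ?thesis using False \<eta> diameter_ge_0[OF Ub(1)]
      by (simp add: r_def powr_mult add_increasing2)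
  qed
  have "A \<subseteq> (\<Union>k\<in>N. ball (x k) (r k))"
  proof
    fix y assume "y \<in> A"
    then obtain k where k: "y \<in> U k" using U(1) by (auto simp: delta_covers_def)
    then have "k \<in> N" by (auto simp: N_def)
    moreover have "dist (x k) y \<le> diameter (U k)"
      using k x[OF calculation] Ub by (intro diameter_bounded_bound) auto
    ultimately show "y \<in> (\<Union>k\<in>N. ball (x k) (r k))" using r(3)[of k] by force
  qed
  then obtain T where T: "T \<subseteq> N" "finite T" "A \<subseteq> (\<Union>k\<in>T. ball (x k) (r k))"
    using compactE_image[OF assms(1), of N "\<lambda>k. ball (x k) (r k)"] by auto
  have "\<exists>p. \<rho> ^ Suc p < 2 * r k \<and> 2 * r k \<le> \<rho> ^ p" for k
    using power_scale_exists[OF assms(2,3), of "2 * r k"] r[of k] by auto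
  then obtain p where p: "\<And>k. \<rho> ^ Suc (p k) < 2 * r k" "\<And>k. 2 * r k \<le> \<rho> ^ p k" by metis
  \<comment> \<open>Only now is the resolution known: compactness has left finitely many scales
    \<open>p k\<close>, all at most \<open>sum p T\<close>.\<close>
  obtain \<Omega> :: "'w set" and pt G where \<Omega>: "finite \<Omega>" "\<Omega> \<noteq> {}" "pt ` \<Omega> \<subseteq> A" "G \<subseteq> \<Omega>"
      "card \<Omega> \<le> 2 * card G"
      "\<And>\<omega> q. \<omega> \<in> G \<Longrightarrow> q \<le> sum p T \<Longrightarrow> real (card {\<omega>'\<in>\<Omega>. dist (pt \<omega>) (pt \<omega>') \<le> \<rho> ^ q})
            \<le> C * (\<rho> ^ q) powr s * real (card \<Omega>)"
    using fam[of "sum p T"] by blast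
  have finG: "finite G" using \<Omega> finite_subset by blast
  define B where "B k = {\<omega>\<in>G. pt \<omega> \<in> ball (x k) (r k)}" for k
  have Bk: "real (card (B k)) \<le> D * r k powr s * real (card \<Omega>)" if "k \<in> T" for k
  proof (cases "B k = {}")
    case True
    then show ?thesis using D by simp
  next
    case False
    \<comment> \<open>The centre \<open>x k\<close> need not be a point of the family, so the count
      is made around a member of \<open>G\<close>, at twice the radius.\<close>
    then obtain w where w: "w \<in> B k" by auto
    have "B k \<subseteq> {\<omega>'\<in>\<Omega>. dist (pt w) (pt \<omega>') \<le> \<rho> ^ p k}"
    proof
      fix v assume v: "v \<in> B k"
      have "dist (pt w) (pt v) \<le> dist (x k) (pt w) + dist (x k) (pt v)" by (rule dist_triangle3)
      also have "\<dots> \<le> 2 * r k" using v w by (auto simp: B_def)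
      finally show "v \<in> {\<omega>'\<in>\<Omega>. dist (pt w) (pt \<omega>') \<le> \<rho> ^ p k}"
        using p(2)[of k] v \<Omega>(4) by (auto simp: B_def)
    qed
    then have "card (B k) \<le> card {\<omega>'\<in>\<Omega>. dist (pt w) (pt \<omega>') \<le> \<rho> ^ p k}"
      using \<Omega>(1) by (intro card_mono) auto
    also have "real \<dots> \<le> C * (\<rho> ^ p k) powr s * real (card \<Omega>)"
      using w T(2) that by (intro \<Omega>(6)) (auto simp: B_def intro: member_le_sum)
    also have "\<dots> \<le> C * (2 / \<rho> * r k) powr s * real (card \<Omega>)"
    proof -
      have "\<rho> ^ p k \<le> 2 / \<rho> * r k" using p(1)[of k] assms(2) by (simp add: field_simps)
      then show ?thesis using assms r[of k]
        by (intro mult_right_mono mult_left_mono powr_mono2) auto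
    qed
    also have "\<dots> = D * r k powr s * real (card \<Omega>)"
      using powr_mult[of "2 / \<rho>" "r k" s] assms r[of k] by (simp add: D_def)
    finally show ?thesis by simp
  qed
  have Gs: "G = (\<Union>k\<in>T. B k)"
    using T(3) \<Omega>(3,4) unfolding B_def by blast
  have "real (card G) \<le> (\<Sum>k\<in>T. real (card (B k)))"
    unfolding Gs using card_UN_le[OF T(2), of B] by (metis of_nat_le_iff of_nat_sum)
  also have "\<dots> \<le> (\<Sum>k\<in>T. D * r k powr s * real (card \<Omega>))" using Bk by (intro sum_mono) auto
  also have "\<dots> = D * real (card \<Omega>) * (\<Sum>k\<in>T. r k powr s)"
    by (simp add: sum_distrib_left mult_ac)
  also have "\<dots> \<le> D * real (card \<Omega>) * (\<Sum>k\<in>T. 2 powr s * g k + \<eta> / 2 ^ Suc k)"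
    using rs T(1) D by (intro mult_left_mono sum_mono) auto
  also have "(\<Sum>k\<in>T. 2 powr s * g k + \<eta> / 2 ^ Suc k) = 2 powr s * sum g T + \<eta> * (\<Sum>k\<in>T. (1/2) ^ Suc k)"
    by (simp add: sum.distrib sum_distrib_left power_divide)
  also have "D * real (card \<Omega>) * \<dots> \<le> D * real (card \<Omega>) * (2 powr s * \<eta> + \<eta> * 1)"
  proof -
    have "(\<Sum>k\<in>T. (1/2::real) ^ Suc k) \<le> (\<Sum>k. (1/2) ^ Suc k)"
      using T(2) power_half_series by (intro sum_le_suminf) (auto simp: sums_iff)
    then have "(\<Sum>k\<in>T. (1/2::real) ^ Suc k) \<le> 1" using power_half_series by (simp add: sums_iff)
    then show ?thesis
      using gsum[OF T(2)] \<eta> D by (intro mult_left_mono add_mono) auto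
  qed
  also have "\<dots> = real (card \<Omega>) / 4"
  proof -
    have "2 powr s + 1 \<noteq> 0" by (smt (verit) powr_ge_zero)
    then have "4 * (D * (2 powr s + 1) * \<eta>) = 1" using D by (simp add: \<eta>_def)
    then have "4 * (D * (2 powr s * \<eta> + \<eta> * 1)) = 1" by (simp add: algebra_simps)
    then show ?thesis by (simp add: mult_ac)
  qed
  finally have "4 * card G \<le> card \<Omega>" by linarith
  then have "card \<Omega> = 0" using \<Omega>(5) by linarith
  then show False using \<Omega> by simp
qed

section \<open>Irrational rotations\<close>

definition rot_arc :: "nat \<Rightarrow> real \<Rightarrow> nat \<Rightarrow> nat" where
  "rot_arc L \<alpha> p = nat \<lfloor>real L * frac (real p * \<alpha>)\<rfloor>"

lemma rot_arc_bounds: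
  assumes "0 < L"
  shows "real (rot_arc L \<alpha> p) \<le> real L * frac (real p * \<alpha>)" "real L * frac (real p * \<alpha>) < real (rot_arc L \<alpha> p) + 1"
    "rot_arc L \<alpha> p < L"
proof -
  have 0: "0 \<le> real L * frac (real p * \<alpha>)" "real L * frac (real p * \<alpha>) < real L"
    using assms by (auto simp: frac_ge_0 frac_lt_1)
  then show 1: "real (rot_arc L \<alpha> p) \<le> real L * frac (real p * \<alpha>)"
    "real L * frac (real p * \<alpha>) < real (rot_arc L \<alpha> p) + 1"
    unfolding rot_arc_def by linarith+
  then have "real (rot_arc L \<alpha> p) < real L" using 0 by linarith
  then show "rot_arc L \<alpha> p < L" by simp
qed

text \<open>Only the upper bound in Weyl's theorem, with a lossy factor 2, is needed: pairwise disjoint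
  translates of an arc, provided by Kronecker's density theorem, are all visited about as often.\<close>

lemma rotation_visits:
  fixes \<alpha> :: real
  assumes "\<alpha> \<notin> \<rat>" "0 < M"
  shows "\<exists>C. \<forall>P. real (card {p\<in>{..<P}. rot_arc (2 * M) \<alpha> p = j}) \<le> real P / real M + C"
proof -
  define L where "L = 2 * M"
  have L: "0 < L" using assms by (simp add: L_def)
  \<comment> \<open>Rotating by \<open>k i\<close> steps moves a point forward by strictly between
    \<open>2 * i\<close> and \<open>2 * i + 1\<close> arcs. An arc then lands in two neighbouring
    arcs, and the pairs for different \<open>i\<close> are disjoint modulo \<open>L\<close>; this is
    why \<open>M\<close> translates take \<open>2 * M\<close> arcs.\<close>
  have "\<exists>k. 2 * real i / L < frac (real k * \<alpha>) \<and> frac (real k * \<alpha>) < (2 * real i + 1) / L" if "i < M" for i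
  proof -
    have "(2 * real i + 1/2) / L \<le> 1" using that by (simp add: L_def field_simps)
    then obtain k where "\<bar>frac(real k * \<alpha>) - (2 * real i + 1/2) / L\<bar> < 1 / (2 * L)"
      using Kronecker_approx_1_explicit[OF assms(1), of "(2 * real i + 1/2) / L" "1 / (2 * L)"] L
      by auto
    then show ?thesis using L by (intro exI[of _ k]) (auto simp: abs_less_iff field_simps)
  qed
  then obtain k where k: "\<And>i. i < M \<Longrightarrow> 2 * real i / L < frac (real (k i) * \<alpha>)"
      "\<And>i. i < M \<Longrightarrow> frac (real (k i) * \<alpha>) < (2 * real i + 1) / L" by metis
  have shift: "rot_arc L \<alpha> (p + k i) \<in> {j + 2 * i, j + 2 * i + 1} \<or>
      rot_arc L \<alpha> (p + k i) + L \<in> {j + 2 * i, j + 2 * i + 1}"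
    if "rot_arc L \<alpha> p = j" "i < M" for p i
  proof -
    define x where "x = real L * frac (real p * \<alpha>)"
    define y where "y = real L * frac (real (k i) * \<alpha>)"
    define z where "z = real L * frac (real (p + k i) * \<alpha>)"
    have "real j \<le> x" "x < real j + 1"
      using rot_arc_bounds[OF L, where \<alpha> = \<alpha> and p = p] that(1) by (auto simp: x_def y_def z_def)
    moreover have "2 * real i < y" "y < 2 * real i + 1"
      using k[OF that(2)] L by (auto simp: x_def y_def z_def field_simps)
    moreover have "z = x + y \<or> z = x + y - L"
      unfolding x_def y_def z_def by (simp add: distrib_right frac_add algebra_simps)
    moreover have "real (rot_arc L \<alpha> (p + k i)) \<le> z" "z < real (rot_arc L \<alpha> (p + k i)) + 1"
      using rot_arc_bounds[OF L, where \<alpha> = \<alpha> and p = "p + k i"] by (auto simp: x_def y_def z_def)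
    ultimately show ?thesis by auto
  qed
  have "M * card {p\<in>{..<P}. rot_arc L \<alpha> p = j} \<le> P + sum k {..<M}" for P
  proof -
    let ?V = "{p\<in>{..<P}. rot_arc L \<alpha> p = j}"
    \<comment> \<open>The \<open>M\<close> shifted copies of the set of visit times are disjoint and
      fit into \<open>P + sum k {..<M}\<close> times.\<close>
    have "inj_on (\<lambda>(p, i). p + k i) (?V \<times> {..<M})"
    proof (rule inj_onI)
      fix x x' assume x: "x \<in> ?V \<times> {..<M}" "x' \<in> ?V \<times> {..<M}"
        "(\<lambda>(p, i). p + k i) x = (\<lambda>(p, i). p + k i) x'"
      obtain p i p' i' where xp: "x = (p, i)" "x' = (p', i')" by (cases x, cases x')
      then have *: "rot_arc L \<alpha> p = j" "rot_arc L \<alpha> p' = j" "i < M" "i' < M" "p + k i = p' + k i'"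
        using x by auto
      have "i = i'"
        using shift[OF *(1,3)] shift[OF *(2,4)] *(3-5) by (auto simp: L_def)
      then show "x = x'" using *(5) xp by simp
    qed
    moreover have "(\<lambda>(p, i). p + k i) ` (?V \<times> {..<M}) \<subseteq> {..<P + sum k {..<M}}"
    proof clarify
      fix p i assume "p < P" "i < M"
      then show "p + k i < P + sum k {..<M}"
        using member_le_sum[of i "{..<M}" k] by auto
    qed
    ultimately have "card (?V \<times> {..<M}) \<le> card {..<P + sum k {..<M}}"
      by (intro card_inj_on_le[where f = "\<lambda>(p, i). p + k i"]) auto
    then show ?thesis by (simp add: card_cartesian_product mult.commute)
  qed
  then have "real M * real (card {p\<in>{..<P}. rot_arc L \<alpha> p = j}) \<le> real P + real (sum k {..<M})" for P
    by (metis of_nat_add of_nat_le_iff of_nat_mult)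
  then have "real (card {p\<in>{..<P}. rot_arc L \<alpha> p = j}) \<le> real P / real M + real (sum k {..<M}) / real M" for P
    using assms(2) by (simp add: field_simps add_divide_distrib[symmetric])
  then show ?thesis unfolding L_def by blast
qed

lemma rotation_visits_set:
  fixes \<alpha> :: real
  assumes "\<alpha> \<notin> \<rat>" "0 < M" "finite J"
  obtains C where "0 \<le> C" "\<And>P. real (card {p\<in>{..<P}. rot_arc (2 * M) \<alpha> p \<in> J}) \<le> real (card J) * (real P / real M) + C"
proof -
  obtain C where C: "\<And>j P. real (card {p\<in>{..<P}. rot_arc (2 * M) \<alpha> p = j}) \<le> real P / real M + C j"
    using rotation_visits[OF assms(1,2)] by metis
  have "real (card {p\<in>{..<P}. rot_arc (2 * M) \<alpha> p \<in> J}) \<le> real (card J) * (real P / real M) + \<bar>sum C J\<bar>" for P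
  proof -
    have "{p\<in>{..<P}. rot_arc (2 * M) \<alpha> p \<in> J} = (\<Union>j\<in>J. {p\<in>{..<P}. rot_arc (2 * M) \<alpha> p = j})" by auto
    then have "card {p\<in>{..<P}. rot_arc (2 * M) \<alpha> p \<in> J} \<le> (\<Sum>j\<in>J. card {p\<in>{..<P}. rot_arc (2 * M) \<alpha> p = j})"
      by (simp only: card_UN_le[OF assms(3)])
    then have "real (card {p\<in>{..<P}. rot_arc (2 * M) \<alpha> p \<in> J})
        \<le> (\<Sum>j\<in>J. real (card {p\<in>{..<P}. rot_arc (2 * M) \<alpha> p = j}))"
      unfolding of_nat_sum[symmetric] of_nat_le_iff .
    also have "\<dots> \<le> (\<Sum>j\<in>J. real P / real M + C j)" using C by (intro sum_mono) auto
    also have "\<dots> = real (card J) * (real P / real M) + sum C J" by (simp add: sum.distrib)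
    finally show ?thesis by linarith
  qed
  then show ?thesis using that[of "\<bar>sum C J\<bar>"] by simp
qed

section \<open>Separated points and near pairs\<close>

text \<open>Rounding down to cells of length \<delta> is injective on \<delta>-separated
  values.\<close>

lemma card_separated_le:
  fixes f :: "'a \<Rightarrow> real"
  assumes "0 < \<delta>" "0 \<le> R"
    and "\<And>x. x \<in> S \<Longrightarrow> \<bar>f x - z\<bar> \<le> R"
    and "\<And>x y. x \<in> S \<Longrightarrow> y \<in> S \<Longrightarrow> x \<noteq> y \<Longrightarrow> \<delta> \<le> \<bar>f x - f y\<bar>"
  shows "real (card S) \<le> 2 * R / \<delta> + 1"
proof -
  define g where "g x = nat \<lfloor>(f x - z + R) / \<delta>\<rfloor>" for x
  have nn: "0 \<le> (f x - z + R) / \<delta>" "(f x - z + R) / \<delta> \<le> 2 * R / \<delta>" if "x \<in> S" for x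
    using assms(3)[OF that] assms(1) by (auto simp: abs_le_iff intro!: divide_right_mono)
  have "inj_on g S"
  proof (rule inj_onI, rule ccontr)
    fix x y assume *: "x \<in> S" "y \<in> S" "g x = g y" "x \<noteq> y"
    have "\<bar>(f x - z + R) / \<delta> - (f y - z + R) / \<delta>\<bar> < 1"
      using nn(1)[OF *(1)] nn(1)[OF *(2)] *(3) unfolding g_def by linarith
    then have "\<bar>(f x - f y) / \<delta>\<bar> < 1" by (simp add: diff_divide_distrib[symmetric])
    then have "\<bar>f x - f y\<bar> < \<delta>" using assms(1) by (simp add: abs_divide)
    then show False using assms(4)[OF *(1,2,4)] by simp
  qed
  moreover have "g ` S \<subseteq> {..nat \<lfloor>2 * R / \<delta>\<rfloor>}"
    using nn(2) by (auto simp: g_def intro!: nat_mono floor_mono)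
  ultimately have "card S \<le> card {..nat \<lfloor>2 * R / \<delta>\<rfloor>}" by (intro card_inj_on_le) auto
  then have "card S \<le> nat \<lfloor>2 * R / \<delta>\<rfloor> + 1" by simp
  moreover have "0 \<le> 2 * R / \<delta>" using assms by simp
  ultimately show ?thesis by linarith
qed

lemma sum_card_fibres:
  assumes "finite A" "finite B" "finite I"
  shows "(\<Sum>n\<in>I. card {x\<in>A. \<phi> x = n} * card {y\<in>B. \<psi> y = n})
    = card {(x, y). x \<in> A \<and> y \<in> B \<and> \<phi> x = \<psi> y \<and> \<phi> x \<in> I}"
proof -
  have "{(x, y). x \<in> A \<and> y \<in> B \<and> \<phi> x = \<psi> y \<and> \<phi> x \<in> I}
      = (\<Union>n\<in>I. {x\<in>A. \<phi> x = n} \<times> {y\<in>B. \<psi> y = n})" by auto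
  also have "card \<dots> = (\<Sum>n\<in>I. card ({x\<in>A. \<phi> x = n} \<times> {y\<in>B. \<psi> y = n}))"
    using assms by (intro card_UN_disjoint) auto
  finally show ?thesis by (simp add: card_cartesian_product)
qed

text \<open>An unnormalised correlation sum at scale \<delta>. Two families are allowed because
  points below two different approximate squares have to be compared.\<close>

definition near_pairs :: "real \<Rightarrow> 'a set \<Rightarrow> ('a \<Rightarrow> real) \<Rightarrow> 'b set \<Rightarrow> ('b \<Rightarrow> real) \<Rightarrow> ('a \<times> 'b) set" where
  "near_pairs \<delta> A f B g = {(x, y). x \<in> A \<and> y \<in> B \<and> \<bar>f x - g y\<bar> \<le> \<delta>}"

lemma finite_near_pairs [simp]: "finite A \<Longrightarrow> finite B \<Longrightarrow> finite (near_pairs \<delta> A f B g)"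
  by (rule finite_subset[of _ "A \<times> B"]) (auto simp: near_pairs_def)

lemma card_eq_sum_of_bool:
  "finite A \<Longrightarrow> real (card {x\<in>A. P x}) = (\<Sum>x\<in>A. of_bool (P x))"
  by (simp add: of_bool_def sum.If_cases Int_def)

lemma card_near_pairs_eq_sum:
  assumes "finite A" "finite B"
  shows "real (card (near_pairs \<delta> A f B g)) = (\<Sum>x\<in>A. \<Sum>y\<in>B. of_bool (\<bar>f x - g y\<bar> \<le> \<delta>))"
proof -
  have "near_pairs \<delta> A f B g = {z\<in>A \<times> B. \<bar>f (fst z) - g (snd z)\<bar> \<le> \<delta>}"
    by (auto simp: near_pairs_def)
  then have "real (card (near_pairs \<delta> A f B g)) = (\<Sum>z\<in>A \<times> B. of_bool (\<bar>f (fst z) - g (snd z)\<bar> \<le> \<delta>))"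
    using assms by (simp only: card_eq_sum_of_bool finite_cartesian_product)
  then show ?thesis by (simp only: sum.cartesian_product case_prod_unfold)
qed

text \<open>Cutting the line into cells of length \<open>\<delta>\<close> makes both sides sums of products of cell counts,
  which are compared by \<open>2 * x * y \<le> x\<^sup>2 + y\<^sup>2\<close>.\<close>

lemma card_near_pairs_cross:
  fixes f :: "'a \<Rightarrow> real" and g :: "'b \<Rightarrow> real"
  assumes "finite A" "finite B" "0 < \<delta>"
  shows "2 * card (near_pairs \<delta> A f B g) \<le> 3 * (card (near_pairs \<delta> A f A f) + card (near_pairs \<delta> B g B g))"
proof -
  define \<phi> where "\<phi> x = \<lfloor>f x / \<delta>\<rfloor>" for x
  \<comment> \<open>Near points lie in the same cell or in adjacent ones. The shift \<sigma> in
    \<open>{-1, 0, 1}\<close> records which, and these three cases produce the factor 3.\<close>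
  define \<psi> where "\<psi> \<sigma> y = \<lfloor>g y / \<delta>\<rfloor> - \<sigma>" for \<sigma> y
  define S where "S \<sigma> = {(x, y). x \<in> A \<and> y \<in> B \<and> \<phi> x = \<psi> \<sigma> y \<and> \<phi> x \<in> \<phi> ` A}" for \<sigma>
  have cell: "\<bar>u - v\<bar> \<le> \<delta>" if "\<lfloor>u / \<delta>\<rfloor> = \<lfloor>v / \<delta>\<rfloor>" for u v
  proof -
    have "\<bar>u / \<delta> - v / \<delta>\<bar> < 1" using that by linarith
    then have "\<bar>(u - v) / \<delta>\<bar> < 1" by (simp add: diff_divide_distrib)
    then show ?thesis using assms(3) by (simp add: abs_divide)
  qed
  have S: "2 * card (S \<sigma>) \<le> card (near_pairs \<delta> A f A f) + card (near_pairs \<delta> B g B g)" for \<sigma>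
  proof -
    let ?a = "\<lambda>n. card {x\<in>A. \<phi> x = n}" and ?b = "\<lambda>n. card {y\<in>B. \<psi> \<sigma> y = n}"
    have "2 * card (S \<sigma>) = (\<Sum>n\<in>\<phi> ` A. 2 * (?a n * ?b n))"
      unfolding S_def using assms by (subst sum_card_fibres[symmetric]) (auto simp: sum_distrib_left)
    also have "\<dots> \<le> (\<Sum>n\<in>\<phi> ` A. ?a n * ?a n + ?b n * ?b n)"
    proof (rule sum_mono)
      fix n
      have "2 * (x * y) \<le> x * x + y * y" for x y :: nat
        using linear[of x y] by (auto simp: le_iff_add algebra_simps)
      then show "2 * (?a n * ?b n) \<le> ?a n * ?a n + ?b n * ?b n" .
    qed
    also have "\<dots> = card {(x, y). x \<in> A \<and> y \<in> A \<and> \<phi> x = \<phi> y \<and> \<phi> x \<in> \<phi> ` A}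
        + card {(x, y). x \<in> B \<and> y \<in> B \<and> \<psi> \<sigma> x = \<psi> \<sigma> y \<and> \<psi> \<sigma> x \<in> \<phi> ` A}"
      using assms by (simp add: sum.distrib sum_card_fibres)
    also have "\<dots> \<le> card (near_pairs \<delta> A f A f) + card (near_pairs \<delta> B g B g)"
      using assms by (intro add_mono card_mono finite_near_pairs)
        (auto simp: near_pairs_def \<phi>_def \<psi>_def intro!: cell)
    finally show ?thesis .
  qed
  have "near_pairs \<delta> A f B g \<subseteq> S (-1) \<union> S 0 \<union> S 1"
  proof clarify
    fix x y assume "(x, y) \<in> near_pairs \<delta> A f B g" and ns: "(x, y) \<notin> S 1" "(x, y) \<notin> S 0"
    then have xy: "x \<in> A" "y \<in> B" "\<bar>f x - g y\<bar> \<le> \<delta>" by (auto simp: near_pairs_def)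
    then have "\<bar>(f x - g y) / \<delta>\<bar> \<le> 1" using assms(3) by (simp add: abs_divide)
    then have "\<bar>f x / \<delta> - g y / \<delta>\<bar> \<le> 1" by (simp add: diff_divide_distrib)
    then have "\<lfloor>g y / \<delta>\<rfloor> - \<lfloor>f x / \<delta>\<rfloor> \<in> {-1, 0, 1}" by auto linarith
    then show "(x, y) \<in> S (-1)" using xy ns by (auto simp: S_def \<phi>_def \<psi>_def)
  qed
  moreover have fS: "finite (S \<sigma>)" for \<sigma>
    by (rule finite_subset[of _ "A \<times> B"]) (use assms in \<open>auto simp: S_def\<close>)
  ultimately have "card (near_pairs \<delta> A f B g) \<le> card (S (-1) \<union> S 0 \<union> S 1)"
    by (intro card_mono) auto
  also have "\<dots> \<le> card (S (-1)) + card (S 0) + card (S 1)"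
    using card_Un_le by (meson add_le_mono1 order_trans)
  finally show ?thesis
    using add_mono[OF S[of "-1"] add_mono[OF S[of 0] S[of 1]]] by (simp add: algebra_simps)
qed

section \<open>Digit words\<close>

definition words :: "nat \<Rightarrow> nat \<Rightarrow> nat list set" where
  "words k N = {v. set v \<subseteq> {1..k} \<and> length v = N}"

lemma finite_words [simp]: "finite (words k N)"
  unfolding words_def using finite_lists_length_eq[of "{1..k}"] by simp

lemma card_words [simp]: "card (words k N) = k ^ N"
  unfolding words_def using card_lists_length_eq[of "{1..k}"] by simp

lemma words_0 [simp]: "words k 0 = {[]}"
  by (auto simp: words_def)

lemma words_append: "words k (h + g) = (\<lambda>(u, v). u @ v) ` (words k h \<times> words k g)"
proof -
  have "v \<in> (\<lambda>(u, v). u @ v) ` (words k h \<times> words k g)" if "v \<in> words k (h + g)" for v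
    using that by (intro image_eqI[of _ _ "(take h v, drop h v)"])
      (auto simp: words_def dest: in_set_takeD in_set_dropD)
  moreover have "u @ v \<in> words k (h + g)" if "u \<in> words k h" "v \<in> words k g" for u v
    using that by (auto simp: words_def)
  ultimately show ?thesis by auto
qed

lemma take_in_words: "v \<in> words k N \<Longrightarrow> h \<le> N \<Longrightarrow> take h v \<in> words k h"
  by (auto simp: words_def dest: in_set_takeD)

lemma drop_in_words: "v \<in> words k N \<Longrightarrow> drop h v \<in> words k (N - h)"
  by (auto simp: words_def dest: in_set_dropD)

lemma words_nth: "u \<in> words k N \<Longrightarrow> i < N \<Longrightarrow> u ! i \<in> {1..k}"
  unfolding words_def using nth_mem[of i u] by blast

lemma card_words_prefix:
  "h \<le> N \<Longrightarrow> card {v\<in>words k N. take h v \<in> X} = card (words k h \<inter> X) * k ^ (N - h)"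
proof -
  assume "h \<le> N"
  then obtain g where N: "N = h + g" using le_Suc_ex by blast
  have "{v\<in>words k N. take h v \<in> X} = (\<lambda>(u, v). u @ v) ` ((words k h \<inter> X) \<times> words k g)"
    unfolding N words_append by (auto simp: words_def)
  moreover have "inj_on (\<lambda>(u, v). u @ v) ((words k h \<inter> X) \<times> words k g)"
    by (auto simp: inj_on_def words_def)
  ultimately show ?thesis by (simp add: card_image card_cartesian_product N)
qed

text \<open>The digit positions \<open>G i\<close> may vary with the index, since the offset of a
  column digit depends on the row digit in the same place.\<close>

primrec word_val :: "real \<Rightarrow> (nat \<Rightarrow> nat \<Rightarrow> real) \<Rightarrow> nat list \<Rightarrow> real" where
  "word_val r G [] = 0"
| "word_val r G (j # v) = G 0 j + r * word_val r (\<lambda>i. G (Suc i)) v"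

lemma word_val_append:
  "word_val r G (v @ w) = word_val r G v + r ^ length v * word_val r (\<lambda>i. G (length v + i)) w"
  by (induction v arbitrary: G) (auto simp: algebra_simps)

lemma word_val_cong:
  "(\<And>i. i < length v \<Longrightarrow> G i = H i) \<Longrightarrow> word_val r G v = word_val r H v"
proof (induction v arbitrary: G H)
  case (Cons j v)
  then have "word_val r (\<lambda>i. G (Suc i)) v = word_val r (\<lambda>i. H (Suc i)) v" by (intro Cons.IH) auto
  then show ?case using Cons.prems[of 0] by simp
qed simp

text \<open>Arithmetic form of the geometric hypothesis: the intervals from \<open>G i j\<close> to
  \<open>G i j + r\<close> lie in the unit interval and do not overlap. Only \<open>N\<close> places
  are constrained, because a finite row word determines no more of them.\<close>

definition digit_system :: "real \<Rightarrow> nat \<Rightarrow> nat \<Rightarrow> (nat \<Rightarrow> nat \<Rightarrow> real) \<Rightarrow> bool" where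
  "digit_system r k N G \<longleftrightarrow> (\<forall>i<N. (\<forall>j\<in>{1..k}. 0 \<le> G i j \<and> G i j \<le> 1 - r) \<and>
     (\<forall>j\<in>{1..k}. \<forall>j'\<in>{1..k}. j \<noteq> j' \<longrightarrow> r \<le> \<bar>G i j - G i j'\<bar>))"

lemma digit_system_Suc: "digit_system r k (Suc N) G \<Longrightarrow> digit_system r k N (\<lambda>i. G (Suc i))"
  by (auto simp: digit_system_def)

lemma digit_system_mono: "digit_system r k N G \<Longrightarrow> h \<le> N \<Longrightarrow> digit_system r k h G"
  by (auto simp: digit_system_def)

lemma digit_system_shift:
  "digit_system r k N G \<Longrightarrow> h + g \<le> N \<Longrightarrow> digit_system r k g (\<lambda>i. G (h + i))"
  by (auto simp: digit_system_def)

lemma words_SucE: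
  assumes "v \<in> words k (Suc N)"
  obtains j w where "v = j # w" "j \<in> {1..k}" "w \<in> words k N"
  using assms by (cases v) (auto simp: words_def)

text \<open>The bound \<open>1 - r ^ N\<close> keeps room for the cylinder of length
  \<open>r ^ N\<close> to the right of the word; \<open>word_val_separated\<close> and the covering
  by approximate squares rely on it.\<close>

lemma word_val_range:
  assumes "digit_system r k N G" "v \<in> words k N" "0 < r" "r < 1"
  shows "0 \<le> word_val r G v" "word_val r G v \<le> 1 - r ^ N"
proof -
  have "0 \<le> word_val r G v \<and> word_val r G v \<le> 1 - r ^ N"
    using assms(1,2)
  proof (induction N arbitrary: v G)
    case (Suc N)
    obtain j w where v: "v = j # w" "j \<in> {1..k}" "w \<in> words k N" using words_SucE[OF Suc.prems(2)] .
    have "0 \<le> word_val r (\<lambda>i. G (Suc i)) w \<and> word_val r (\<lambda>i. G (Suc i)) w \<le> 1 - r ^ N"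
      by (rule Suc.IH[OF digit_system_Suc[OF Suc.prems(1)] v(3)])
    then have "0 \<le> r * word_val r (\<lambda>i. G (Suc i)) w" "r * word_val r (\<lambda>i. G (Suc i)) w \<le> r * (1 - r ^ N)"
      using assms(3) by (auto intro: mult_left_mono)
    moreover have "0 \<le> G 0 j" "G 0 j \<le> 1 - r"
      using Suc.prems(1) v(2) by (auto simp: digit_system_def)
    ultimately show ?case by (simp add: v(1) algebra_simps)
  qed simp
  then show "0 \<le> word_val r G v" "word_val r G v \<le> 1 - r ^ N" by auto
qed

lemma word_val_separated:
  assumes "digit_system r k N G" "v \<in> words k N" "v' \<in> words k N" "v \<noteq> v'" "0 < r" "r < 1"
  shows "r ^ N \<le> \<bar>word_val r G v - word_val r G v'\<bar>"
  using assms(1-4)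
proof (induction N arbitrary: v v' G)
  case (Suc N)
  obtain j w where v: "v = j # w" "j \<in> {1..k}" "w \<in> words k N" using words_SucE[OF Suc.prems(2)] .
  obtain j' w' where v': "v' = j' # w'" "j' \<in> {1..k}" "w' \<in> words k N" using words_SucE[OF Suc.prems(3)] .
  let ?x = "word_val r (\<lambda>i. G (Suc i)) w" and ?x' = "word_val r (\<lambda>i. G (Suc i)) w'"
  have ds: "digit_system r k N (\<lambda>i. G (Suc i))" by (rule digit_system_Suc[OF Suc.prems(1)])
  show ?case
  proof (cases "j = j'")
    case True
    then have "r ^ N \<le> \<bar>?x - ?x'\<bar>"
      using Suc.IH[OF ds v(3) v'(3)] Suc.prems(4) v v' by auto
    then have "r * r ^ N \<le> r * \<bar>?x - ?x'\<bar>" using assms(5) by simp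
    also have "\<dots> = \<bar>r * ?x - r * ?x'\<bar>" using assms(5) by (simp add: abs_mult right_diff_distrib[symmetric])
    finally show ?thesis using True v v' by simp
  next
    case False
    then have "r \<le> \<bar>G 0 j - G 0 j'\<bar>" using Suc.prems(1) v v' by (auto simp: digit_system_def)
    moreover have "0 \<le> r * ?x" "0 \<le> r * ?x'" "r * ?x \<le> r * (1 - r ^ N)" "r * ?x' \<le> r * (1 - r ^ N)"
      using word_val_range[OF ds v(3) assms(5,6)] word_val_range[OF ds v'(3) assms(5,6)] assms(5)
      by (auto intro: mult_left_mono)
    ultimately show ?thesis unfolding v(1) v'(1) by (simp add: algebra_simps)
  qed
qed simp

text \<open>A word near \<open>z\<close> has its prefix of length \<open>h\<close> within
  \<open>R + r ^ h\<close> of \<open>z\<close>; distinct prefixes are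
  \<open>r ^ h\<close>-separated, and each has \<open>k ^ (N - h)\<close> extensions.\<close>

lemma card_words_ball:
  assumes "digit_system r k N G" "0 < r" "r < 1" "h \<le> N" "0 \<le> R"
  shows "real (card {v\<in>words k N. \<bar>word_val r G v - z\<bar> \<le> R}) \<le> (2 * R / r ^ h + 3) * real k ^ (N - h)"
proof -
  define X where "X = {u. \<bar>word_val r G u - z\<bar> \<le> R + r ^ h}"
  have "{v\<in>words k N. \<bar>word_val r G v - z\<bar> \<le> R} \<subseteq> {v\<in>words k N. take h v \<in> X}"
  proof clarify
    fix v assume v: "v \<in> words k N" "\<bar>word_val r G v - z\<bar> \<le> R"
    have ds: "digit_system r k (N - h) (\<lambda>i. G (h + i))" using digit_system_shift[OF assms(1)] assms(4) by simp
    have len: "length (take h v) = h" using v assms(4) by (auto simp: words_def)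
    let ?y = "word_val r (\<lambda>i. G (h + i)) (drop h v)"
    have "word_val r G v = word_val r G (take h v) + r ^ h * ?y"
      using word_val_append[of r G "take h v" "drop h v"] len by simp
    moreover have "0 \<le> ?y" "?y \<le> 1"
      using word_val_range[OF ds drop_in_words[OF v(1)] assms(2,3)] zero_le_power[of r "N - h"] assms(2) by linarith+
    then have "0 \<le> r ^ h * ?y" "r ^ h * ?y \<le> r ^ h" using assms(2) by (auto simp: mult_left_le)
    ultimately show "take h v \<in> X" using v(2) by (auto simp: X_def)
  qed
  then have "card {v\<in>words k N. \<bar>word_val r G v - z\<bar> \<le> R} \<le> card (words k h \<inter> X) * k ^ (N - h)"
    unfolding card_words_prefix[OF assms(4), symmetric] by (intro card_mono) auto
  then have "real (card {v\<in>words k N. \<bar>word_val r G v - z\<bar> \<le> R}) \<le> real (card (words k h \<inter> X)) * real k ^ (N - h)"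
    unfolding of_nat_power[symmetric] of_nat_mult[symmetric] of_nat_le_iff .
  also have "real (card (words k h \<inter> X)) \<le> 2 * (R + r ^ h) / r ^ h + 1"
    using assms word_val_separated[OF digit_system_mono[OF assms(1,4)]]
    by (intro card_separated_le[where f = "word_val r G" and z = z]) (auto simp: X_def)
  also have "\<dots> = 2 * R / r ^ h + 3" using assms(2) by (simp add: field_simps)
  finally show ?thesis by (simp add: mult_right_mono)
qed

section \<open>Projections of one block\<close>

lemma affine_intervals_digit_system:
  assumes "0 < r"
    and sub: "\<forall>i\<in>{1..k}. (\<lambda>x. r * x + e i) ` {0..1} \<subseteq> {0..(1::real)}"
    and disj: "disjoint_family_on (\<lambda>i. interior ((\<lambda>x. r * x + e i) ` {0..(1::real)})) {1..k}"
  shows "digit_system r k N (\<lambda>_. e)"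
proof -
  have img: "(\<lambda>x. r * x + e i) ` {0..(1::real)} = {e i..r + e i}" for i
    using assms(1) by (simp add: image_affinity_atLeastAtMost)
  have "0 \<le> e j \<and> e j \<le> 1 - r" if "j \<in> {1..k}" for j
  proof -
    have "{e j..r + e j} \<subseteq> {0..1}" using sub that unfolding img by blast
    then show ?thesis using assms(1) by simp
  qed
  moreover have "r \<le> \<bar>e j - e j'\<bar>" if "j \<in> {1..k}" "j' \<in> {1..k}" "j \<noteq> j'" for j j'
  proof (rule ccontr)
    assume "\<not> r \<le> \<bar>e j - e j'\<bar>"
    then have lt: "\<bar>e j - e j'\<bar> < r" by simp
    have "interior {e j..r + e j} \<inter> interior {e j'..r + e j'} = {}"
      using disj that unfolding img disjoint_family_on_def by blast
    then have "{e j<..<r + e j} \<inter> {e j'<..<r + e j'} = {}"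
      by (simp add: interior_atLeastAtMost_real)
    \<comment> \<open>The midpoint of the overlap.\<close>
    moreover have "(e j + e j' + r) / 2 \<in> {e j<..<r + e j} \<inter> {e j'<..<r + e j'}"
      using lt by (auto simp: abs_less_iff)
    ultimately show False by blast
  qed
  ultimately show ?thesis by (auto simp: digit_system_def)
qed

text \<open>The slope \<open>t\<close> replaces the angle: up to scaling the projections are \<open>(x, y) \<mapsto> x + t * y\<close>.\<close>

locale GL_slope =
  fixes m n :: nat and a b :: real and c :: "nat \<Rightarrow> nat \<Rightarrow> real" and d :: "nat \<Rightarrow> real" and t :: real
  assumes gl: "gatzouras_lalley m n a b c d" and t_nz: "t \<noteq> 0"
begin

text \<open>Since \<open>b powr \<kappa> = a\<close>, a number \<open>\<kappa> * q\<close> of row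
  digits resolves the same length as \<open>q\<close> column digits.\<close>

definition \<kappa> where "\<kappa> = ln a / ln b"
text \<open>The similarity dimension of \<open>n\<close> copies scaled by \<open>a\<close>, that is,
  of a horizontal fibre; \<open>dim_y\<close> is its analogue for the rows.\<close>

definition dim_x where "dim_x = ln n / - ln a"
definition dim_y where "dim_y = ln m / - ln b"
definition \<gamma> where "\<gamma> = min (dim_x + dim_y) 1"
text \<open>This is \<open>\<bar>slope 1\<bar>\<close>, the largest size of a slope over one turn of
  the rotation.\<close>

definition T where "T = \<bar>t\<bar> / b"

lemma ab: "0 < a" "a < b" "b < 1" "0 < b" "a < 1" "0 < m" "0 < n"
  using gl by (auto simp: gatzouras_lalley_def)

lemma ln_neg: "ln a < 0" "ln b < 0"
  using ab by auto

lemma \<kappa>_gt_1: "1 < \<kappa>"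
  using ab ln_neg by (simp add: \<kappa>_def)

lemma b_powr_\<kappa>: "b powr (\<kappa> * x) = a powr x"
  using ab ln_neg by (simp add: powr_def \<kappa>_def)

lemma T_pos: "0 < T"
  using t_nz ab by (simp add: T_def)

lemma dim_nonneg: "0 \<le> dim_x" "0 \<le> dim_y"
  using ab ln_neg by (auto simp: dim_x_def dim_y_def intro!: divide_nonneg_pos divide_nonneg_neg)

lemma \<gamma>_bounds: "0 \<le> \<gamma>" "\<gamma> \<le> 1"
  using dim_nonneg by (auto simp: \<gamma>_def)

lemma power_dim_x: "(a ^ h) powr dim_x = 1 / real n ^ h"
proof -
  have "(a ^ h) powr dim_x = exp (- (real h * ln n))"
    using ab ln_neg by (simp add: powr_def dim_x_def ln_realpow)
  also have "\<dots> = 1 / real n ^ h"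
    using ab by (simp add: exp_minus exp_of_nat_mult inverse_eq_divide)
  finally show ?thesis .
qed

lemma power_dim_y: "(b ^ h) powr dim_y = 1 / real m ^ h"
proof -
  have "(b ^ h) powr dim_y = exp (- (real h * ln m))"
    using ab ln_neg by (simp add: powr_def dim_y_def ln_realpow)
  also have "\<dots> = 1 / real m ^ h"
    using ab by (simp add: exp_minus exp_of_nat_mult inverse_eq_divide)
  finally show ?thesis .
qed

lemma digit_system_d: "digit_system b m N (\<lambda>_. d)"
  using gl ab by (intro affine_intervals_digit_system) (auto simp: gatzouras_lalley_def)

lemma digit_system_c:
  assumes "\<And>i. i < N \<Longrightarrow> u i \<in> {1..m}"
  shows "digit_system a n N (\<lambda>i. c (u i))"
proof -
  have "digit_system a n 1 (\<lambda>_. c (u i))" if "i < N" for i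
    using gl ab assms[OF that] by (intro affine_intervals_digit_system) (auto simp: gatzouras_lalley_def)
  then show ?thesis by (auto simp: digit_system_def)
qed

text \<open>The piece inside an approximate square after rescaling. The columns are read with the
  old row block \<open>u\<close>, while \<open>snd x\<close> holds fresh row digits, so the two
  coordinates vary independently. The column word comes first here, but second in
  \<open>word_pos\<close>.\<close>

definition block_val :: "nat list \<Rightarrow> real \<Rightarrow> nat list \<times> nat list \<Rightarrow> real" where
  "block_val u \<tau> x = word_val a (\<lambda>i. c (u ! i)) (fst x) + \<tau> * word_val b (\<lambda>_. d) (snd x)"

definition energy :: "nat list \<Rightarrow> real \<Rightarrow> real \<Rightarrow> nat \<Rightarrow> nat \<Rightarrow> nat" where
  "energy u \<tau> \<delta> q Q = card (near_pairs \<delta> (words n q \<times> words m Q) (block_val u \<tau>)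
     (words n q \<times> words m Q) (block_val u \<tau>))"

section \<open>Dependence on the slope and averaging over it\<close>

definition slope :: "real \<Rightarrow> real" where
  "slope x = t * b powr (- x)"

lemma slope_bound: "0 \<le> x \<Longrightarrow> x \<le> 1 \<Longrightarrow> \<bar>slope x\<bar> \<le> T"
proof -
  assume x: "0 \<le> x" "x \<le> 1"
  have "b powr (- x) \<le> b powr (-1)" using x ab by (intro powr_mono') auto
  then have "\<bar>t\<bar> * b powr (- x) \<le> \<bar>t\<bar> * b powr (-1)" by (rule mult_left_mono) auto
  then show ?thesis using ab by (simp add: slope_def T_def abs_mult powr_minus_divide)
qed

text \<open>Transversality: for nonnegative arguments the derivative of \<open>slope\<close> has
  size at least \<open>\<bar>t\<bar> * - ln b\<close>. This is what replaces the variation of the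
  angle in Marstrand's theorem.\<close>

lemma slope_separated: "0 \<le> x \<Longrightarrow> 0 \<le> y \<Longrightarrow> \<bar>t\<bar> * - ln b * \<bar>x - y\<bar> \<le> \<bar>slope x - slope y\<bar>"
proof (induction x y rule: linorder_wlog)
  case (le x y)
  have "b powr (- y) - b powr (- x) = b powr (- x) * (b powr (x - y) - 1)"
    by (simp add: right_diff_distrib powr_add[symmetric])
  moreover have "1 \<le> b powr (- x)" using le ab powr_mono'[of "-x" 0 b] by simp
  moreover have ge: "- ln b * (y - x) \<le> b powr (x - y) - 1"
    using exp_ge_add_one_self[of "(x - y) * ln b"] ab by (simp add: powr_def algebra_simps)
  moreover have nn: "0 \<le> - ln b * (y - x)" using ln_neg le by (intro mult_nonneg_nonneg) auto
  ultimately have "1 * (- ln b * (y - x)) \<le> b powr (- y) - b powr (- x)"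
    by (metis (no_types, lifting) mult_mono order_trans zero_le_one)
  then have "\<bar>t\<bar> * (- ln b * (y - x)) \<le> \<bar>t\<bar> * \<bar>b powr (- x) - b powr (- y)\<bar>"
    by (intro mult_left_mono) auto
  then show ?case using le by (simp add: slope_def right_diff_distrib[symmetric] abs_mult)
next
  case (sym x y)
  then show ?case by (simp add: abs_minus_commute)
qed

text \<open>The price of replacing the slope at a step by a grid slope.\<close>

lemma slope_lipschitz:
  assumes "0 \<le> x" "x \<le> y" "y \<le> 1"
  shows "\<bar>slope y - slope x\<bar> \<le> T * - ln b * (y - x)"
proof -
  have "b powr (- y) - b powr (- x) = b powr (- y) * (1 - b powr (y - x))"
    by (simp add: right_diff_distrib powr_add[symmetric])
  also have "\<dots> \<le> b powr (- 1) * (- ln b * (y - x))"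
  proof (intro mult_mono)
    show "b powr (- y) \<le> b powr (- 1)" using assms ab by (intro powr_mono') auto
    show "1 - b powr (y - x) \<le> - ln b * (y - x)"
      using exp_ge_add_one_self[of "(y - x) * ln b"] ab by (simp add: powr_def algebra_simps)
    show "0 \<le> 1 - b powr (y - x)" using assms ab powr_mono'[of 0 "y - x" b] by simp
  qed auto
  finally have le: "b powr (- y) - b powr (- x) \<le> b powr (- 1) * (- ln b * (y - x))" .
  have "0 \<le> b powr (- y) - b powr (- x)" using assms ab by (auto intro!: powr_mono')
  then have "\<bar>slope y - slope x\<bar> = \<bar>t\<bar> * (b powr (- y) - b powr (- x))"
    by (simp add: slope_def right_diff_distrib[symmetric] abs_mult)
  also have "\<dots> \<le> \<bar>t\<bar> * (b powr (- 1) * (- ln b * (y - x)))" using le by (intro mult_left_mono) auto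
  also have "\<dots> = T * - ln b * (y - x)" using ab by (simp add: T_def powr_minus_divide)
  finally show ?thesis .
qed

text \<open>The values \<open>slope (real j / L) * y\<close> are separated by a multiple of
  \<open>\<bar>y\<bar> / L\<close>, and \<open>L \<le> K2 / \<rho>\<close>, so a window of length
  about \<rho> contains at most about \<open>1 / \<bar>y\<bar>\<close> of them. For
  \<open>\<bar>y\<bar> < \<rho>\<close> all \<open>L\<close> slopes are counted.\<close>

lemma card_grid_slopes_le:
  assumes "0 < K" "0 < \<rho>" "real L * \<rho> \<le> K2" "0 < L" "\<bar>y\<bar> \<le> 1"
  shows "real (card {j\<in>{..<L}. \<bar>x + slope (real j / L) * y\<bar> \<le> K * \<rho>})
    \<le> (K2 + 2 * K * K2 / (\<bar>t\<bar> * - ln b) + 1) / max \<bar>y\<bar> \<rho>"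
proof -
  have lam: "0 < \<bar>t\<bar> * - ln b" using t_nz ln_neg by (intro mult_pos_pos) auto
  have K2: "0 < K2" using assms by (smt (verit) mult_pos_pos of_nat_0_less_iff)
  let ?S = "{j\<in>{..<L}. \<bar>x + slope (real j / L) * y\<bar> \<le> K * \<rho>}"
  show ?thesis
  proof (cases "\<bar>y\<bar> < \<rho>")
    case True
    have "card ?S \<le> card {..<L}" by (intro card_mono) auto
    then have "real (card ?S) \<le> real L" by simp
    also have "\<dots> \<le> K2 / \<rho>" using assms by (simp add: field_simps)
    also have "\<dots> \<le> (K2 + 2 * K * K2 / (\<bar>t\<bar> * - ln b) + 1) / max \<bar>y\<bar> \<rho>"
    proof -
      have "0 \<le> 2 * K * K2 / (\<bar>t\<bar> * - ln b)" using lam assms K2 by (intro divide_nonneg_pos) auto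
      then show ?thesis using True assms K2 by (intro frac_le) linarith+
    qed
    finally show ?thesis .
  next
    case False
    then have y: "0 < \<bar>y\<bar>" using assms by linarith
    have "real (card ?S) \<le> 2 * (K * \<rho>) / (\<bar>t\<bar> * - ln b * \<bar>y\<bar> / L) + 1"
    proof (rule card_separated_le[where f = "\<lambda>j. slope (real j / L) * y" and z = "- x"])
      show "0 < \<bar>t\<bar> * - ln b * \<bar>y\<bar> / real L" using lam y assms by (simp only: divide_pos_pos mult_pos_pos of_nat_0_less_iff)
      fix i j assume "i \<in> ?S" "j \<in> ?S" "i \<noteq> j"
      have "(\<bar>t\<bar> * - ln b) * (1 / L) \<le> (\<bar>t\<bar> * - ln b) * \<bar>real i / L - real j / L\<bar>"
      proof (rule mult_left_mono)
        have "1 \<le> \<bar>real i - real j\<bar>" using \<open>i \<noteq> j\<close> by linarith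
        then show "1 / real L \<le> \<bar>real i / L - real j / L\<bar>"
          using assms by (simp add: diff_divide_distrib[symmetric] divide_right_mono)
      qed (use lam in auto)
      also have "\<dots> \<le> \<bar>slope (real i / L) - slope (real j / L)\<bar>" by (rule slope_separated) auto
      finally have "(\<bar>t\<bar> * - ln b) * (1 / L) * \<bar>y\<bar> \<le> \<bar>slope (real i / L) - slope (real j / L)\<bar> * \<bar>y\<bar>"
        by (rule mult_right_mono) auto
      then show "\<bar>t\<bar> * - ln b * \<bar>y\<bar> / L \<le> \<bar>slope (real i / L) * y - slope (real j / L) * y\<bar>"
        by (simp add: abs_mult left_diff_distrib[symmetric])
    qed (use assms in \<open>auto simp: algebra_simps\<close>)
    also have "2 * (K * \<rho>) / (\<bar>t\<bar> * - ln b * \<bar>y\<bar> / L) = 2 * K * (real L * \<rho>) / (\<bar>t\<bar> * - ln b) / \<bar>y\<bar>"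
      by simp
    also have "\<dots> + 1 \<le> 2 * K * K2 / (\<bar>t\<bar> * - ln b) / \<bar>y\<bar> + 1 / \<bar>y\<bar>"
      using assms lam y by (intro add_mono divide_right_mono mult_left_mono) auto
    also have "\<dots> \<le> (K2 + 2 * K * K2 / (\<bar>t\<bar> * - ln b) + 1) / \<bar>y\<bar>"
      unfolding add_divide_distrib[symmetric] using K2 y by (intro divide_right_mono) linarith+
    finally show ?thesis using False by (simp add: max_def)
  qed
qed

text \<open>A Frostman bound for the column positions, uniform in the row block \<open>u\<close>.
  The factor \<open>(1 / a) powr dim_x\<close> is lost in rounding \<open>R\<close> up to a power of
  \<open>a\<close>.\<close>

lemma card_columns_ball_le:
  assumes "u \<in> words m q" "a ^ q \<le> R" "R \<le> 1" "0 \<le> A"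
  shows "real (card {v\<in>words n q. \<bar>word_val a (\<lambda>i. c (u ! i)) v - z\<bar> \<le> A * R})
    \<le> (2 * A + 3) * (1 / a) powr dim_x * real n ^ q * R powr dim_x"
proof -
  have R: "0 < R" using assms(2) ab by (smt (verit) zero_less_power)
  obtain h where h: "a ^ Suc h < R" "R \<le> a ^ h" using power_scale_exists[OF ab(1) ab(5) R assms(3)] .
  have hq: "h \<le> q"
  proof (rule ccontr)
    assume "\<not> h \<le> q"
    then have "a ^ h < a ^ q" using ab by (intro power_strict_decreasing) auto
    then show False using assms h by linarith
  qed
  have "real (card {v\<in>words n q. \<bar>word_val a (\<lambda>i. c (u ! i)) v - z\<bar> \<le> A * R})
      \<le> (2 * (A * R) / a ^ h + 3) * real n ^ (q - h)"
    using assms R ab hq words_nth[OF assms(1)] by (intro card_words_ball digit_system_c) auto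
  also have "\<dots> \<le> (2 * A + 3) * (real n ^ q * (R / a) powr dim_x)"
  proof (intro mult_mono)
    have "A * R \<le> A * a ^ h" using h assms by (intro mult_left_mono) auto
    then show "2 * (A * R) / a ^ h + 3 \<le> 2 * A + 3" using ab by (simp add: field_simps)
    have "real n ^ (q - h) = real n ^ q * (a ^ h) powr dim_x"
      using hq ab by (simp add: power_dim_x power_diff)
    also have "\<dots> \<le> real n ^ q * (R / a) powr dim_x"
      using h ab dim_nonneg by (intro mult_left_mono powr_mono2) (auto simp: field_simps)
    finally show "real n ^ (q - h) \<le> real n ^ q * (R / a) powr dim_x" .
  qed (use assms in auto)
  also have "\<dots> = (2 * A + 3) * (1 / a) powr dim_x * real n ^ q * R powr dim_x"
    using powr_mult[of "1 / a" R dim_x] R ab by simp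
  finally show ?thesis .
qed

text \<open>A truncated Riesz energy of the row positions with kernel
  \<open>\<bar>y\<bar> powr (dim_x - 1)\<close>. By the ball count for row words each scale
  \<open>b ^ h \<ge> \<rho>\<close> contributes a multiple of
  \<open>(b ^ h) powr (dim_x + dim_y - 1)\<close>, which is at most
  \<open>\<rho> powr (\<gamma> - 1)\<close>; \<open>Suc Q\<close> bounds the number of
  scales.\<close>

lemma sum_row_words_kernel_le:
  assumes "w \<in> words m Q" "0 < \<rho>" "\<rho> \<le> 1" "b ^ Q \<le> \<rho>"
  shows "(\<Sum>w'\<in>words m Q. max \<bar>word_val b (\<lambda>_. d) w - word_val b (\<lambda>_. d) w'\<bar> \<rho> powr (dim_x - 1))
    \<le> 5 * max 1 (b powr (dim_x - 1)) * real (Suc Q) * real m ^ Q * \<rho> powr (\<gamma> - 1)"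
proof -
  let ?y = "word_val b (\<lambda>_. d)"
  \<comment> \<open>The exponent \<open>dim_x - 1\<close> can have either sign; \<open>C\<close>
    covers the rounding of the kernel to a scale \<open>b ^ h\<close> in both cases.\<close>
  define C where "C = max 1 (b powr (dim_x - 1))"
  define H where "H = {h. h \<le> Q \<and> \<rho> \<le> b ^ h}"
  have finH: "finite H" by (auto simp: H_def)
  have yr: "0 \<le> ?y v" "?y v \<le> 1" if "v \<in> words m Q" for v
    using word_val_range[OF digit_system_d that ab(4,3)] zero_le_power[of b Q] ab by linarith+
  have kernel: "max \<bar>?y w - ?y w'\<bar> \<rho> powr (dim_x - 1)
      \<le> (\<Sum>h\<in>H. of_bool (\<bar>?y w' - ?y w\<bar> \<le> b ^ h) * (C * (b ^ h) powr (dim_x - 1)))"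
    if w': "w' \<in> words m Q" for w'
  proof -
    define R where "R = max \<bar>?y w - ?y w'\<bar> \<rho>"
    have R: "0 < R" "R \<le> 1" "\<rho> \<le> R" using assms yr[OF w'] yr[OF assms(1)] by (auto simp: R_def)
    obtain h where h: "b ^ Suc h < R" "R \<le> b ^ h" using power_scale_exists[OF ab(4,3) R(1,2)] .
    have "h \<le> Q"
    proof (rule ccontr)
      assume "\<not> h \<le> Q"
      then have "b ^ h < b ^ Q" using ab by (intro power_strict_decreasing) auto
      then show False using assms h R by linarith
    qed
    then have hH: "h \<in> H" using h R by (auto simp: H_def)
    have "R powr (dim_x - 1) \<le> C * (b ^ h) powr (dim_x - 1)"
    proof (cases "1 \<le> dim_x")
      case True
      then have "R powr (dim_x - 1) \<le> 1 * (b ^ h) powr (dim_x - 1)"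
        using h R by (simp add: powr_mono2)
      also have "\<dots> \<le> C * (b ^ h) powr (dim_x - 1)" by (intro mult_right_mono) (auto simp: C_def)
      finally show ?thesis .
    next
      case False
      then have "R powr (dim_x - 1) \<le> (b * b ^ h) powr (dim_x - 1)"
        using h R ab by (intro powr_mono2') auto
      also have "\<dots> = b powr (dim_x - 1) * (b ^ h) powr (dim_x - 1)" using ab by (simp add: powr_mult)
      also have "\<dots> \<le> C * (b ^ h) powr (dim_x - 1)" by (intro mult_right_mono) (auto simp: C_def)
      finally show ?thesis .
    qed
    also have "\<dots> = of_bool (\<bar>?y w' - ?y w\<bar> \<le> b ^ h) * (C * (b ^ h) powr (dim_x - 1))"
      using h by (auto simp: R_def abs_minus_commute)
    also have "\<dots> \<le> (\<Sum>h\<in>H. of_bool (\<bar>?y w' - ?y w\<bar> \<le> b ^ h) * (C * (b ^ h) powr (dim_x - 1)))"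
      using hH finH by (intro member_le_sum) (auto simp: C_def)
    finally show ?thesis by (simp add: R_def)
  qed
  have "(\<Sum>w'\<in>words m Q. max \<bar>?y w - ?y w'\<bar> \<rho> powr (dim_x - 1))
      \<le> (\<Sum>w'\<in>words m Q. \<Sum>h\<in>H. of_bool (\<bar>?y w' - ?y w\<bar> \<le> b ^ h) * (C * (b ^ h) powr (dim_x - 1)))"
    using kernel by (rule sum_mono)
  also have "\<dots> = (\<Sum>h\<in>H. real (card {w'\<in>words m Q. \<bar>?y w' - ?y w\<bar> \<le> b ^ h}) * (C * (b ^ h) powr (dim_x - 1)))"
    by (subst sum.swap) (simp add: card_eq_sum_of_bool sum_distrib_right)
  also have "\<dots> \<le> (\<Sum>h\<in>H. 5 * C * real m ^ Q * \<rho> powr (\<gamma> - 1))"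
  proof (rule sum_mono)
    fix h assume h: "h \<in> H"
    have "real (card {w'\<in>words m Q. \<bar>?y w' - ?y w\<bar> \<le> b ^ h}) \<le> (2 * b ^ h / b ^ h + 3) * real m ^ (Q - h)"
      using h ab by (intro card_words_ball digit_system_d) (auto simp: H_def)
    also have "\<dots> = 5 * real m ^ Q * (b ^ h) powr dim_y"
      using h ab by (simp add: power_dim_y power_diff H_def)
    finally have "real (card {w'\<in>words m Q. \<bar>?y w' - ?y w\<bar> \<le> b ^ h}) * (C * (b ^ h) powr (dim_x - 1))
        \<le> 5 * real m ^ Q * (b ^ h) powr dim_y * (C * (b ^ h) powr (dim_x - 1))"
      by (rule mult_right_mono) (auto simp: C_def)
    also have "\<dots> = 5 * C * real m ^ Q * (b ^ h) powr (dim_x + dim_y - 1)"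
      using ab by (simp add: powr_add[symmetric] algebra_simps)
    also have "\<dots> \<le> 5 * C * real m ^ Q * \<rho> powr (\<gamma> - 1)"
    proof (rule mult_left_mono)
      show "(b ^ h) powr (dim_x + dim_y - 1) \<le> \<rho> powr (\<gamma> - 1)"
      proof (cases "1 \<le> dim_x + dim_y")
        case True
        then have "(b ^ h) powr (dim_x + dim_y - 1) \<le> 1 powr (dim_x + dim_y - 1)"
          using ab by (intro powr_mono2) (auto simp: power_le_one)
        then show ?thesis using True assms by (simp add: \<gamma>_def)
      next
        case False
        then show ?thesis using h assms by (auto simp: \<gamma>_def H_def intro!: powr_mono2')
      qed
    qed (auto simp: C_def)
    finally show "real (card {w'\<in>words m Q. \<bar>?y w' - ?y w\<bar> \<le> b ^ h}) * (C * (b ^ h) powr (dim_x - 1))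
        \<le> 5 * C * real m ^ Q * \<rho> powr (\<gamma> - 1)" .
  qed
  also have "\<dots> = real (card H) * (5 * C * real m ^ Q * \<rho> powr (\<gamma> - 1))" by simp
  also have "\<dots> \<le> real (Suc Q) * (5 * C * real m ^ Q * \<rho> powr (\<gamma> - 1))"
  proof (rule mult_right_mono)
    have "card H \<le> card {..Q}" by (intro card_mono) (auto simp: H_def)
    then show "real (card H) \<le> real (Suc Q)" by simp
  qed (auto simp: C_def)
  finally show ?thesis by (simp add: C_def mult_ac)
qed

text \<open>A discrete form of the potential-theoretic proof of Marstrand's projection theorem: the slope
  is averaged over a geometric grid, uniformly in the row word \<open>u\<close>.\<close>

lemma sum_energy_le:
  assumes "0 < K" "0 < K2"
  obtains C where "0 < C"
    "\<And>u q Q L. u \<in> words m q \<Longrightarrow> 0 < L \<Longrightarrow> real L * a ^ q \<le> K2 \<Longrightarrow> b ^ Q \<le> a ^ q \<Longrightarrow>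
      (\<Sum>j<L. real (energy u (slope (real j / L)) (K * a ^ q) q Q))
      \<le> C * real (Suc Q) * (real n ^ q * real m ^ Q) ^ 2 * (a ^ q) powr (\<gamma> - 1)"
proof -
  define C1 where "C1 = K2 + 2 * K * K2 / (\<bar>t\<bar> * - ln b) + 1"
  define C2 where "C2 = (2 * (K + T) + 3) * (1 / a) powr dim_x"
  define C3 where "C3 = 5 * max 1 (b powr (dim_x - 1))"
  have lam: "0 < \<bar>t\<bar> * - ln b" using t_nz ln_neg by (intro mult_pos_pos) auto
  have C1: "0 < C1" unfolding C1_def using assms lam by (intro add_pos_pos divide_pos_pos) auto
  have C2: "0 < C2" unfolding C2_def using assms T_pos ab by (intro mult_pos_pos) auto
  have C3: "0 < C3" unfolding C3_def by (auto simp: less_max_iff_disj)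
  show ?thesis
  proof (rule that[of "C1 * C2 * C3"])
    show "0 < C1 * C2 * C3" using C1 C2 C3 by simp
    fix u q Q L
    assume u: "u \<in> words m q" and L: "0 < L" "real L * a ^ q \<le> K2" and Q: "b ^ Q \<le> a ^ q"
    define \<rho> where "\<rho> = a ^ q"
    have \<rho>: "0 < \<rho>" "\<rho> \<le> 1" using ab by (auto simp: \<rho>_def power_le_one)
    let ?x = "word_val a (\<lambda>i. c (u ! i))" and ?y = "word_val b (\<lambda>_. d)"
    let ?F = "words n q \<times> words m Q"
    let ?R = "\<lambda>w w'. max \<bar>?y w - ?y w'\<bar> \<rho>"
    have yr: "0 \<le> ?y v" "?y v \<le> 1" if "v \<in> words m Q" for v
      using word_val_range[OF digit_system_d that ab(4,3)] zero_le_power[of b Q] ab by linarith+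
    \<comment> \<open>If the columns are more than \<open>(K + T) * ?R w w'\<close> apart, no slope
      of size at most \<open>T\<close> brings the pair within \<open>K * \<rho>\<close>.\<close>
    have pair: "(\<Sum>j<L. of_bool (\<bar>block_val u (slope (real j / L)) (v, w) - block_val u (slope (real j / L)) (v', w')\<bar> \<le> K * \<rho>))
        \<le> C1 / ?R w w' * of_bool (\<bar>?x v' - ?x v\<bar> \<le> (K + T) * ?R w w')" (is "?S \<le> _")
      if "w \<in> words m Q" "w' \<in> words m Q" for v v' w w'
    proof -
      have dy: "\<bar>?y w - ?y w'\<bar> \<le> 1" using yr[OF that(1)] yr[OF that(2)] by (auto simp: abs_le_iff)
      have "block_val u \<tau> (v, w) - block_val u \<tau> (v', w') = (?x v - ?x v') + \<tau> * (?y w - ?y w')" for \<tau>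
        by (simp add: block_val_def algebra_simps)
      then have S: "?S = real (card {j\<in>{..<L}. \<bar>(?x v - ?x v') + slope (real j / L) * (?y w - ?y w')\<bar> \<le> K * \<rho>})"
        by (simp only: card_eq_sum_of_bool finite_lessThan)
      show ?thesis
      proof (cases "\<bar>?x v' - ?x v\<bar> \<le> (K + T) * ?R w w'")
        case True
        have "real L * \<rho> \<le> K2" using L(2) by (simp add: \<rho>_def)
        then show ?thesis
          using card_grid_slopes_le[OF assms(1) \<rho>(1) _ L(1) dy, of K2 "?x v - ?x v'"]
          unfolding S C1_def by (simp only: True of_bool_eq mult_1_right)
      next
        case False
        have "{j\<in>{..<L}. \<bar>(?x v - ?x v') + slope (real j / L) * (?y w - ?y w')\<bar> \<le> K * \<rho>} = {}"
        proof (rule ccontr)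
          assume "\<not> ?thesis"
          then obtain j where j: "j < L" "\<bar>(?x v - ?x v') + slope (real j / L) * (?y w - ?y w')\<bar> \<le> K * \<rho>" by auto
          have "\<bar>slope (real j / L) * (?y w - ?y w')\<bar> \<le> T * \<bar>?y w - ?y w'\<bar>"
            unfolding abs_mult using j(1) by (intro mult_right_mono slope_bound) auto
          then have "\<bar>?x v' - ?x v\<bar> \<le> K * \<rho> + T * \<bar>?y w - ?y w'\<bar>" using j(2) by linarith
          also have "\<dots> \<le> K * ?R w w' + T * ?R w w'"
            using assms T_pos by (intro add_mono mult_left_mono) auto
          finally show False using False by (simp add: algebra_simps)
        qed
        then have "?S = 0" unfolding S by simp
        then show ?thesis using C1 \<rho> by (simp add: False)
      qed
    qed
    \<comment> \<open>Summing over the column words first gains \<open>?R w w' powr dim_x\<close>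
      and turns \<open>1 / ?R w w'\<close> into the kernel of
      \<open>sum_row_words_kernel_le\<close>.\<close>
    have cols: "(\<Sum>v'\<in>words n q. C1 / ?R w w' * of_bool (\<bar>?x v' - ?x v\<bar> \<le> (K + T) * ?R w w'))
        \<le> C1 * C2 * real n ^ q * ?R w w' powr (dim_x - 1)"
      if "w \<in> words m Q" "w' \<in> words m Q" for v w w'
    proof -
      have R: "a ^ q \<le> ?R w w'" "?R w w' \<le> 1" "0 < ?R w w'"
        using yr[OF that(1)] yr[OF that(2)] \<rho> by (auto simp: abs_le_iff \<rho>_def)
      have "(\<Sum>v'\<in>words n q. C1 / ?R w w' * of_bool (\<bar>?x v' - ?x v\<bar> \<le> (K + T) * ?R w w'))
          = C1 / ?R w w' * real (card {v'\<in>words n q. \<bar>?x v' - ?x v\<bar> \<le> (K + T) * ?R w w'})"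
        by (simp only: card_eq_sum_of_bool finite_words sum_distrib_left)
      also have "\<dots> \<le> C1 / ?R w w' * (C2 * real n ^ q * ?R w w' powr dim_x)"
        unfolding C2_def using assms T_pos C1 R
        by (intro mult_left_mono card_columns_ball_le[OF u R(1,2)]) auto
      also have "\<dots> = C1 * C2 * real n ^ q * ?R w w' powr (dim_x - 1)"
        using R by (simp add: powr_diff)
      finally show ?thesis .
    qed
    have "(\<Sum>j<L. real (energy u (slope (real j / L)) (K * \<rho>) q Q))
        = (\<Sum>x\<in>?F. \<Sum>x'\<in>?F. \<Sum>j<L. of_bool (\<bar>block_val u (slope (real j / L)) x - block_val u (slope (real j / L)) x'\<bar> \<le> K * \<rho>))"
    proof -
      have F: "finite ?F" by simp
      show ?thesis
        unfolding energy_def card_near_pairs_eq_sum[OF F F]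
        by (subst sum.swap, rule sum.cong[OF refl], rule sum.swap)
    qed
    also have "\<dots> \<le> (\<Sum>(v, w)\<in>?F. \<Sum>(v', w')\<in>?F. C1 / ?R w w' * of_bool (\<bar>?x v' - ?x v\<bar> \<le> (K + T) * ?R w w'))"
    proof (rule sum_mono)
      fix x assume "x \<in> ?F"
      then obtain v w where x: "x = (v, w)" "w \<in> words m Q" by auto
      show "(\<Sum>x'\<in>?F. \<Sum>j<L. of_bool (\<bar>block_val u (slope (real j / L)) x - block_val u (slope (real j / L)) x'\<bar> \<le> K * \<rho>))
          \<le> (case x of (v, w) \<Rightarrow> \<Sum>(v', w')\<in>?F. C1 / ?R w w' * of_bool (\<bar>?x v' - ?x v\<bar> \<le> (K + T) * ?R w w'))"
        unfolding x(1) prod.case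
      proof (rule sum_mono)
        fix x' assume "x' \<in> ?F"
        then obtain v' w' where x': "x' = (v', w')" "w' \<in> words m Q" by auto
        show "(\<Sum>j<L. of_bool (\<bar>block_val u (slope (real j / L)) (v, w) - block_val u (slope (real j / L)) x'\<bar> \<le> K * \<rho>))
            \<le> (case x' of (v', w') \<Rightarrow> C1 / ?R w w' * of_bool (\<bar>?x v' - ?x v\<bar> \<le> (K + T) * ?R w w'))"
          unfolding x'(1) prod.case by (rule pair[OF x(2) x'(2)])
      qed
    qed
    also have "\<dots> = (\<Sum>(v, w)\<in>?F. \<Sum>w'\<in>words m Q. \<Sum>v'\<in>words n q. C1 / ?R w w' * of_bool (\<bar>?x v' - ?x v\<bar> \<le> (K + T) * ?R w w'))"
      unfolding sum.cartesian_product[symmetric]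
      by (rule sum.cong[OF refl], rule sum.cong[OF refl], rule sum.swap)
    also have "\<dots> \<le> (\<Sum>(v, w)\<in>?F. \<Sum>w'\<in>words m Q. C1 * C2 * real n ^ q * ?R w w' powr (dim_x - 1))"
    proof (rule sum_mono)
      fix x assume "x \<in> ?F"
      then obtain v w where x: "x = (v, w)" "w \<in> words m Q" by auto
      show "(case x of (v, w) \<Rightarrow> \<Sum>w'\<in>words m Q. \<Sum>v'\<in>words n q. C1 / ?R w w' * of_bool (\<bar>?x v' - ?x v\<bar> \<le> (K + T) * ?R w w'))
          \<le> (case x of (v, w) \<Rightarrow> \<Sum>w'\<in>words m Q. C1 * C2 * real n ^ q * ?R w w' powr (dim_x - 1))"
        unfolding x(1) prod.case by (rule sum_mono) (rule cols[OF x(2)])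
    qed
    also have "\<dots> = (\<Sum>(v, w)\<in>?F. C1 * C2 * real n ^ q * (\<Sum>w'\<in>words m Q. ?R w w' powr (dim_x - 1)))"
      by (simp add: sum_distrib_left)
    also have "\<dots> \<le> (\<Sum>(v, w)\<in>?F. C1 * C2 * real n ^ q * (C3 * real (Suc Q) * real m ^ Q * \<rho> powr (\<gamma> - 1)))"
    proof (intro sum_mono, clarify)
      fix v w assume w: "w \<in> words m Q"
      show "C1 * C2 * real n ^ q * (\<Sum>w'\<in>words m Q. ?R w w' powr (dim_x - 1))
          \<le> C1 * C2 * real n ^ q * (C3 * real (Suc Q) * real m ^ Q * \<rho> powr (\<gamma> - 1))"
        unfolding C3_def using sum_row_words_kernel_le[OF w \<rho>] Q C1 C2
        by (intro mult_left_mono) (auto simp: \<rho>_def)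
    qed
    also have "\<dots> = C1 * C2 * C3 * real (Suc Q) * (real n ^ q * real m ^ Q) ^ 2 * \<rho> powr (\<gamma> - 1)"
      by (simp add: case_prod_unfold card_cartesian_product power2_eq_square)
    finally show "(\<Sum>j<L. real (energy u (slope (real j / L)) (K * a ^ q) q Q))
      \<le> C1 * C2 * C3 * real (Suc Q) * (real n ^ q * real m ^ Q) ^ 2 * (a ^ q) powr (\<gamma> - 1)"
      by (simp add: \<rho>_def)
  qed
qed

end

section \<open>The tree of admissible words\<close>

lemma card_le_mult_fibres:
  fixes B :: real
  assumes "finite S" "finite E" "f ` S \<subseteq> E" "\<And>e. e \<in> E \<Longrightarrow> real (card {x\<in>S. f x = e}) \<le> B"
  shows "real (card S) \<le> B * real (card E)"
proof -
  have "S = (\<Union>e\<in>E. {x\<in>S. f x = e})" using assms(3) by auto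
  then have "card S \<le> (\<Sum>e\<in>E. card {x\<in>S. f x = e})"
    using card_UN_le[OF assms(2), of "\<lambda>e. {x\<in>S. f x = e}"] by simp
  then have "real (card S) \<le> (\<Sum>e\<in>E. real (card {x\<in>S. f x = e}))"
    unfolding of_nat_sum[symmetric] of_nat_le_iff .
  also have "\<dots> \<le> (\<Sum>e\<in>E. B)" using assms(4) by (rule sum_mono)
  finally show ?thesis by (simp add: mult.commute)
qed

context GL_slope
begin

definition word_pos :: "nat list \<times> nat list \<Rightarrow> real" where
  "word_pos x = word_val a (\<lambda>i. c (fst x ! i)) (snd x) + t * word_val b (\<lambda>_. d) (fst x)"

text \<open>Because of \<open>k \<le> h\<close> the first \<open>k\<close> column positions are
  determined by the first \<open>h\<close> row digits; the tails stay in a box with sides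
  \<open>a ^ k\<close> and \<open>b ^ h\<close>.\<close>

lemma word_pos_split:
  assumes x: "is \<in> words m N" "js \<in> words n M" and le: "M \<le> N" "k \<le> M" "h \<le> N" "k \<le> h"
  obtains X Y where "X = word_val a (\<lambda>i. c (is ! (k + i))) (drop k js)" "Y = word_val b (\<lambda>_. d) (drop h is)"
    "word_pos (is, js) = word_pos (take h is, take k js) + a ^ k * X + t * b ^ h * Y"
    "0 \<le> X" "X \<le> 1" "0 \<le> Y" "Y \<le> 1"
proof -
  define X where "X = word_val a (\<lambda>i. c (is ! (k + i))) (drop k js)"
  define Y where "Y = word_val b (\<lambda>_. d) (drop h is)"
  have len: "length is = N" "length js = M" using x by (auto simp: words_def)
  have "word_val a (\<lambda>i. c (is ! i)) js = word_val a (\<lambda>i. c (is ! i)) (take k js) + a ^ k * X"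
    using word_val_append[of a "\<lambda>i. c (is ! i)" "take k js" "drop k js"] len le
    by (simp add: X_def min_absorb2)
  also have "word_val a (\<lambda>i. c (is ! i)) (take k js) = word_val a (\<lambda>i. c (take h is ! i)) (take k js)"
    using len le by (intro word_val_cong) auto
  finally have 1: "word_val a (\<lambda>i. c (is ! i)) js = word_val a (\<lambda>i. c (take h is ! i)) (take k js) + a ^ k * X" .
  have 2: "word_val b (\<lambda>_. d) is = word_val b (\<lambda>_. d) (take h is) + b ^ h * Y"
    using word_val_append[of b "\<lambda>_. d" "take h is" "drop h is"] len le
    by (simp add: Y_def min_absorb2)
  have dsX: "digit_system a n (M - k) (\<lambda>i. c (is ! (k + i)))"
    using words_nth[OF x(1)] le by (intro digit_system_c) auto
  have "0 \<le> X" "X \<le> 1 - a ^ (M - k)" "0 \<le> Y" "Y \<le> 1 - b ^ (N - h)"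
    unfolding X_def Y_def
    using word_val_range[OF dsX drop_in_words[OF x(2)] ab(1,5)]
      word_val_range[OF digit_system_d drop_in_words[OF x(1)] ab(4,3)] by auto
  moreover have "0 \<le> a ^ (M - k)" "0 \<le> b ^ (N - h)" using ab by auto
  ultimately have "0 \<le> X" "X \<le> 1" "0 \<le> Y" "Y \<le> 1" by linarith+
  moreover have "word_pos (is, js) = word_pos (take h is, take k js) + a ^ k * X + t * b ^ h * Y"
    using 1 2 by (simp add: word_pos_def algebra_simps)
  ultimately show ?thesis using that[OF X_def Y_def] by blast
qed

end

text \<open>After \<open>p\<close> steps a word pair has \<open>l p\<close> row digits and \<open>q * p\<close> column digits. \<open>G p\<close> contains the
  blocks allowed for the row digits with indices from \<open>q * p\<close> to \<open>q * Suc p - 1\<close>, on which the column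
  positions of step \<open>p\<close> depend, and \<open>g p\<close> is the factor by which the proportion of near pairs shrinks
  in step \<open>p\<close>.\<close>

locale GL_tree = GL_slope +
  fixes q :: nat and l :: "nat \<Rightarrow> nat" and G :: "nat \<Rightarrow> nat list set" and K :: real and g :: "nat \<Rightarrow> real"
  assumes q: "a ^ q \<le> 1 / 2"
    and l_0: "l 0 = 0" and l_mono: "l p \<le> l (Suc p)" and long: "q * p \<le> l p"
    and scale: "\<bar>t\<bar> * b ^ l p \<le> T * a ^ (q * p)"
    and G_words: "G p \<subseteq> words m q" and G_card: "m ^ q \<le> 2 * card (G p)"
    and K: "2 * (1 + T) \<le> K" and g_nonneg: "0 \<le> g p"
    and step: "1 \<le> g p \<or> (q * Suc p \<le> l p \<and>
      (\<forall>u\<in>G p. 3 * real (energy u (t * b ^ l p / a ^ (q * p)) (K * a ^ q) q (l (Suc p) - l p))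
         \<le> g p * (real n ^ q * real m ^ (l (Suc p) - l p)) ^ 2))"
begin

section \<open>Near pairs along the levels of the tree\<close>

definition block :: "nat list \<Rightarrow> nat \<Rightarrow> nat list" where
  "block is p = take q (drop (q * p) is)"

text \<open>Row digits after the last complete block are left free; a block is restricted from the
  first level on that contains all of it.\<close>

definition level :: "nat \<Rightarrow> (nat list \<times> nat list) set" where
  "level p = {(is, js). is \<in> words m (l p) \<and> js \<in> words n (q * p) \<and>
     (\<forall>p'. q * Suc p' \<le> l p \<longrightarrow> block is p' \<in> G p')}"

definition prefix :: "nat \<Rightarrow> nat list \<times> nat list \<Rightarrow> nat list \<times> nat list" where
  "prefix p x = (take (l p) (fst x), take (q * p) (snd x))"

definition level_pairs :: "nat \<Rightarrow> ((nat list \<times> nat list) \<times> (nat list \<times> nat list)) set" where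
  "level_pairs p = near_pairs (K * a ^ (q * p)) (level p) word_pos (level p) word_pos"

lemma finite_level: "finite (level p)"
  by (rule finite_subset[of _ "words m (l p) \<times> words n (q * p)"]) (auto simp: level_def)

lemma finite_level_pairs: "finite (level_pairs p)"
  by (simp add: level_pairs_def finite_level)

lemma K_pos: "0 < K"
  using K T_pos by (simp add: distrib_left)

lemma block_take: "q * Suc p \<le> h \<Longrightarrow> block (take h is) p = block is p"
  by (simp add: block_def take_drop min_absorb1 add.commute)

text \<open>Deleting digits changes a difference of positions by at most the projected size of a
  cylinder, \<open>a ^ (q * p) + \<bar>t\<bar> * b ^ l p\<close>.\<close>

lemma prefix_near:
  assumes "x \<in> words m N \<times> words n M" "x' \<in> words m N \<times> words n M" "M \<le> N" "q * p \<le> M" "l p \<le> N"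
  shows "\<bar>word_pos (prefix p x) - word_pos (prefix p x')\<bar> \<le> \<bar>word_pos x - word_pos x'\<bar> + (1 + T) * a ^ (q * p)"
proof -
  obtain i j i' j' where x: "x = (i, j)" "x' = (i', j')" by (cases x, cases x')
  have w: "i \<in> words m N" "j \<in> words n M" "i' \<in> words m N" "j' \<in> words n M" using assms x by auto
  obtain X Y where X: "word_pos (i, j) = word_pos (take (l p) i, take (q * p) j) + a ^ (q * p) * X + t * b ^ l p * Y"
      "0 \<le> X" "X \<le> 1" "0 \<le> Y" "Y \<le> 1"
    by (rule word_pos_split[OF w(1,2) assms(3,4,5) long[of p]]) (rule that)
  obtain X' Y' where X': "word_pos (i', j') = word_pos (take (l p) i', take (q * p) j') + a ^ (q * p) * X' + t * b ^ l p * Y'"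
      "0 \<le> X'" "X' \<le> 1" "0 \<le> Y'" "Y' \<le> 1"
    by (rule word_pos_split[OF w(3,4) assms(3,4,5) long[of p]]) (rule that)
  have "\<bar>a ^ (q * p) * (X - X')\<bar> \<le> a ^ (q * p) * 1"
    unfolding abs_mult using X(2-) X'(2-) ab by (intro mult_mono) auto
  moreover have "\<bar>t * b ^ l p * (Y - Y')\<bar> \<le> \<bar>t\<bar> * b ^ l p * 1"
    unfolding abs_mult using X(2-) X'(2-) ab by (intro mult_mono) auto
  moreover have "word_pos x - word_pos x' = (word_pos (prefix p x) - word_pos (prefix p x'))
      + a ^ (q * p) * (X - X') + t * b ^ l p * (Y - Y')"
    using X(1) X'(1) unfolding x prefix_def by (simp add: right_diff_distrib)
  moreover have "\<bar>P\<bar> \<le> \<bar>D\<bar> + (u + v)" if "\<bar>A\<bar> \<le> u" "\<bar>B\<bar> \<le> v" "D = P + A + B" for P D A B u v :: real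
    using that by linarith
  ultimately have "\<bar>word_pos (prefix p x) - word_pos (prefix p x')\<bar>
      \<le> \<bar>word_pos x - word_pos x'\<bar> + (a ^ (q * p) * 1 + \<bar>t\<bar> * b ^ l p * 1)" by blast
  then show ?thesis
    using scale[of p] by (simp add: distrib_right)
qed

lemma level_words: "x \<in> level p \<Longrightarrow> x \<in> words m (l p) \<times> words n (q * p)"
  by (auto simp: level_def)

lemma prefix_level:
  assumes "x \<in> level (Suc p)"
  shows "prefix p x \<in> level p"
proof -
  have x: "fst x \<in> words m (l (Suc p))" "snd x \<in> words n (q * Suc p)"
    "\<And>p'. q * Suc p' \<le> l (Suc p) \<Longrightarrow> block (fst x) p' \<in> G p'"
    using assms by (auto simp: level_def)
  have "block (take (l p) (fst x)) p' \<in> G p'" if "q * Suc p' \<le> l p" for p'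
    unfolding block_take[OF that] by (rule x(3)[OF order_trans[OF that l_mono]])
  then show ?thesis
    using take_in_words[OF x(1) l_mono] take_in_words[OF x(2), of "q * p"]
    by (simp add: level_def prefix_def)
qed

text \<open>The same \<open>K\<close> works at all levels: \<open>a ^ q \<le> 1 / 2\<close> leaves
  at most half of \<open>K * a ^ (q * p)\<close> for the distance of the longer words, and
  \<open>2 * (1 + T) \<le> K\<close> fits the deleted digits into the other half.\<close>

lemma prefix_level_pairs:
  assumes "(x, x') \<in> level_pairs (Suc p)"
  shows "(prefix p x, prefix p x') \<in> level_pairs p"
proof -
  have x: "x \<in> level (Suc p)" "x' \<in> level (Suc p)" "\<bar>word_pos x - word_pos x'\<bar> \<le> K * a ^ (q * Suc p)"
    using assms by (auto simp: level_pairs_def near_pairs_def)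
  have "\<bar>word_pos (prefix p x) - word_pos (prefix p x')\<bar> \<le> \<bar>word_pos x - word_pos x'\<bar> + (1 + T) * a ^ (q * p)"
    using level_words[OF x(1)] level_words[OF x(2)] long[of "Suc p"] l_mono[of p]
    by (intro prefix_near) auto
  also have "\<dots> \<le> K * (a ^ q * a ^ (q * p)) + (1 + T) * a ^ (q * p)"
    using x(3) by (simp add: power_add)
  also have "\<dots> \<le> K * (1 / 2 * a ^ (q * p)) + K / 2 * a ^ (q * p)"
    using q K K_pos ab by (intro add_mono mult_left_mono mult_right_mono) auto
  finally show ?thesis
    using x prefix_level by (simp add: level_pairs_def near_pairs_def)
qed

text \<open>The components are swapped to match the column-first order of
  \<open>block_val\<close>.\<close>

definition suffix :: "nat \<Rightarrow> nat list \<times> nat list \<Rightarrow> nat list \<times> nat list" where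
  "suffix p x = (drop (q * p) (snd x), drop (l p) (fst x))"

lemma suffix_inj: "prefix p x = prefix p x' \<Longrightarrow> suffix p x = suffix p x' \<Longrightarrow> x = x'"
  unfolding prefix_def suffix_def by (metis Pair_inject append_take_drop_id prod.collapse)

lemma suffix_words:
  assumes "x \<in> level (Suc p)"
  shows "suffix p x \<in> words n q \<times> words m (l (Suc p) - l p)"
proof -
  have x: "fst x \<in> words m (l (Suc p))" "snd x \<in> words n (q * Suc p)"
    using assms by (auto simp: level_def)
  show ?thesis
    using drop_in_words[OF x(1), of "l p"] drop_in_words[OF x(2), of "q * p"] by (simp add: suffix_def)
qed

text \<open>The hypothesis \<open>q * Suc p \<le> l p\<close> puts the block that governs the new
  columns inside the prefix. Once the prefix is fixed, the new digits enter through one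
  \<open>block_val\<close> with a constant block.\<close>

lemma word_pos_suffix:
  assumes "x \<in> level (Suc p)" "q * Suc p \<le> l p"
  shows "word_pos x = word_pos (prefix p x)
    + a ^ (q * p) * block_val (block (fst (prefix p x)) p) (t * b ^ l p / a ^ (q * p)) (suffix p x)"
proof -
  obtain i j where x: "x = (i, j)" by (cases x)
  have w: "i \<in> words m (l (Suc p))" "j \<in> words n (q * Suc p)" using level_words[OF assms(1)] x by auto
  obtain X Y where X: "X = word_val a (\<lambda>r. c (i ! (q * p + r))) (drop (q * p) j)"
      "Y = word_val b (\<lambda>_. d) (drop (l p) i)"
      "word_pos (i, j) = word_pos (take (l p) i, take (q * p) j) + a ^ (q * p) * X + t * b ^ l p * Y"
    using word_pos_split[OF w long[of "Suc p"] _ l_mono[of p] long[of p]] by auto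
  have len: "length i = l (Suc p)" "length (drop (q * p) j) = q" using w by (auto simp: words_def)
  have "X = word_val a (\<lambda>r. c (block (take (l p) i) p ! r)) (drop (q * p) j)"
    unfolding X(1) using len assms(2) l_mono[of p]
    by (intro word_val_cong) (auto simp: block_def)
  then show ?thesis
    using X(2,3) ab unfolding x prefix_def suffix_def by (simp add: block_val_def algebra_simps)
qed

lemma near_pairs_shift:
  "card (near_pairs \<delta> B (\<lambda>y. h y - s) B (\<lambda>y. h y - s)) = card (near_pairs \<delta> B h B (h :: 'b \<Rightarrow> real))"
  by (simp add: near_pairs_def)

text \<open>For two fixed words of level \<open>p\<close>, the near pairs of extensions inject after
  rescaling into the near pairs of \<open>block_val u\<close> and a translate of
  \<open>block_val u'\<close>. Dropping the restrictions on the new row digits only enlarges the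
  count. If \<open>1 \<le> g p\<close>, counting all pairs is enough.\<close>

lemma card_level_pairs_Suc:
  "real (card (level_pairs (Suc p)))
    \<le> g p * (real n ^ q * real m ^ (l (Suc p) - l p)) ^ 2 * real (card (level_pairs p))"
proof (rule card_le_mult_fibres[where f = "\<lambda>(x, x'). (prefix p x, prefix p x')"])
  let ?F = "words n q \<times> words m (l (Suc p) - l p)"
  define N where "N = real n ^ q * real m ^ (l (Suc p) - l p)"
  have cF: "real (card ?F) = N" by (simp add: N_def card_cartesian_product)
  show "(\<lambda>(x, x'). (prefix p x, prefix p x')) ` level_pairs (Suc p) \<subseteq> level_pairs p"
    using prefix_level_pairs by auto
  fix e assume e: "e \<in> level_pairs p"
  obtain w w' where ww: "e = (w, w')" by (cases e)
  have wl: "w \<in> level p" "w' \<in> level p" using e ww by (auto simp: level_pairs_def near_pairs_def)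
  define Fib where "Fib = {z\<in>level_pairs (Suc p). (\<lambda>(x, x'). (prefix p x, prefix p x')) z = e}"
  define \<sigma> where "\<sigma> = (\<lambda>(x, x'). (suffix p x, suffix p x'))"
  have FibD: "x \<in> level (Suc p)" "x' \<in> level (Suc p)" "prefix p x = w" "prefix p x' = w'"
      "\<bar>word_pos x - word_pos x'\<bar> \<le> K * a ^ (q * Suc p)" if "(x, x') \<in> Fib" for x x'
    using that by (auto simp: Fib_def ww level_pairs_def near_pairs_def)
  have finFib: "finite Fib" by (simp add: Fib_def finite_level_pairs)
  have inj: "inj_on \<sigma> Fib"
  proof (rule inj_onI)
    fix z z' assume z: "z \<in> Fib" "z' \<in> Fib" "\<sigma> z = \<sigma> z'"
    obtain x x' y y' where "z = (x, x')" "z' = (y, y')" by (cases z, cases z')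
    then have "(x, x') \<in> Fib" "(y, y') \<in> Fib" "suffix p x = suffix p y" "suffix p x' = suffix p y'"
      using z by (simp_all add: \<sigma>_def)
    then have "x = y" "x' = y'"
      using suffix_inj[of p x y] suffix_inj[of p x' y'] FibD(3,4)[of x x'] FibD(3,4)[of y y'] by simp_all
    then show "z = z'" using \<open>z = (x, x')\<close> \<open>z' = (y, y')\<close> by simp
  qed
  have "real (card Fib) \<le> g p * N ^ 2"
  proof (cases "1 \<le> g p")
    case True
    have "\<sigma> ` Fib \<subseteq> ?F \<times> ?F"
    proof
      fix y assume "y \<in> \<sigma> ` Fib"
      then obtain x x' where x: "(x, x') \<in> Fib" "y = \<sigma> (x, x')" by auto
      then show "y \<in> ?F \<times> ?F" using suffix_words FibD[OF x(1)] by (simp add: \<sigma>_def)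
    qed
    then have "card Fib \<le> card (?F \<times> ?F)" using inj by (intro card_inj_on_le) auto
    then have "real (card Fib) \<le> real (card (?F \<times> ?F))" by (simp only: of_nat_le_iff)
    also have "\<dots> = real (card ?F) ^ 2"
      by (simp only: card_cartesian_product[of ?F ?F] of_nat_mult power2_eq_square)
    also have "\<dots> = 1 * N ^ 2" unfolding cF by simp
    also have "\<dots> \<le> g p * N ^ 2" using True by (intro mult_right_mono) auto
    finally show ?thesis .
  next
    case False
    then have st: "q * Suc p \<le> l p"
      "\<And>u. u \<in> G p \<Longrightarrow> 3 * real (energy u (t * b ^ l p / a ^ (q * p)) (K * a ^ q) q (l (Suc p) - l p)) \<le> g p * N ^ 2"
      using step[of p] by (auto simp: N_def)
    define u where "u = block (fst w) p"
    define u' where "u' = block (fst w') p"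
    define \<tau> where "\<tau> = t * b ^ l p / a ^ (q * p)"
    \<comment> \<open>The relative position of the two squares, about which nothing beyond nearness
      is known.\<close>
    define s where "s = (word_pos w - word_pos w') / a ^ (q * p)"
    have uG: "u \<in> G p" "u' \<in> G p" using wl st(1) by (auto simp: level_def u_def u'_def)
    define NP where "NP = near_pairs (K * a ^ q) ?F (block_val u \<tau>) ?F (\<lambda>y. block_val u' \<tau> y - s)"
    have "\<sigma> ` Fib \<subseteq> NP"
    proof
      fix y assume "y \<in> \<sigma> ` Fib"
      then obtain x x' where x: "(x, x') \<in> Fib" "y = \<sigma> (x, x')" by auto
      note D = FibD[OF x(1)]
      have A: "0 < a ^ (q * p)" using ab by simp
      then have s: "a ^ (q * p) * s = word_pos w - word_pos w'"
        unfolding s_def by (metis less_irrefl nonzero_mult_div_cancel_left times_divide_eq_right)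
      have "word_pos x - word_pos x' = a ^ (q * p) * (block_val u \<tau> (suffix p x) - (block_val u' \<tau> (suffix p x') - s))"
        using word_pos_suffix[OF D(1) st(1)] word_pos_suffix[OF D(2) st(1)] s
        unfolding D(3,4) u_def[symmetric] u'_def[symmetric] \<tau>_def[symmetric]
        by (simp add: right_diff_distrib)
      then have "a ^ (q * p) * \<bar>block_val u \<tau> (suffix p x) - (block_val u' \<tau> (suffix p x') - s)\<bar>
          = \<bar>word_pos x - word_pos x'\<bar>" using A by (simp add: abs_mult)
      also have "\<dots> \<le> a ^ (q * p) * (K * a ^ q)" using D(5) by (simp add: power_add mult_ac)
      finally have "\<bar>block_val u \<tau> (suffix p x) - (block_val u' \<tau> (suffix p x') - s)\<bar> \<le> K * a ^ q"
        using A by (simp only: mult_le_cancel_left_pos)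
      then show "y \<in> NP" using x(2) suffix_words D by (simp add: NP_def near_pairs_def \<sigma>_def)
    qed
    then have "card Fib \<le> card NP" using inj by (intro card_inj_on_le) (auto simp: NP_def)
    \<comment> \<open>Self-counts do not see the translation by \<open>s\<close>, so the energies of
      the two blocks suffice. This 3 is the one in the assumption \<open>step\<close>.\<close>
    moreover have "2 * card NP \<le> 3 * (energy u \<tau> (K * a ^ q) q (l (Suc p) - l p)
        + energy u' \<tau> (K * a ^ q) q (l (Suc p) - l p))"
      using card_near_pairs_cross[of ?F ?F "K * a ^ q" "block_val u \<tau>" "\<lambda>y. block_val u' \<tau> y - s"] K_pos ab
      unfolding NP_def energy_def near_pairs_shift by simp
    ultimately have "2 * card Fib \<le> 3 * (energy u \<tau> (K * a ^ q) q (l (Suc p) - l p)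
        + energy u' \<tau> (K * a ^ q) q (l (Suc p) - l p))" by linarith
    then have "real (2 * card Fib) \<le> real (3 * (energy u \<tau> (K * a ^ q) q (l (Suc p) - l p)
        + energy u' \<tau> (K * a ^ q) q (l (Suc p) - l p)))" by (simp only: of_nat_le_iff)
    then have "2 * real (card Fib) \<le> 3 * real (energy u \<tau> (K * a ^ q) q (l (Suc p) - l p))
        + 3 * real (energy u' \<tau> (K * a ^ q) q (l (Suc p) - l p))" by (simp add: distrib_left)
    then show ?thesis using st(2)[OF uG(1)] st(2)[OF uG(2)] by (simp add: \<tau>_def)
  qed
  then show "real (card {z \<in> level_pairs (Suc p). (case z of (x, x') \<Rightarrow> (prefix p x, prefix p x')) = e})
      \<le> g p * (real n ^ q * real m ^ (l (Suc p) - l p))\<^sup>2"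
    unfolding Fib_def N_def .
qed (rule finite_level_pairs)+

lemma card_level_pairs_le:
  "real (card (level_pairs p)) \<le> (real n ^ (q * p) * real m ^ l p) ^ 2 * (\<Prod>i<p. g i)"
proof (induction p)
  case 0
  have "level 0 \<subseteq> {([], [])}"
    unfolding level_def l_0 mult_0_right words_0 by blast
  then have "level_pairs 0 \<subseteq> {(([], []), ([], []))}"
    unfolding level_pairs_def near_pairs_def by blast
  then have "card (level_pairs 0) \<le> card {(([] :: nat list, [] :: nat list), ([] :: nat list, [] :: nat list))}"
    by (intro card_mono) auto
  then show ?case by (simp add: l_0)
next
  case (Suc p)
  define M where "M = real n ^ q * real m ^ (l (Suc p) - l p)"
  define N where "N = real n ^ (q * p) * real m ^ l p"
  have "real n ^ (q * Suc p) = real n ^ q * real n ^ (q * p)" by (simp add: power_add)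
  moreover have "real m ^ l (Suc p) = real m ^ (l (Suc p) - l p) * real m ^ l p"
    unfolding power_add[symmetric] using l_mono[of p] by simp
  ultimately have MN: "real n ^ (q * Suc p) * real m ^ l (Suc p) = M * N" by (simp add: M_def N_def)
  have "real (card (level_pairs (Suc p))) \<le> g p * M ^ 2 * real (card (level_pairs p))"
    unfolding M_def by (rule card_level_pairs_Suc)
  also have "\<dots> \<le> g p * M ^ 2 * (N ^ 2 * (\<Prod>i<p. g i))"
    using Suc g_nonneg[of p] by (intro mult_left_mono) (simp_all add: N_def)
  also have "\<dots> = (M * N) ^ 2 * (\<Prod>i<Suc p. g i)"
    by (simp add: power_mult_distrib)
  finally show ?case unfolding MN .
qed

section \<open>Row words made of complete allowed blocks\<close>

definition row_words :: "nat \<Rightarrow> nat list set" where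
  "row_words B = {is\<in>words m (q * B). \<forall>p<B. block is p \<in> G p}"

lemma finite_row_words [simp]: "finite (row_words B)"
  by (simp add: row_words_def)

lemma block_append: "q * Suc p \<le> length xs \<Longrightarrow> block (xs @ ys) p = block xs p"
  by (simp add: block_def)

text \<open>Complete blocks make this set a product of the \<open>G p\<close>, so that cardinalities
  multiply exactly; a \<open>level\<close> may instead end in the middle of a block.\<close>

lemma row_words_Suc: "row_words (Suc B) = (\<lambda>(x, u). x @ u) ` (row_words B \<times> G B)"
proof (intro equalityI subsetI)
  fix x assume x: "x \<in> row_words (Suc B)"
  then have xw: "x \<in> words m (q * Suc B)" "length x = q * Suc B" by (auto simp: row_words_def words_def)
  have "drop (q * B) x = block x B" using xw(2) by (simp add: block_def)
  then have "drop (q * B) x \<in> G B" using x by (simp add: row_words_def)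
  moreover have "block (take (q * B) x) p = block x p" if "p < B" for p
    using mult_le_mono2[of "Suc p" B q] that by (intro block_take) simp
  then have "take (q * B) x \<in> row_words B"
    using x take_in_words[OF xw(1), of "q * B"] by (auto simp: row_words_def)
  ultimately show "x \<in> (\<lambda>(x, u). x @ u) ` (row_words B \<times> G B)"
    by (intro image_eqI[of _ _ "(take (q * B) x, drop (q * B) x)"]) auto
next
  fix x assume "x \<in> (\<lambda>(x, u). x @ u) ` (row_words B \<times> G B)"
  then obtain y u where y: "x = y @ u" "y \<in> row_words B" "u \<in> G B" by auto
  have u: "u \<in> words m q" using y G_words by auto
  have len: "length y = q * B" "length u = q" using y u by (auto simp: row_words_def words_def)
  have "block x p \<in> G p" if "p < Suc B" for p
  proof (cases "p = B")
    case True
    then show ?thesis using y len by (simp add: block_def)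
  next
    case False
    then have "block x p = block y p"
      using mult_le_mono2[of "Suc p" B q] that len unfolding y(1) by (intro block_append) simp
    then show ?thesis using y(2) False that by (simp add: row_words_def)
  qed
  moreover have "x \<in> words m (q * Suc B)" using y u by (auto simp: words_def row_words_def)
  ultimately show "x \<in> row_words (Suc B)" by (auto simp: row_words_def)
qed

lemma row_words_length: "x \<in> row_words B \<Longrightarrow> length x = q * B"
  by (simp add: row_words_def words_def)

lemma append_inj_row_words: "inj_on (\<lambda>(x, u). x @ u) (row_words B \<times> G B)"
proof (rule inj_onI)
  fix z z' assume z: "z \<in> row_words B \<times> G B" "z' \<in> row_words B \<times> G B"
    "(case z of (x, u) \<Rightarrow> x @ u) = (case z' of (x, u) \<Rightarrow> x @ u)"
  have "length (fst z) = length (fst z')" using z row_words_length by (metis mem_Times_iff)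
  then show "z = z'" using z(3) by (simp add: case_prod_unfold prod_eq_iff)
qed

lemma card_row_words_Suc: "card (row_words (Suc B)) = card (row_words B) * card (G B)"
  unfolding row_words_Suc by (simp only: card_image[OF append_inj_row_words] card_cartesian_product)

lemma card_row_words_ge: "m ^ (q * B) \<le> 2 ^ B * card (row_words B)"
proof (induction B)
  case 0
  have "row_words 0 = {[]}" by (auto simp: row_words_def)
  then show ?case by simp
next
  case (Suc B)
  have "m ^ (q * Suc B) = m ^ (q * B) * m ^ q" by (simp add: power_add)
  also have "\<dots> \<le> (2 ^ B * card (row_words B)) * (2 * card (G B))" using Suc G_card by (intro mult_mono) auto
  also have "\<dots> = 2 ^ Suc B * card (row_words (Suc B))" by (simp add: card_row_words_Suc)
  finally show ?case .
qed

text \<open>The prefix lies in the first \<open>B'\<close> blocks, where the restriction loses at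
  most \<open>2 ^ B'\<close> against all words. Each later block multiplies both sides by
  \<open>card (G B)\<close>, so the loss does not grow with \<open>B\<close>.\<close>

lemma card_row_words_prefix:
  assumes "B' \<le> B" "h \<le> q * B'"
  shows "card {x\<in>row_words B. take h x = v} * m ^ h \<le> 2 ^ B' * card (row_words B)"
  using assms(1)
proof (induction B rule: dec_induct)
  case base
  have "card {x\<in>row_words B'. take h x = v} \<le> card {x\<in>words m (q * B'). take h x \<in> {v}}"
    by (intro card_mono) (auto simp: row_words_def)
  also have "\<dots> = card (words m h \<inter> {v}) * m ^ (q * B' - h)"
    by (rule card_words_prefix[OF assms(2)])
  also have "\<dots> \<le> 1 * m ^ (q * B' - h)"
    by (intro mult_right_mono) (auto intro: order_trans[OF card_mono[of "{v}"]])
  finally have "card {x\<in>row_words B'. take h x = v} * m ^ h \<le> m ^ (q * B' - h) * m ^ h" by simp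
  also have "\<dots> = m ^ (q * B')" using assms(2) by (simp add: power_add[symmetric])
  also have "\<dots> \<le> 2 ^ B' * card (row_words B')" by (rule card_row_words_ge)
  finally show ?case .
next
  case (step B)
  have "h \<le> q * B" using assms(2) step(1) by (meson mult_le_mono2 order_trans)
  then have tk: "take h (x @ u) = take h x" if "x \<in> row_words B" for x u
    using row_words_length[OF that] by simp
  have "{x\<in>row_words (Suc B). take h x = v}
      = (\<lambda>(x, u). x @ u) ` {s\<in>row_words B \<times> G B. take h (case s of (x, u) \<Rightarrow> x @ u) = v}"
    unfolding row_words_Suc by blast
  also have "{s\<in>row_words B \<times> G B. take h (case s of (x, u) \<Rightarrow> x @ u) = v} = {x\<in>row_words B. take h x = v} \<times> G B"
    by (auto simp: tk simp del: take_append)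
  finally have "{x\<in>row_words (Suc B). take h x = v} = (\<lambda>(x, u). x @ u) ` ({x\<in>row_words B. take h x = v} \<times> G B)" .
  moreover have "inj_on (\<lambda>(x, u). x @ u) ({x\<in>row_words B. take h x = v} \<times> G B)"
    by (rule inj_on_subset[OF append_inj_row_words[of B]]) auto
  ultimately have "card {x\<in>row_words (Suc B). take h x = v} = card {x\<in>row_words B. take h x = v} * card (G B)"
    by (simp only: card_image card_cartesian_product)
  then show ?case
    using mult_right_mono[OF step(3), of "card (G B)"] by (simp only: card_row_words_Suc mult_ac zero_le)
qed

lemma row_words_nonempty: "row_words B \<noteq> {}"
  using card_row_words_ge[of B] ab by auto

text \<open>Truncation maps near pairs of \<Omega> into \<open>level_pairs p\<close>. A word of
  level \<open>p\<close> has at most \<open>2 ^ B'\<close> times its uniform share of extensions in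
  \<Omega>, hence \<open>4 ^ B'\<close> for pairs. As \<open>B\<close> enters only through
  \<open>card \<Omega>\<close>, one family can serve many scales.\<close>

lemma card_near_pairs_row_words_le:
  assumes "B' \<le> B" "l p \<le> q * B'" "K' + (1 + T) \<le> K"
  defines "\<Omega> \<equiv> row_words B \<times> words n (q * B)"
  shows "real (card (near_pairs (K' * a ^ (q * p)) \<Omega> word_pos \<Omega> word_pos))
    \<le> 4 ^ B' * real (card \<Omega>) ^ 2 * (\<Prod>i<p. g i)"
proof -
  define NP where "NP = near_pairs (K' * a ^ (q * p)) \<Omega> word_pos \<Omega> word_pos"
  define N where "N = real n ^ (q * p) * real m ^ l p"
  have N: "0 < N" using ab by (simp add: N_def)
  have fin\<Omega>: "finite \<Omega>" by (simp add: \<Omega>_def)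
  have lB: "l p \<le> q * B" using assms(1,2) by (meson mult_le_mono2 order_trans)
  have pB: "q * p \<le> q * B" using long lB by (rule order_trans)
  have fib: "real (card {x\<in>\<Omega>. prefix p x = w}) \<le> 2 ^ B' * real (card \<Omega>) / N" for w
  proof -
    obtain i j where w: "w = (i, j)" by (cases w)
    have "{x\<in>\<Omega>. prefix p x = w} = {x\<in>row_words B. take (l p) x = i} \<times> {x\<in>words n (q * B). take (q * p) x \<in> {j}}"
      by (auto simp: \<Omega>_def prefix_def w)
    then have "card {x\<in>\<Omega>. prefix p x = w}
        = card {x\<in>row_words B. take (l p) x = i} * (card (words n (q * p) \<inter> {j}) * n ^ (q * B - q * p))"
      by (simp only: card_cartesian_product card_words_prefix[OF pB])
    also have "\<dots> \<le> card {x\<in>row_words B. take (l p) x = i} * (1 * n ^ (q * B - q * p))"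
      by (intro mult_left_mono mult_right_mono) (auto intro: order_trans[OF card_mono[of "{j}"]])
    finally have "card {x\<in>\<Omega>. prefix p x = w} * (m ^ l p * n ^ (q * p))
        \<le> (card {x\<in>row_words B. take (l p) x = i} * m ^ l p) * (n ^ (q * B - q * p) * n ^ (q * p))"
      by (simp add: mult_ac)
    also have "n ^ (q * B - q * p) * n ^ (q * p) = n ^ (q * B)" using pB by (simp add: power_add[symmetric])
    also have "(card {x\<in>row_words B. take (l p) x = i} * m ^ l p) * n ^ (q * B) \<le> (2 ^ B' * card (row_words B)) * n ^ (q * B)"
      by (intro mult_right_mono card_row_words_prefix assms) auto
    also have "\<dots> = 2 ^ B' * card \<Omega>" by (simp add: \<Omega>_def card_cartesian_product)
    finally have "real (card {x\<in>\<Omega>. prefix p x = w} * (m ^ l p * n ^ (q * p))) \<le> real (2 ^ B' * card \<Omega>)"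
      by (simp only: of_nat_le_iff)
    then have "real (card {x\<in>\<Omega>. prefix p x = w}) * N \<le> 2 ^ B' * real (card \<Omega>)"
      by (simp add: N_def mult_ac)
    then show ?thesis using N by (simp only: pos_le_divide_eq)
  qed
  have "real (card NP) \<le> (2 ^ B' * real (card \<Omega>) / N) ^ 2 * real (card (level_pairs p))"
  proof (rule card_le_mult_fibres[where f = "\<lambda>(x, x'). (prefix p x, prefix p x')"])
    show "(\<lambda>(x, x'). (prefix p x, prefix p x')) ` NP \<subseteq> level_pairs p"
    proof
      fix e assume "e \<in> (\<lambda>(x, x'). (prefix p x, prefix p x')) ` NP"
      then obtain x x' where xx: "(x, x') \<in> NP" "e = (prefix p x, prefix p x')" by auto
      from xx(1) have x: "x \<in> \<Omega>" "x' \<in> \<Omega>" "\<bar>word_pos x - word_pos x'\<bar> \<le> K' * a ^ (q * p)"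
        by (auto simp: NP_def near_pairs_def)
      have lev: "prefix p y \<in> level p" if y\<Omega>: "y \<in> \<Omega>" for y
      proof -
        obtain i j where y: "y = (i, j)" "i \<in> row_words B" "j \<in> words n (q * B)" using y\<Omega> by (auto simp: \<Omega>_def)
        have "block (take (l p) i) p' \<in> G p'" if p': "q * Suc p' \<le> l p" for p'
        \<comment> \<open>This case contradicts \<open>a ^ q \<le> 1 / 2\<close>.\<close>
        proof (cases "q = 0")
          case True
          then have "0 < B" using q by simp
          then show ?thesis using True q by simp
        next
          case False
          have "q * Suc p' \<le> q * B" using p' lB by (rule order_trans)
          then have "Suc p' \<le> B" unfolding mult_le_cancel1 using False by blast
          then have "p' < B" by simp
          then show ?thesis using y(2) block_take[OF p'] by (simp add: row_words_def)
        qed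
        then show ?thesis using y lB pB
          by (auto simp: level_def prefix_def row_words_def intro!: take_in_words)
      qed
      have "\<bar>word_pos (prefix p x) - word_pos (prefix p x')\<bar> \<le> \<bar>word_pos x - word_pos x'\<bar> + (1 + T) * a ^ (q * p)"
        using x lB pB by (intro prefix_near[of _ "q * B" "q * B"]) (auto simp: \<Omega>_def row_words_def)
      also have "\<dots> \<le> (K' + (1 + T)) * a ^ (q * p)" using x(3) by (simp add: algebra_simps)
      also have "\<dots> \<le> K * a ^ (q * p)" using assms(3) ab by (intro mult_right_mono) auto
      finally show "e \<in> level_pairs p"
        using lev x xx(2) by (simp add: level_pairs_def near_pairs_def)
    qed
    fix e :: "(nat list \<times> nat list) \<times> (nat list \<times> nat list)"
    obtain w w' where e: "e = (w, w')" by (cases e)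
    have "card {z\<in>NP. (case z of (x, x') \<Rightarrow> (prefix p x, prefix p x')) = e}
        \<le> card ({x\<in>\<Omega>. prefix p x = w} \<times> {x\<in>\<Omega>. prefix p x = w'})"
      using fin\<Omega> by (intro card_mono) (auto simp: NP_def near_pairs_def e)
    then have "real (card {z\<in>NP. (case z of (x, x') \<Rightarrow> (prefix p x, prefix p x')) = e})
        \<le> real (card {x\<in>\<Omega>. prefix p x = w}) * real (card {x\<in>\<Omega>. prefix p x = w'})"
      unfolding card_cartesian_product of_nat_mult[symmetric] of_nat_le_iff .
    also have "\<dots> \<le> (2 ^ B' * real (card \<Omega>) / N) * (2 ^ B' * real (card \<Omega>) / N)"
      using N by (intro mult_mono fib) (simp_all add: divide_nonneg_pos)
    finally show "real (card {z\<in>NP. (case z of (x, x') \<Rightarrow> (prefix p x, prefix p x')) = e})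
        \<le> (2 ^ B' * real (card \<Omega>) / N) ^ 2" unfolding power2_eq_square .
  next
    show "finite NP" using fin\<Omega> by (simp add: NP_def)
  qed (rule finite_level_pairs)
  also have "\<dots> \<le> (2 ^ B' * real (card \<Omega>) / N) ^ 2 * (N ^ 2 * (\<Prod>i<p. g i))"
    using card_level_pairs_le[of p] by (intro mult_left_mono) (auto simp: N_def)
  also have "\<dots> = 4 ^ B' * real (card \<Omega>) ^ 2 * (\<Prod>i<p. g i)"
  proof -
    have "(2 ^ B') ^ 2 = (4 :: real) ^ B'"
      using power_mult_distrib[of 2 "2 :: real" B'] by (simp add: power2_eq_square)
    moreover have "(x / N) ^ 2 * (N ^ 2 * y) = x ^ 2 * y" for x y
      using N by (simp add: power_divide)
    ultimately show ?thesis by (simp only: power_mult_distrib)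
  qed
  finally show ?thesis unfolding NP_def .
qed

end

section \<open>Equidistributed slopes\<close>

text \<open>By Chebyshev's inequality at each scale, the slack \<open>\<sigma> - s\<close> makes the
  proportion of points with too many neighbours decay geometrically in \<open>p\<close>; all scales
  together discard at most half of \<Omega>, whatever \<open>P\<close> is.\<close>

lemma chebyshev_near_pairs:
  fixes f :: "'a \<Rightarrow> real"
  assumes "finite \<Omega>" "\<Omega> \<noteq> {}" "0 < \<rho>" "\<rho> < 1" "0 < C" "s < \<sigma>"
    and pairs: "\<And>p. p \<le> P \<Longrightarrow> real (card (near_pairs (K * \<rho> ^ p) \<Omega> f \<Omega> f))
      \<le> C * (\<rho> ^ p) powr \<sigma> * real (card \<Omega>) ^ 2"
  shows "\<exists>G\<subseteq>\<Omega>. card \<Omega> \<le> 2 * card G \<and> (\<forall>\<omega>\<in>G. \<forall>p\<le>P. real (card {\<omega>'\<in>\<Omega>. \<bar>f \<omega> - f \<omega>'\<bar> \<le> K * \<rho> ^ p})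
    \<le> 2 * C / (1 - \<rho> powr (\<sigma> - s)) * (\<rho> ^ p) powr s * real (card \<Omega>))"
proof -
  define r where "r = \<rho> powr (\<sigma> - s)"
  have r: "0 < r" "r < 1" using assms powr_less_mono2[of "\<sigma> - s" \<rho> 1] by (auto simp: r_def)
  \<comment> \<open>Makes the discarded proportions \<open>(1 - r) / 2 * r ^ p\<close>, whose sum is
    at most \<open>1 / 2\<close>.\<close>
  define D where "D = 2 * C / (1 - r)"
  have D: "0 < D" using assms r by (simp add: D_def)
  define W where "W = real (card \<Omega>)"
  have W: "0 < W" using assms by (auto simp: W_def card_gt_0_iff)
  define cnt where "cnt p \<omega> = real (card {\<omega>'\<in>\<Omega>. \<bar>f \<omega> - f \<omega>'\<bar> \<le> K * \<rho> ^ p})" for p \<omega>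
  define Bad where "Bad p = {\<omega>\<in>\<Omega>. D * (\<rho> ^ p) powr s * W < cnt p \<omega>}" for p
  have Bad: "real (card (Bad p)) \<le> (1 - r) / 2 * r ^ p * W" if "p \<le> P" for p
  proof -
    have pos: "0 < (\<rho> ^ p) powr s" using assms by simp
    have rp: "(\<rho> ^ p) powr \<sigma> = (\<rho> ^ p) powr s * r ^ p"
      using assms by (simp add: r_def powr_realpow[symmetric] powr_powr powr_add[symmetric] algebra_simps)
    have "real (card (Bad p)) * (D * (\<rho> ^ p) powr s * W) = (\<Sum>\<omega>\<in>Bad p. D * (\<rho> ^ p) powr s * W)" by simp
    also have "\<dots> \<le> (\<Sum>\<omega>\<in>Bad p. cnt p \<omega>)" by (intro sum_mono) (auto simp: Bad_def)
    also have "\<dots> \<le> (\<Sum>\<omega>\<in>\<Omega>. cnt p \<omega>)"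
      using assms by (intro sum_mono2) (auto simp: Bad_def cnt_def)
    also have "\<dots> = real (card (near_pairs (K * \<rho> ^ p) \<Omega> f \<Omega> f))"
      unfolding cnt_def card_near_pairs_eq_sum[OF assms(1,1)] card_eq_sum_of_bool[OF assms(1)] ..
    also have "\<dots> \<le> C * (\<rho> ^ p) powr \<sigma> * W ^ 2" unfolding W_def by (rule pairs[OF that])
    also have "\<dots> = ((1 - r) / 2 * r ^ p * W) * (D * (\<rho> ^ p) powr s * W)"
      unfolding rp D_def using r by (simp add: power2_eq_square)
    finally show ?thesis
      using D W pos by (meson mult_le_cancel_right_pos mult_pos_pos)
  qed
  define G where "G = \<Omega> - (\<Union>p\<le>P. Bad p)"
  have "real (card (\<Union>p\<le>P. Bad p)) \<le> (\<Sum>p\<le>P. real (card (Bad p)))"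
    unfolding of_nat_sum[symmetric] of_nat_le_iff by (rule card_UN_le) simp
  also have "\<dots> \<le> (\<Sum>p\<le>P. (1 - r) / 2 * r ^ p * W)" using Bad by (intro sum_mono) auto
  also have "\<dots> = W / 2 * ((1 - r) * (\<Sum>p\<le>P. r ^ p))" by (simp add: sum_distrib_left mult_ac)
  also have "(1 - r) * (\<Sum>p\<le>P. r ^ p) = 1 - r ^ Suc P"
    using sum_gp_basic[of r P] by simp
  also have "W / 2 * (1 - r ^ Suc P) \<le> W / 2 * 1" using W r by (intro mult_left_mono) auto
  finally have "2 * card (\<Union>p\<le>P. Bad p) \<le> card \<Omega>" by (simp add: W_def)
  moreover have "card G = card \<Omega> - card (\<Union>p\<le>P. Bad p)"
    unfolding G_def using assms(1) by (intro card_Diff_subset) (auto simp: Bad_def)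
  ultimately have "card \<Omega> \<le> 2 * card G" by simp
  moreover have "cnt p \<omega> \<le> D * (\<rho> ^ p) powr s * W" if "\<omega> \<in> G" "p \<le> P" for \<omega> p
    using that by (auto simp: G_def Bad_def not_less)
  ultimately show ?thesis
    unfolding cnt_def D_def W_def r_def by (intro exI[of _ G]) (auto simp: G_def)
qed

context GL_slope
begin

text \<open>The number of new row digits varies with the step, while the averaged bound will be used
  with one fixed \<open>Q\<close>. Padding all words alike by the digit 1 adds a common constant,
  which cancels in differences; the change of slope costs at most \<eta>, as row positions differ by
  at most 1.\<close>

lemma energy_pad:
  assumes "wk \<le> Q" "\<bar>\<tau> - \<tau>'\<bar> \<le> \<eta>" "\<delta> + \<eta> \<le> \<delta>'"
  shows "energy u \<tau> \<delta> q wk \<le> energy u \<tau>' \<delta>' q Q"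
proof -
  define e where "e x = (fst x, snd x @ replicate (Q - wk) 1)" for x :: "nat list \<times> nat list"
  let ?N = "near_pairs \<delta> (words n q \<times> words m wk) (block_val u \<tau>) (words n q \<times> words m wk) (block_val u \<tau>)"
  have mem: "e x \<in> words n q \<times> words m Q" if "x \<in> words n q \<times> words m wk" for x
    using that assms(1) ab by (auto simp: e_def words_def)
  have "(\<lambda>(x, y). (e x, e y)) ` ?N
      \<subseteq> near_pairs \<delta>' (words n q \<times> words m Q) (block_val u \<tau>') (words n q \<times> words m Q) (block_val u \<tau>')"
  proof
    fix z assume "z \<in> (\<lambda>(x, y). (e x, e y)) ` ?N"
    then obtain v w v' w' where z: "((v, w), (v', w')) \<in> ?N" "z = (e (v, w), e (v', w'))" by auto
    from z(1) have N: "(v, w) \<in> words n q \<times> words m wk" "(v', w') \<in> words n q \<times> words m wk"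
      "\<bar>block_val u \<tau> (v, w) - block_val u \<tau> (v', w')\<bar> \<le> \<delta>" by (auto simp: near_pairs_def)
    have w: "w \<in> words m wk" "w' \<in> words m wk" "length w = wk" "length w' = wk"
      using N by (auto simp: words_def)
    let ?y = "word_val b (\<lambda>_. d)" and ?x = "word_val a (\<lambda>i. c (u ! i))"
    have "0 \<le> ?y w" "?y w \<le> 1 - b ^ wk" "0 \<le> ?y w'" "?y w' \<le> 1 - b ^ wk" "0 \<le> b ^ wk"
      using word_val_range[OF digit_system_d w(1) ab(4,3)] word_val_range[OF digit_system_d w(2) ab(4,3)] ab
      by auto
    then have "\<bar>?y w - ?y w'\<bar> \<le> 1" by linarith
    then have "\<bar>\<tau>' - \<tau>\<bar> * \<bar>?y w - ?y w'\<bar> \<le> \<eta> * 1"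
      using assms(2) by (intro mult_mono) auto
    then have "\<bar>(\<tau>' - \<tau>) * (?y w - ?y w')\<bar> \<le> \<eta>" by (simp add: abs_mult)
    moreover have "block_val u \<tau>' (e (v, w)) - block_val u \<tau>' (e (v', w'))
        = (block_val u \<tau> (v, w) - block_val u \<tau> (v', w')) + (\<tau>' - \<tau>) * (?y w - ?y w')"
      using w by (simp add: block_val_def e_def word_val_append algebra_simps)
    ultimately have "\<bar>block_val u \<tau>' (e (v, w)) - block_val u \<tau>' (e (v', w'))\<bar> \<le> \<delta>'"
      using N(3) assms(3) by linarith
    then show "z \<in> near_pairs \<delta>' (words n q \<times> words m Q) (block_val u \<tau>') (words n q \<times> words m Q) (block_val u \<tau>')"
      using mem[OF N(1)] mem[OF N(2)] z(2) by (simp add: near_pairs_def)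
  qed
  moreover have "inj_on (\<lambda>(x, y). (e x, e y)) ?N"
    by (rule inj_onI) (auto simp: e_def)
  ultimately show ?thesis
    unfolding energy_def by (intro card_inj_on_le) auto
qed

text \<open>The saving \<open>(a ^ q) powr \<epsilon>\<close> beats any factor linear in
  \<open>q\<close>; \<open>\<kappa> * real q + 2\<close> will bound \<open>Suc Q\<close>, the number
  of scales.\<close>

lemma exists_block_length:
  assumes "0 < \<epsilon>" "0 < A" "0 < A'"
  obtains q where "0 < q" "a ^ q \<le> 1 / 2" "A * (\<kappa> * real q + 2) * (a ^ q) powr \<epsilon> \<le> \<epsilon>"
    "A' * (a ^ q) powr \<epsilon> \<le> 1"
proof -
  define r where "r = a powr \<epsilon>"
  have r: "0 < r" "r < 1" using assms ab powr_less_mono2[of \<epsilon> a 1] by (auto simp: r_def)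
  have pr: "(a ^ q) powr \<epsilon> = r ^ q" for q
    using ab by (simp add: r_def powr_realpow[symmetric] powr_powr mult.commute)
  have l1: "(\<lambda>q. r ^ q) \<longlonglongrightarrow> 0" and l2: "(\<lambda>q. a ^ q) \<longlonglongrightarrow> 0"
    using r ab by (auto intro!: LIMSEQ_realpow_zero)
  have l3: "(\<lambda>q. real q * r ^ q) \<longlonglongrightarrow> 0"
    using powser_times_n_limit_0[of r] r by simp
  have "(\<lambda>q. A * (\<kappa> * (real q * r ^ q) + 2 * r ^ q)) \<longlonglongrightarrow> A * (\<kappa> * 0 + 2 * 0)"
    by (intro tendsto_intros l1 l3)
  then have "\<forall>\<^sub>F q in sequentially. A * (\<kappa> * (real q * r ^ q) + 2 * r ^ q) < \<epsilon>"
    using assms by (intro order_tendstoD) auto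
  moreover have "(\<lambda>q. A' * r ^ q) \<longlonglongrightarrow> A' * 0" by (intro tendsto_intros l1)
  then have "\<forall>\<^sub>F q in sequentially. A' * r ^ q < 1" by (intro order_tendstoD) auto
  moreover have "\<forall>\<^sub>F q in sequentially. a ^ q < 1 / 2" using l2 by (intro order_tendstoD) auto
  moreover have "\<forall>\<^sub>F q in sequentially. 0 < q" by (rule eventually_gt_at_top)
  ultimately have "\<forall>\<^sub>F q in sequentially. 0 < q \<and> a ^ q < 1 / 2 \<and> A' * r ^ q < 1 \<and>
      A * (\<kappa> * (real q * r ^ q) + 2 * r ^ q) < \<epsilon>" by eventually_elim auto
  then obtain q where "0 < q" "a ^ q < 1 / 2" "A' * r ^ q < 1" "A * (\<kappa> * (real q * r ^ q) + 2 * r ^ q) < \<epsilon>"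
    unfolding eventually_sequentially by blast
  then show ?thesis by (intro that[of q]) (simp_all add: pr algebra_simps)
qed

lemma exists_few_near_pairs:
  assumes irr: "\<kappa> \<notin> \<rat>" and \<sigma>: "0 < \<sigma>" "\<sigma> < \<gamma>" and K': "0 < K'"
  obtains \<rho> C where "0 < \<rho>" "\<rho> < 1" "0 < C"
    "\<And>P. \<exists>N \<Omega>. finite \<Omega> \<and> \<Omega> \<noteq> {} \<and> \<Omega> \<subseteq> words m N \<times> words n N \<and>
      (\<forall>p\<le>P. real (card (near_pairs (K' * \<rho> ^ p) \<Omega> word_pos \<Omega> word_pos))
        \<le> C * (\<rho> ^ p) powr \<sigma> * real (card \<Omega>) ^ 2)"
proof -
  \<comment> \<open>Three losses of at most \<epsilon> occur: the energy threshold for good blocks,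
    the share of bad steps, and the constants paid at each step. A fourth \<epsilon> is
    spare.\<close>
  define \<epsilon> where "\<epsilon> = (\<gamma> - \<sigma>) / 4"
  have \<epsilon>: "0 < \<epsilon>" "\<epsilon> < \<gamma>" "\<epsilon> < 1" using \<sigma> \<gamma>_bounds by (auto simp: \<epsilon>_def)
  \<comment> \<open>Meets both the requirement of the tree and \<open>K' + (1 + T) \<le> K\<close>
    for the passage from \<Omega> to a level.\<close>
  define K where "K = K' + 2 * (1 + T)"
  \<comment> \<open>The increment absorbs the move to a grid slope whose parameter differs by at
    most \<rho>.\<close>
  define K1 where "K1 = K + T * - ln b"
  have Tl: "0 < T * - ln b" using T_pos ln_neg by (intro mult_pos_pos) auto
  have K: "0 < K" "0 < K1" using K' T_pos Tl by (auto simp: K_def K1_def)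
  obtain C0 where C0: "0 < C0"
    "\<And>u q Q L. u \<in> words m q \<Longrightarrow> 0 < L \<Longrightarrow> real L * a ^ q \<le> 4 \<Longrightarrow> b ^ Q \<le> a ^ q \<Longrightarrow>
      (\<Sum>j<L. real (energy u (slope (real j / L)) (K1 * a ^ q) q Q))
      \<le> C0 * real (Suc Q) * (real n ^ q * real m ^ Q) ^ 2 * (a ^ q) powr (\<gamma> - 1)"
    using sum_energy_le[OF K(2), of 4] by auto
  \<comment> \<open>The 3 comes from comparing two blocks, and \<open>real m ^ 2\<close> from
    padding each of two words by at most one row digit.\<close>
  define A where "A = 3 * real m ^ 2"
  have A: "1 \<le> A" using ab by (simp add: A_def) (smt (verit) of_nat_1 of_nat_le_iff one_le_power Suc_leI One_nat_def)
  \<comment> \<open>The third condition keeps the share of bad slopes below \<epsilon>; the fourth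
    makes the cost \<open>4 powr \<kappa> * A\<close> of one step at most
    \<open>(a ^ q) powr (- \<epsilon>)\<close>.\<close>
  obtain q where q_props: "0 < q" "a ^ q \<le> 1 / 2" "2 * C0 * (\<kappa> * real q + 2) * (a ^ q) powr \<epsilon> \<le> \<epsilon>"
      "4 powr \<kappa> * A * (a ^ q) powr \<epsilon> \<le> 1"
    using exists_block_length[OF \<epsilon>(1), of "2 * C0" "4 powr \<kappa> * A"] C0(1) A by auto
  define \<rho> where "\<rho> = a ^ q"
  have \<rho>: "0 < \<rho>" "\<rho> < 1" using q_props ab by (auto simp: \<rho>_def)
  \<comment> \<open>With \<open>M\<close> of order \<open>1 / \<rho>\<close>, the grid of
    \<open>2 * M\<close> slopes has spacing at most \<rho>, yet
    \<open>real L * \<rho> \<le> 4\<close> as the averaged energy bound demands.\<close>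
  define M where "M = nat \<lceil>1 / \<rho>\<rceil>"
  have M: "1 / \<rho> \<le> M" "M \<le> 1 / \<rho> + 1" "0 < M" using \<rho> by (auto simp: M_def)
  define L where "L = 2 * M"
  have L: "0 < L" "1 / \<rho> \<le> L" "real L * \<rho> \<le> 4"
  proof -
    show "0 < L" "1 / \<rho> \<le> L" using M by (auto simp: L_def)
    have "real L * \<rho> \<le> 2 * (1 / \<rho> + 1) * \<rho>" using M \<rho> by (intro mult_right_mono) (auto simp: L_def)
    also have "\<dots> = 2 + 2 * \<rho>" using \<rho> by (simp add: field_simps)
    finally show "real L * \<rho> \<le> 4" using \<rho> by simp
  qed
  define Q where "Q = Suc (nat \<lfloor>\<kappa> * real q\<rfloor>)"
  have \<kappa>q: "0 < \<kappa> * real q" using \<kappa>_gt_1 q_props by simp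
  have Q: "\<kappa> * real q \<le> Q" "Q \<le> \<kappa> * real q + 1" using \<kappa>q by (auto simp: Q_def) linarith+
  have bQ: "b ^ Q \<le> \<rho>"
  proof -
    have "b ^ Q = b powr Q" using ab by (simp add: powr_realpow)
    also have "\<dots> \<le> b powr (\<kappa> * real q)" using ab Q by (intro powr_mono') auto
    also have "\<dots> = \<rho>" using ab by (simp add: b_powr_\<kappa> powr_realpow \<rho>_def)
    finally show ?thesis .
  qed
  define \<alpha> where "\<alpha> = \<kappa> * real q"
  have \<alpha>: "\<alpha> \<notin> \<rat>"
  proof
    assume "\<alpha> \<in> \<rat>"
    then have "\<alpha> / real q \<in> \<rat>" by (intro Rats_divide Rats_of_nat)
    then show False using irr q_props by (simp add: \<alpha>_def)
  qed
  \<comment> \<open>With this rounding the shape of the approximate square at step \<open>p\<close>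
    depends only on the fractional part \<open>\<theta> p\<close>, and its slope is exactly
    \<open>slope (\<theta> p)\<close>.\<close>
  define l where "l p = nat \<lfloor>real p * \<alpha>\<rfloor>" for p
  define \<theta> where "\<theta> p = frac (real p * \<alpha>)" for p
  have l: "real (l p) = real p * \<alpha> - \<theta> p" for p
    using \<kappa>q by (simp add: l_def \<theta>_def frac_def \<alpha>_def)
  have \<theta>: "0 \<le> \<theta> p" "\<theta> p < 1" for p by (auto simp: \<theta>_def frac_lt_1)
  have slope_\<theta>: "t * b ^ l p = slope (\<theta> p) * a ^ (q * p)" for p
  proof -
    have "b ^ l p = b powr (real (l p))" using ab by (simp add: powr_realpow)
    also have "\<dots> = b powr (\<kappa> * real (q * p)) * b powr (- \<theta> p)"
      unfolding l powr_add[symmetric] by (simp add: \<alpha>_def mult_ac)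
    also have "b powr (\<kappa> * real (q * p)) = a ^ (q * p)"
      unfolding b_powr_\<kappa> using ab by (simp only: powr_realpow)
    finally show ?thesis by (simp add: slope_def)
  qed
  have l_step: "l p \<le> l (Suc p)" "l (Suc p) - l p \<le> Q" "Q \<le> Suc (l (Suc p) - l p)" for p
  proof -
    have "real (l (Suc p)) - real (l p) = \<alpha> - \<theta> (Suc p) + \<theta> p" by (simp add: l algebra_simps)
    then have 1: "\<alpha> - 1 < real (l (Suc p)) - real (l p)" "real (l (Suc p)) - real (l p) < \<alpha> + 1"
      using \<theta>[of p] \<theta>[of "Suc p"] by linarith+
    have "1 < \<alpha>" using \<kappa>_gt_1 q_props mult_strict_mono'[of 1 \<kappa> 1 "real q"] unfolding \<alpha>_def
      by (cases "q = 1") auto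
    then have "real (l p) < real (l (Suc p))" using 1 by linarith
    then show lm: "l p \<le> l (Suc p)" by simp
    have "real (l (Suc p) - l p) = real (l (Suc p)) - real (l p)" using lm by simp
    then have 2: "\<alpha> - 1 < real (l (Suc p) - l p)" "real (l (Suc p) - l p) < \<alpha> + 1" using 1 by auto
    have "real (Q) \<le> \<alpha> + 1" "\<alpha> \<le> real Q" using Q by (auto simp: \<alpha>_def)
    then have "real Q < real (l (Suc p) - l p) + 2" "real (l (Suc p) - l p) < real Q + 1"
      using 2 by linarith+
    then show "l (Suc p) - l p \<le> Q" "Q \<le> Suc (l (Suc p) - l p)" by linarith+
  qed
  define N where "N = real n ^ q * real m ^ Q"
  have N: "0 < N" using ab by (simp add: N_def)
  \<comment> \<open>The average over the grid is of order
    \<open>real (Suc Q) * N ^ 2 * \<rho> powr \<gamma>\<close>; the threshold leaves a factor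
    \<open>\<rho> powr (- \<epsilon>)\<close> for \<open>Suc Q\<close> and for Markov's
    inequality.\<close>
  define good where "good j u \<longleftrightarrow> real (energy u (slope (real j / L)) (K1 * \<rho>) q Q) \<le> N ^ 2 * \<rho> powr (\<gamma> - \<epsilon>)" for j u
  define BJ where "BJ = {j\<in>{..<L}. m ^ q < 2 * card {u\<in>words m q. \<not> good j u}}"
  have BJ: "real (card BJ) * \<rho> \<le> 2 * C0 * (\<kappa> * real q + 2) * \<rho> powr \<epsilon>"
  proof -
    define H where "H = N ^ 2 * \<rho> powr (\<gamma> - \<epsilon>)"
    have H: "0 < H" using N \<rho> by (simp add: H_def)
    have mq: "0 < real (m ^ q)" using ab by simp
    \<comment> \<open>Markov's inequality for pairs of a slope and a block: every slope in
      \<open>BJ\<close> has more than \<open>real (m ^ q) / 2\<close> blocks of energy above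
      \<open>H\<close>.\<close>
    have "real (card BJ) * (real (m ^ q) / 2 * H) = (\<Sum>j\<in>BJ. real (m ^ q) / 2 * H)" by simp
    also have "\<dots> \<le> (\<Sum>j\<in>BJ. \<Sum>u\<in>words m q. real (energy u (slope (real j / L)) (K1 * \<rho>) q Q))"
    proof (rule sum_mono)
      fix j assume "j \<in> BJ"
      then have "real (m ^ q) < real (2 * card {u\<in>words m q. \<not> good j u})"
        unfolding of_nat_less_iff by (simp add: BJ_def)
      then have "real (m ^ q) / 2 * H \<le> real (card {u\<in>words m q. \<not> good j u}) * H"
        using H by (intro mult_right_mono) auto
      also have "\<dots> = (\<Sum>u\<in>{u\<in>words m q. \<not> good j u}. H)" by simp
      also have "\<dots> \<le> (\<Sum>u\<in>{u\<in>words m q. \<not> good j u}. real (energy u (slope (real j / L)) (K1 * \<rho>) q Q))"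
        by (intro sum_mono) (auto simp: good_def H_def)
      also have "\<dots> \<le> (\<Sum>u\<in>words m q. real (energy u (slope (real j / L)) (K1 * \<rho>) q Q))"
        by (intro sum_mono2) auto
      finally show "real (m ^ q) / 2 * H \<le> (\<Sum>u\<in>words m q. real (energy u (slope (real j / L)) (K1 * \<rho>) q Q))" .
    qed
    also have "\<dots> \<le> (\<Sum>j<L. \<Sum>u\<in>words m q. real (energy u (slope (real j / L)) (K1 * \<rho>) q Q))"
      by (intro sum_mono2) (auto simp: BJ_def intro!: sum_nonneg)
    also have "\<dots> = (\<Sum>u\<in>words m q. \<Sum>j<L. real (energy u (slope (real j / L)) (K1 * \<rho>) q Q))"
      by (rule sum.swap)
    also have "\<dots> \<le> (\<Sum>u\<in>words m q. C0 * real (Suc Q) * N ^ 2 * \<rho> powr (\<gamma> - 1))"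
      using C0(2) L bQ unfolding \<rho>_def N_def by (intro sum_mono) blast
    also have "\<dots> = real (m ^ q) * (C0 * real (Suc Q) * N ^ 2 * \<rho> powr (\<gamma> - 1))" by simp
    finally have "real (m ^ q) * (real (card BJ) / 2 * H) \<le> real (m ^ q) * (C0 * real (Suc Q) * N ^ 2 * \<rho> powr (\<gamma> - 1))"
      by (simp only: times_divide_eq_left times_divide_eq_right mult_ac)
    then have "real (card BJ) / 2 * H \<le> C0 * real (Suc Q) * N ^ 2 * \<rho> powr (\<gamma> - 1)"
      using mq by (simp only: mult_le_cancel_left_pos)
    then have "N ^ 2 * (real (card BJ) * \<rho> powr (\<gamma> - \<epsilon>)) \<le> N ^ 2 * (2 * C0 * real (Suc Q) * \<rho> powr (\<gamma> - 1))"
      unfolding H_def by (simp add: mult_ac del: of_nat_Suc)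
    then have "real (card BJ) * \<rho> powr (\<gamma> - \<epsilon>) \<le> 2 * C0 * real (Suc Q) * \<rho> powr (\<gamma> - 1)"
      using N by (simp only: mult_le_cancel_left_pos zero_less_power)
    then have "real (card BJ) * \<rho> powr (\<gamma> - \<epsilon>) * \<rho> powr (1 - \<gamma> + \<epsilon>)
        \<le> 2 * C0 * real (Suc Q) * \<rho> powr (\<gamma> - 1) * \<rho> powr (1 - \<gamma> + \<epsilon>)"
      by (rule mult_right_mono) auto
    then have "real (card BJ) * \<rho> \<le> 2 * C0 * real (Suc Q) * \<rho> powr \<epsilon>"
      using \<rho> by (simp add: mult.assoc powr_add[symmetric] del: of_nat_Suc)
    also have "\<dots> \<le> 2 * C0 * (\<kappa> * real q + 2) * \<rho> powr \<epsilon>"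
      using Q C0(1) by (intro mult_right_mono mult_left_mono) auto
    finally show ?thesis .
  qed
  have finBJ: "finite BJ" by (simp add: BJ_def)
  \<comment> \<open>Irrationality enters here: bad slopes are met at most twice as often as their
    share of the grid, up to the constant \<open>Cv\<close>.\<close>
  obtain Cv where Cv: "0 \<le> Cv"
      "\<And>P. real (card {p\<in>{..<P}. rot_arc L \<alpha> p \<in> BJ}) \<le> real (card BJ) * (real P / real M) + Cv"
    using rotation_visits_set[OF \<alpha> M(3) finBJ] unfolding L_def by metis
  \<comment> \<open>The steps with a gain: the grid slope is not bad, and the block governing the
    new columns is already complete. All other steps get the trivial factor 1.\<close>
  define gs where "gs p \<longleftrightarrow> rot_arc L \<alpha> p \<notin> BJ \<and> q * Suc p \<le> l p" for p
  define G where "G p = (if gs p then {u\<in>words m q. good (rot_arc L \<alpha> p) u} else words m q)" for p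
  define g where "g p = (if gs p then A * \<rho> powr (\<gamma> - \<epsilon>) else 1)" for p
  interpret GL_tree m n a b c d t q l G K g
  proof
    fix p
    show "a ^ q \<le> 1 / 2" by (rule q_props(2))
    show "l 0 = 0" by (simp add: l_def)
    show "l p \<le> l (Suc p)" by (rule l_step)
    show "q * p \<le> l p"
    proof -
      have "real (q * p) \<le> real p * \<alpha>"
        using \<kappa>_gt_1 mult_right_mono[of 1 \<kappa> "real (q * p)"] by (simp add: \<alpha>_def mult_ac)
      then show ?thesis unfolding l_def by (simp add: le_nat_floor)
    qed
    show "\<bar>t\<bar> * b ^ l p \<le> T * a ^ (q * p)"
    proof -
      have "\<bar>t\<bar> * b ^ l p = \<bar>slope (\<theta> p)\<bar> * a ^ (q * p)"
        using slope_\<theta>[of p] ab by (metis abs_mult abs_of_nonneg less_imp_le zero_le_power)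
      also have "\<dots> \<le> T * a ^ (q * p)" using \<theta>[of p] ab by (intro mult_right_mono slope_bound) auto
      finally show ?thesis .
    qed
    show "G p \<subseteq> words m q" by (auto simp: G_def)
    show "m ^ q \<le> 2 * card (G p)"
    proof (cases "gs p")
      case True
      then have "\<not> m ^ q < 2 * card {u\<in>words m q. \<not> good (rot_arc L \<alpha> p) u}"
        using rot_arc_bounds(3)[OF L(1)] by (auto simp: gs_def BJ_def)
      moreover have "card {u\<in>words m q. good (rot_arc L \<alpha> p) u} + card {u\<in>words m q. \<not> good (rot_arc L \<alpha> p) u} = m ^ q"
      proof -
        have "words m q = {u\<in>words m q. good (rot_arc L \<alpha> p) u} \<union> {u\<in>words m q. \<not> good (rot_arc L \<alpha> p) u}" by auto
        then have "card (words m q) = card ({u\<in>words m q. good (rot_arc L \<alpha> p) u} \<union> {u\<in>words m q. \<not> good (rot_arc L \<alpha> p) u})"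
          by simp
        also have "\<dots> = card {u\<in>words m q. good (rot_arc L \<alpha> p) u} + card {u\<in>words m q. \<not> good (rot_arc L \<alpha> p) u}"
          by (intro card_Un_disjoint) auto
        finally show ?thesis by simp
      qed
      ultimately show ?thesis using True by (simp add: G_def)
    next
      case False
      then show ?thesis by (simp add: G_def)
    qed
    show "2 * (1 + T) \<le> K" using K' by (simp add: K_def)
    show "0 \<le> g p" using A by (simp add: g_def)
    show "1 \<le> g p \<or> (q * Suc p \<le> l p \<and>
      (\<forall>u\<in>G p. 3 * real (energy u (t * b ^ l p / a ^ (q * p)) (K * a ^ q) q (l (Suc p) - l p))
         \<le> g p * (real n ^ q * real m ^ (l (Suc p) - l p)) ^ 2))"
    proof (cases "gs p")
      case True
      define wk where "wk = l (Suc p) - l p"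
      define j where "j = rot_arc L \<alpha> p"
      have "3 * real (energy u (t * b ^ l p / a ^ (q * p)) (K * \<rho>) q wk) \<le> g p * (real n ^ q * real m ^ wk) ^ 2"
        if u: "u \<in> G p" for u
      proof -
        have "t * b ^ l p / a ^ (q * p) = slope (\<theta> p)" using slope_\<theta>[of p] ab by simp
        moreover have "\<bar>slope (\<theta> p) - slope (real j / L)\<bar> \<le> T * - ln b * \<rho>"
        proof -
          have j: "real j \<le> real L * \<theta> p" "real L * \<theta> p < real j + 1"
            using rot_arc_bounds(1,2)[OF L(1), where \<alpha> = \<alpha> and p = p] by (auto simp: j_def \<theta>_def)
          have "\<bar>slope (\<theta> p) - slope (real j / L)\<bar> \<le> T * - ln b * (\<theta> p - real j / L)"
            using j L(1) \<theta>[of p] by (intro slope_lipschitz) (auto simp: field_simps)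
          also have "\<dots> \<le> T * - ln b * \<rho>"
          proof (rule mult_left_mono)
            have "\<theta> p \<le> (real j + 1) / L"
              using j(2) L(1) by (simp add: pos_le_divide_eq mult.commute less_imp_le)
            then have "\<theta> p - real j / L \<le> 1 / L" by (simp add: add_divide_distrib)
            also have "\<dots> \<le> \<rho>" using L \<rho> by (simp add: field_simps)
            finally show "\<theta> p - real j / L \<le> \<rho>" .
          qed (use Tl in simp)
          finally show ?thesis .
        qed
        moreover have "K * \<rho> + T * - ln b * \<rho> \<le> K1 * \<rho>" by (simp add: K1_def algebra_simps)
        moreover have "wk \<le> Q" unfolding wk_def by (rule l_step)
        ultimately have "energy u (t * b ^ l p / a ^ (q * p)) (K * \<rho>) q wk \<le> energy u (slope (real j / L)) (K1 * \<rho>) q Q"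
          by (metis energy_pad)
        moreover have "real (energy u (slope (real j / L)) (K1 * \<rho>) q Q) \<le> N ^ 2 * \<rho> powr (\<gamma> - \<epsilon>)"
          using u True by (simp add: G_def good_def j_def)
        ultimately have 1: "3 * real (energy u (t * b ^ l p / a ^ (q * p)) (K * \<rho>) q wk) \<le> 3 * (N ^ 2 * \<rho> powr (\<gamma> - \<epsilon>))"
          by simp
        have "N \<le> real n ^ q * (real m * real m ^ wk)"
        proof -
          have "real m ^ Q \<le> real m ^ Suc wk" using l_step(3)[of p] ab unfolding wk_def by (intro power_increasing) auto
          then show ?thesis unfolding N_def by (intro mult_left_mono) auto
        qed
        then have "N ^ 2 \<le> (real n ^ q * (real m * real m ^ wk)) ^ 2" using N by (intro power_mono) auto
        also have "\<dots> = real m ^ 2 * (real n ^ q * real m ^ wk) ^ 2" by (simp add: power_mult_distrib mult_ac)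
        finally have "3 * (N ^ 2 * \<rho> powr (\<gamma> - \<epsilon>)) \<le> 3 * (real m ^ 2 * (real n ^ q * real m ^ wk) ^ 2 * \<rho> powr (\<gamma> - \<epsilon>))"
          by (intro mult_left_mono mult_right_mono) auto
        also have "\<dots> = g p * (real n ^ q * real m ^ wk) ^ 2" using True by (simp add: g_def A_def)
        finally show ?thesis using 1 by linarith
      qed
      then show ?thesis using True unfolding wk_def \<rho>_def gs_def by blast
    next
      case False
      then show ?thesis by (simp add: g_def)
    qed
  qed
  \<comment> \<open>As \<open>\<kappa> > 1\<close>, the lead of the row digits over the column
    digits grows linearly and eventually exceeds one block, so only finitely many early steps are
    lost.\<close>
  obtain p0 :: nat where p0: "(real q + 1) / (real q * (\<kappa> - 1)) \<le> real p0"
    using real_arch_simple by blast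
  have late: "q * Suc p \<le> l p" if "p0 \<le> p" for p
  proof -
    have pos: "0 < real q * (\<kappa> - 1)" using q_props \<kappa>_gt_1 by simp
    have "(real q + 1) / (real q * (\<kappa> - 1)) \<le> real p" using p0 that by linarith
    then have "real q + 1 \<le> real p * (real q * (\<kappa> - 1))" using pos by (simp add: pos_divide_le_eq)
    then have "real (q * Suc p) \<le> real p * \<alpha>" by (simp add: \<alpha>_def algebra_simps)
    then show ?thesis unfolding l_def by (simp add: le_nat_floor)
  qed
  define D where "D = Cv + real p0"
  have bad: "real (card {i\<in>{..<p}. \<not> gs i}) \<le> \<epsilon> * real p + D" for p
  proof -
    have "{i\<in>{..<p}. \<not> gs i} \<subseteq> {i\<in>{..<p}. rot_arc L \<alpha> i \<in> BJ} \<union> {..<p0}"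
      using late by (auto simp: gs_def not_less[symmetric])
    then have "card {i\<in>{..<p}. \<not> gs i} \<le> card ({i\<in>{..<p}. rot_arc L \<alpha> i \<in> BJ} \<union> {..<p0})"
      by (intro card_mono) auto
    also have "\<dots> \<le> card {i\<in>{..<p}. rot_arc L \<alpha> i \<in> BJ} + card {..<p0}" by (rule card_Un_le)
    finally have "real (card {i\<in>{..<p}. \<not> gs i}) \<le> real (card {i\<in>{..<p}. rot_arc L \<alpha> i \<in> BJ}) + real p0"
      by simp
    also have "\<dots> \<le> real (card BJ) * (real p / real M) + D" using Cv(2)[of p] by (simp add: D_def)
    also have "real (card BJ) * (real p / real M) \<le> real (card BJ) * \<rho> * real p"
    proof -
      have "1 / real M \<le> \<rho>" using M \<rho> by (simp add: field_simps)
      then have "real (card BJ) * real p * (1 / real M) \<le> real (card BJ) * real p * \<rho>"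
        by (intro mult_left_mono) auto
      then show ?thesis by (simp add: mult_ac)
    qed
    also have "\<dots> \<le> \<epsilon> * real p"
      using BJ q_props(3) unfolding \<rho>_def[symmetric] by (intro mult_right_mono) auto
    finally show ?thesis by simp
  qed
  define h where "h = \<rho> powr (\<gamma> - \<epsilon>)"
  have h: "0 < h" "h \<le> 1" using \<rho> \<epsilon> powr_mono2[of "\<gamma> - \<epsilon>" \<rho> 1] by (auto simp: h_def)
  have prod_g: "(\<Prod>i<p. g i) \<le> A ^ p * h powr ((1 - \<epsilon>) * real p - D)" for p
  proof -
    define r where "r = card {i\<in>{..<p}. gs i}"
    have rp: "r + card {i\<in>{..<p}. \<not> gs i} = p"
    proof -
      have "{..<p} = {i\<in>{..<p}. gs i} \<union> {i\<in>{..<p}. \<not> gs i}" by auto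
      then have "card {..<p} = card ({i\<in>{..<p}. gs i} \<union> {i\<in>{..<p}. \<not> gs i})" by (rule arg_cong)
      also have "\<dots> = r + card {i\<in>{..<p}. \<not> gs i}"
        unfolding r_def by (intro card_Un_disjoint) auto
      finally show ?thesis by simp
    qed
    have "(\<Prod>i<p. g i) = (A * h) ^ r"
      by (simp add: g_def h_def r_def prod.If_cases Int_def)
    also have "\<dots> = A ^ r * h powr real r" using h by (simp add: power_mult_distrib powr_realpow)
    also have "\<dots> \<le> A ^ p * h powr ((1 - \<epsilon>) * real p - D)"
    proof (intro mult_mono)
      show "A ^ r \<le> A ^ p" using A rp by (intro power_increasing) auto
      have "(1 - \<epsilon>) * real p - D \<le> real r" using bad[of p] rp by (simp add: algebra_simps)
      then show "h powr real r \<le> h powr ((1 - \<epsilon>) * real p - D)" using h by (intro powr_mono') auto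
    qed (use A in auto)
    finally show ?thesis .
  qed
  define C where "C = 4 * \<rho> powr (- (\<gamma> - \<epsilon>) * D)"
  \<comment> \<open>About \<open>\<kappa> * p\<close> blocks cover the first \<open>l p\<close> row
    digits, so discarding blocks costs \<open>4 powr \<kappa>\<close> per step.\<close>
  have fin: "4 ^ nat \<lceil>\<kappa> * real p\<rceil> * (\<Prod>i<p. g i) \<le> C * (\<rho> ^ p) powr \<sigma>" for p
  proof -
    have "(4::real) ^ nat \<lceil>\<kappa> * real p\<rceil> = 4 powr real (nat \<lceil>\<kappa> * real p\<rceil>)" by (simp add: powr_realpow)
    also have "\<dots> \<le> 4 powr (1 + \<kappa> * real p)"
    proof (intro powr_mono)
      have "0 \<le> \<kappa> * real p" using \<kappa>_gt_1 by simp
      then show "real (nat \<lceil>\<kappa> * real p\<rceil>) \<le> 1 + \<kappa> * real p" by linarith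
    qed simp
    also have "\<dots> = 4 * (4 powr \<kappa>) ^ p"
      by (simp only: powr_add powr_powr[symmetric] powr_realpow powr_gt_zero powr_one)
    finally have "4 ^ nat \<lceil>\<kappa> * real p\<rceil> * (\<Prod>i<p. g i)
        \<le> (4 * (4 powr \<kappa>) ^ p) * (A ^ p * h powr ((1 - \<epsilon>) * real p - D))"
      using prod_g[of p] g_nonneg by (intro mult_mono) (auto intro: prod_nonneg)
    also have "\<dots> = 4 * (4 powr \<kappa> * A) ^ p * h powr ((1 - \<epsilon>) * real p - D)" by (simp add: power_mult_distrib)
    also have "\<dots> \<le> 4 * (\<rho> powr (- \<epsilon>)) ^ p * h powr ((1 - \<epsilon>) * real p - D)"
    proof -
      have "4 powr \<kappa> * A \<le> \<rho> powr (- \<epsilon>)"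
        using q_props(4) \<rho> unfolding \<rho>_def[symmetric] by (simp add: powr_minus field_simps)
      then show ?thesis using A by (intro mult_right_mono mult_left_mono power_mono) auto
    qed
    also have "\<dots> = 4 * (\<rho> powr (- \<epsilon> * real p) * \<rho> powr ((\<gamma> - \<epsilon>) * ((1 - \<epsilon>) * real p - D)))"
      using \<rho> by (simp add: h_def powr_powr powr_realpow[symmetric])
    also have "\<dots> = C * \<rho> powr (((\<gamma> - \<epsilon>) * (1 - \<epsilon>) - \<epsilon>) * real p)"
      unfolding C_def mult.assoc powr_add[symmetric] by (simp add: algebra_simps)
    also have "\<dots> \<le> C * \<rho> powr (\<sigma> * real p)"
    proof (intro mult_left_mono powr_mono' mult_right_mono)
      have "\<gamma> * \<epsilon> \<le> 1 * \<epsilon>" using \<gamma>_bounds \<epsilon> by (intro mult_right_mono) auto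
      moreover have "0 \<le> \<epsilon> * \<epsilon>" by simp
      moreover have "\<sigma> = \<gamma> - 4 * \<epsilon>" by (simp add: \<epsilon>_def field_simps)
      moreover have "(\<gamma> - \<epsilon>) * (1 - \<epsilon>) - \<epsilon> = \<gamma> - \<gamma> * \<epsilon> - 2 * \<epsilon> + \<epsilon> * \<epsilon>"
        by (simp add: algebra_simps)
      ultimately show "\<sigma> \<le> (\<gamma> - \<epsilon>) * (1 - \<epsilon>) - \<epsilon>" using \<epsilon> by linarith
    qed (use \<rho> in \<open>auto simp: C_def\<close>)
    also have "\<rho> powr (\<sigma> * real p) = (\<rho> ^ p) powr \<sigma>"
      using \<rho> by (simp add: powr_realpow[symmetric] powr_powr mult.commute)
    finally show ?thesis .
  qed
  show ?thesis
  proof (rule that[of \<rho> C])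
    show "0 < \<rho>" "\<rho> < 1" by fact+
    show "0 < C" using \<rho> by (simp add: C_def)
    fix P
    \<comment> \<open>Enough complete blocks for the finest scale \<open>P\<close>. Row and column
      words get the same length \<open>q * B\<close>, as a composition of maps of the system
      requires.\<close>
    define B where "B = nat \<lceil>\<kappa> * real P\<rceil>"
    define \<Omega> where "\<Omega> = row_words B \<times> words n (q * B)"
    have "words n (q * B) \<noteq> {}" using card_words[of n "q * B"] ab by (metis card.empty power_not_zero not_less0)
    then have ne: "\<Omega> \<noteq> {}" using row_words_nonempty by (simp add: \<Omega>_def)
    have "real (card (near_pairs (K' * \<rho> ^ p) \<Omega> word_pos \<Omega> word_pos)) \<le> C * (\<rho> ^ p) powr \<sigma> * real (card \<Omega>) ^ 2"
      if "p \<le> P" for p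
    proof -
      define B' where "B' = nat \<lceil>\<kappa> * real p\<rceil>"
      have "B' \<le> B" unfolding B'_def B_def using that \<kappa>_gt_1 by (intro nat_mono ceiling_mono mult_left_mono) auto
      moreover have "l p \<le> q * B'"
      proof -
        have "\<kappa> * real p \<le> real B'" unfolding B'_def by linarith
        then have "real q * (\<kappa> * real p) \<le> real q * real B'" by (intro mult_left_mono) auto
        then have "real (l p) \<le> real (q * B')" using l[of p] \<theta>[of p] by (simp add: \<alpha>_def mult_ac)
        then show ?thesis by (simp only: of_nat_le_iff)
      qed
      moreover have "K' + (1 + T) \<le> K" using T_pos by (simp add: K_def)
      ultimately have "real (card (near_pairs (K' * a ^ (q * p)) \<Omega> word_pos \<Omega> word_pos))
          \<le> 4 ^ B' * real (card \<Omega>) ^ 2 * (\<Prod>i<p. g i)"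
        unfolding \<Omega>_def by (rule card_near_pairs_row_words_le)
      also have "\<dots> = (4 ^ B' * (\<Prod>i<p. g i)) * real (card \<Omega>) ^ 2" by (simp only: mult_ac)
      also have "\<dots> \<le> C * (\<rho> ^ p) powr \<sigma> * real (card \<Omega>) ^ 2"
        using fin[of p] unfolding B'_def by (rule mult_right_mono) simp
      finally show ?thesis by (simp add: \<rho>_def power_mult)
    qed
    moreover have "finite \<Omega>" "\<Omega> \<subseteq> words m (q * B) \<times> words n (q * B)"
      by (auto simp: \<Omega>_def row_words_def)
    ultimately show "\<exists>N \<Omega>. finite \<Omega> \<and> \<Omega> \<noteq> {} \<and> \<Omega> \<subseteq> words m N \<times> words n N \<and>
      (\<forall>p\<le>P. real (card (near_pairs (K' * \<rho> ^ p) \<Omega> word_pos \<Omega> word_pos))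
        \<le> C * (\<rho> ^ p) powr \<sigma> * real (card \<Omega>) ^ 2)" using ne by blast
  qed
qed

end

section \<open>The attractor and its projections\<close>

context GL_slope
begin

text \<open>For words of length \<open>N\<close>, the image of \<open>v\<close> under the
  composition of the \<open>N\<close> maps that they name.\<close>

definition code_point :: "nat \<Rightarrow> real \<times> real \<Rightarrow> nat list \<times> nat list \<Rightarrow> real \<times> real" where
  "code_point N v x = (word_val a (\<lambda>i. c (fst x ! i)) (snd x) + a ^ N * fst v,
     word_val b (\<lambda>_. d) (fst x) + b ^ N * snd v)"

lemma GL_map_code_point:
  "GL_map a b c d i j (code_point N v (is, js)) = code_point (Suc N) v (i # is, j # js)"
  by (simp add: GL_map_def code_point_def algebra_simps)

lemma attractor_step:
  assumes "is_GL_attractor m n a b c d \<Lambda>" "i \<in> {1..m}" "j \<in> {1..n}" "v \<in> \<Lambda>"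
  shows "GL_map a b c d i j v \<in> \<Lambda>"
proof -
  have "\<Lambda> = (\<Union>i\<in>{1..m}. \<Union>j\<in>{1..n}. GL_map a b c d i j ` \<Lambda>)"
    using assms(1) by (simp add: is_GL_attractor_def)
  moreover have "GL_map a b c d i j v \<in> (\<Union>i\<in>{1..m}. \<Union>j\<in>{1..n}. GL_map a b c d i j ` \<Lambda>)"
    using assms by blast
  ultimately show ?thesis by blast
qed

lemma attractor_stepE:
  assumes "is_GL_attractor m n a b c d \<Lambda>" "v \<in> \<Lambda>"
  obtains i j w where "i \<in> {1..m}" "j \<in> {1..n}" "w \<in> \<Lambda>" "v = GL_map a b c d i j w"
proof -
  have "\<Lambda> = (\<Union>i\<in>{1..m}. \<Union>j\<in>{1..n}. GL_map a b c d i j ` \<Lambda>)"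
    using assms(1) by (simp add: is_GL_attractor_def)
  then have "v \<in> (\<Union>i\<in>{1..m}. \<Union>j\<in>{1..n}. GL_map a b c d i j ` \<Lambda>)" using assms(2) by metis
  then show ?thesis using that by blast
qed

lemma code_point_in_attractor:
  assumes "is_GL_attractor m n a b c d \<Lambda>" "v \<in> \<Lambda>" "is \<in> words m N" "js \<in> words n N"
  shows "code_point N v (is, js) \<in> \<Lambda>"
  using assms(3,4)
proof (induction N arbitrary: "is" js)
  case 0
  then show ?case using assms(2) by (simp add: code_point_def)
next
  case (Suc N)
  obtain i is' where i: "is = i # is'" "i \<in> {1..m}" "is' \<in> words m N" using words_SucE[OF Suc.prems(1)] .
  obtain j js' where j: "js = j # js'" "j \<in> {1..n}" "js' \<in> words n N" using words_SucE[OF Suc.prems(2)] .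
  show ?case
    unfolding i(1) j(1) GL_map_code_point[symmetric]
    by (rule attractor_step[OF assms(1) i(2) j(2) Suc.IH[OF i(3) j(3)]])
qed

lemma attractor_code:
  assumes "is_GL_attractor m n a b c d \<Lambda>" "v \<in> \<Lambda>"
  shows "\<exists>is\<in>words m N. \<exists>js\<in>words n N. \<exists>w\<in>\<Lambda>. v = code_point N w (is, js)"
  using assms(2)
proof (induction N arbitrary: v)
  case 0
  then show ?case by (auto simp: code_point_def)
next
  case (Suc N)
  obtain i j w where w: "i \<in> {1..m}" "j \<in> {1..n}" "w \<in> \<Lambda>" "v = GL_map a b c d i j w"
    using attractor_stepE[OF assms(1) Suc.prems] .
  obtain is' js' w' where w': "is' \<in> words m N" "js' \<in> words n N" "w' \<in> \<Lambda>" "w = code_point N w' (is', js')"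
    using Suc.IH[OF w(3)] by auto
  have "v = code_point (Suc N) w' (i # is', j # js')" using w(4) w'(4) GL_map_code_point by simp
  moreover have "i # is' \<in> words m (Suc N)" "j # js' \<in> words n (Suc N)" using w w' by (auto simp: words_def)
  ultimately show ?case using w'(3) by blast
qed

text \<open>By compactness each coordinate attains its extrema on the attractor. An extremal point
  is the image of a point that is no more extreme, and an offset between 0 and \<open>1 - r\<close>
  then forces the bound.\<close>

lemma attractor_unit_square:
  assumes att: "is_GL_attractor m n a b c d \<Lambda>" and v: "v \<in> \<Lambda>"
  shows "0 \<le> fst v" "fst v \<le> 1" "0 \<le> snd v" "snd v \<le> 1"
proof -
  have cpt: "compact \<Lambda>" "\<Lambda> \<noteq> {}" using att by (auto simp: is_GL_attractor_def)
  have cij: "0 \<le> c i j" "c i j \<le> 1 - a" if "i \<in> {1..m}" "j \<in> {1..n}" for i j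
    using digit_system_c[of 1 "\<lambda>_. i"] that by (auto simp: digit_system_def)
  have di: "0 \<le> d i" "d i \<le> 1 - b" if "i \<in> {1..m}" for i
    using digit_system_d[of 1] that by (auto simp: digit_system_def)
  have lo: "0 \<le> y" if "y = r * x + e" "0 \<le> e" "y \<le> x" "0 < r" "r < 1" for r x y e :: real
  proof (rule ccontr)
    assume "\<not> 0 \<le> y"
    moreover have "r * y \<le> r * x" using that by simp
    moreover have "y < r * y" using calculation(1) that by (simp add: not_le)
    ultimately show False using that by linarith
  qed
  have hi: "y \<le> 1" if "y = r * x + e" "e \<le> 1 - r" "x \<le> y" "0 < r" "r < 1" for r x y e :: real
  proof -
    have "r * x \<le> r * y" using that by simp
    then have "(1 - r) * y \<le> (1 - r) * 1" using that by (simp add: algebra_simps)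
    then show ?thesis using that by (simp only: mult_le_cancel_left_pos diff_gt_0_iff_gt)
  qed
  have cf: "continuous_on \<Lambda> (fst :: real \<times> real \<Rightarrow> real)" "continuous_on \<Lambda> (snd :: real \<times> real \<Rightarrow> real)"
    by (intro continuous_intros)+
  obtain v1 where v1: "v1 \<in> \<Lambda>" "\<And>w. w \<in> \<Lambda> \<Longrightarrow> fst v1 \<le> fst w"
    using continuous_attains_inf[OF cpt cf(1)] by blast
  obtain v2 where v2: "v2 \<in> \<Lambda>" "\<And>w. w \<in> \<Lambda> \<Longrightarrow> fst w \<le> fst v2"
    using continuous_attains_sup[OF cpt cf(1)] by blast
  obtain v3 where v3: "v3 \<in> \<Lambda>" "\<And>w. w \<in> \<Lambda> \<Longrightarrow> snd v3 \<le> snd w"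
    using continuous_attains_inf[OF cpt cf(2)] by blast
  obtain v4 where v4: "v4 \<in> \<Lambda>" "\<And>w. w \<in> \<Lambda> \<Longrightarrow> snd w \<le> snd v4"
    using continuous_attains_sup[OF cpt cf(2)] by blast
  have "0 \<le> fst v1"
  proof -
    obtain i j w where w: "i \<in> {1..m}" "j \<in> {1..n}" "w \<in> \<Lambda>" "v1 = GL_map a b c d i j w"
      using attractor_stepE[OF att v1(1)] .
    then have "fst v1 = a * fst w + c i j" by (simp add: GL_map_def case_prod_unfold)
    then show ?thesis using lo[of _ a "fst w" "c i j"] cij w v1(2)[OF w(3)] ab by blast
  qed
  then show "0 \<le> fst v" using v1(2)[OF v] by linarith
  have "fst v2 \<le> 1"
  proof -
    obtain i j w where w: "i \<in> {1..m}" "j \<in> {1..n}" "w \<in> \<Lambda>" "v2 = GL_map a b c d i j w"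
      using attractor_stepE[OF att v2(1)] .
    then have "fst v2 = a * fst w + c i j" by (simp add: GL_map_def case_prod_unfold)
    then show ?thesis using hi[of _ a "fst w" "c i j"] cij w v2(2)[OF w(3)] ab by blast
  qed
  then show "fst v \<le> 1" using v2(2)[OF v] by linarith
  have "0 \<le> snd v3"
  proof -
    obtain i j w where w: "i \<in> {1..m}" "j \<in> {1..n}" "w \<in> \<Lambda>" "v3 = GL_map a b c d i j w"
      using attractor_stepE[OF att v3(1)] .
    then have "snd v3 = b * snd w + d i" by (simp add: GL_map_def case_prod_unfold)
    then show ?thesis using lo[of _ b "snd w" "d i"] di w v3(2)[OF w(3)] ab by blast
  qed
  then show "0 \<le> snd v" using v3(2)[OF v] by linarith
  have "snd v4 \<le> 1"
  proof -
    obtain i j w where w: "i \<in> {1..m}" "j \<in> {1..n}" "w \<in> \<Lambda>" "v4 = GL_map a b c d i j w"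
      using attractor_stepE[OF att v4(1)] .
    then have "snd v4 = b * snd w + d i" by (simp add: GL_map_def case_prod_unfold)
    then show ?thesis using hi[of _ b "snd w" "d i"] di w v4(2)[OF w(3)] ab by blast
  qed
  then show "snd v \<le> 1" using v4(2)[OF v] by linarith
qed

lemma attractor_approximate_squares:
  assumes att: "is_GL_attractor m n a b c d \<Lambda>" and "k \<le> h" and hk: "b ^ h \<le> a ^ k / b"
  shows "\<exists>F. finite F \<and> \<Lambda> \<subseteq> \<Union>F \<and> (\<forall>V\<in>F. bounded V \<and> diameter V \<le> (1 + 1 / b) * a ^ k) \<and>
    card F \<le> m ^ h * n ^ k"
proof -
  define sq where "sq x = {word_val a (\<lambda>i. c (fst x ! i)) (snd x)..word_val a (\<lambda>i. c (fst x ! i)) (snd x) + a ^ k}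
    \<times> {word_val b (\<lambda>_. d) (fst x)..word_val b (\<lambda>_. d) (fst x) + b ^ h}" for x :: "nat list \<times> nat list"
  let ?F = "sq ` (words m h \<times> words n k)"
  have "\<Lambda> \<subseteq> \<Union>?F"
  proof
    fix v assume "v \<in> \<Lambda>"
    then obtain i j w where w: "i \<in> words m h" "j \<in> words n h" "w \<in> \<Lambda>" "v = code_point h w (i, j)"
      using attractor_code[OF att] by blast
    have len: "length j = h" using w by (simp add: words_def)
    let ?x = "word_val a (\<lambda>r. c (i ! r)) (take k j)" and ?X = "word_val a (\<lambda>r. c (i ! (k + r))) (drop k j)"
    have x: "word_val a (\<lambda>r. c (i ! r)) j = ?x + a ^ k * ?X"
      using word_val_append[of a "\<lambda>r. c (i ! r)" "take k j" "drop k j"] len assms(2) by (simp add: min_absorb2)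
    have ds: "digit_system a n (h - k) (\<lambda>r. c (i ! (k + r)))"
      using words_nth[OF w(1)] by (intro digit_system_c) auto
    have X: "0 \<le> ?X" "?X \<le> 1 - a ^ (h - k)"
      using word_val_range[OF ds drop_in_words[OF w(2)] ab(1,5)] by auto
    note sqw = attractor_unit_square[OF att w(3)]
    \<comment> \<open>The column digits after place \<open>k\<close> and the remainder
      \<open>w\<close> together fit into length \<open>a ^ k\<close>, by the sharp bound
      \<open>1 - a ^ (h - k)\<close>.\<close>
    have "0 \<le> a ^ k * ?X + a ^ h * fst w" using X sqw ab by simp
    moreover have "a ^ k * ?X + a ^ h * fst w \<le> a ^ k * (1 - a ^ (h - k)) + a ^ h * 1"
      using X sqw ab by (intro add_mono mult_left_mono) auto
    moreover have "a ^ k * (1 - a ^ (h - k)) + a ^ h * 1 = a ^ k"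
      using assms(2) by (simp add: right_diff_distrib power_add[symmetric])
    moreover have "0 \<le> b ^ h * snd w" "b ^ h * snd w \<le> b ^ h" using sqw ab by (auto simp: mult_left_le)
    ultimately have "v \<in> sq (i, take k j)"
      using x w(4) by (simp add: sq_def code_point_def add.assoc)
    then show "v \<in> \<Union>?F" using w(1) take_in_words[OF w(2) assms(2)] by blast
  qed
  moreover have "bounded V \<and> diameter V \<le> (1 + 1 / b) * a ^ k" if V': "V \<in> ?F" for V
  proof
    obtain x where V: "V = sq x" using V' by blast
    show "bounded V" unfolding V sq_def by (intro bounded_Times bounded_closed_interval)
    show "diameter V \<le> (1 + 1 / b) * a ^ k"
    proof (rule diameter_le)
      show "V \<noteq> {} \<or> 0 \<le> (1 + 1 / b) * a ^ k" using ab by simp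
      fix y z assume yz: "y \<in> V" "z \<in> V"
      have "norm (y - z) \<le> norm (fst (y - z)) + norm (snd (y - z))"
        using norm_Pair_le[of "fst (y - z)" "snd (y - z)"] by (simp only: prod.collapse)
      also have "\<dots> \<le> a ^ k + b ^ h"
        using yz unfolding V sq_def by (intro add_mono) (auto simp: abs_le_iff)
      also have "\<dots> \<le> a ^ k + a ^ k / b" using hk by simp
      finally show "norm (y - z) \<le> (1 + 1 / b) * a ^ k" by (simp add: algebra_simps)
    qed
  qed
  moreover have "card ?F \<le> m ^ h * n ^ k"
    using card_image_le[of "words m h \<times> words n k" sq] by (simp add: card_cartesian_product)
  moreover have "finite ?F" by simp
  ultimately show ?thesis by blast
qed

lemma hausdorff_dim_attractor_le:
  assumes att: "is_GL_attractor m n a b c d \<Lambda>"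
  shows "hausdorff_dim \<Lambda> \<le> ennreal (dim_x + dim_y)"
proof (rule hausdorff_dim_leI)
  show "0 \<le> dim_x + dim_y" using dim_nonneg by simp
  fix s assume s: "dim_x + dim_y < s"
  have s0: "0 < s" using s dim_nonneg by linarith
  define \<delta> where "\<delta> = s - (dim_x + dim_y)"
  have \<delta>: "0 < \<delta>" using s by (simp add: \<delta>_def)
  define r where "r = a powr \<delta>"
  have r: "0 < r" "r < 1" using \<delta> ab powr_less_mono2[of \<delta> a 1] by (auto simp: r_def)
  define C where "C = 1 + 1 / b"
  have C: "0 < C" using ab by (simp add: C_def add_pos_pos)
  show "hausdorff_measure s \<Lambda> = 0"
  proof (rule hausdorff_measure_eq_0_finite_covers[OF s0])
    fix \<eta> :: real assume \<eta>: "0 < \<eta>"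
    have "(\<lambda>k. C * a ^ k) \<longlonglongrightarrow> C * 0"
      using ab by (intro tendsto_mult tendsto_const LIMSEQ_realpow_zero) auto
    moreover have "(\<lambda>k. C powr s * r ^ k) \<longlonglongrightarrow> C powr s * 0"
      using r by (intro tendsto_mult tendsto_const LIMSEQ_realpow_zero) auto
    ultimately have "\<forall>\<^sub>F k in sequentially. C * a ^ k < \<eta>" "\<forall>\<^sub>F k in sequentially. C powr s * r ^ k < \<eta>"
      using \<eta> by (auto intro!: order_tendstoD)
    then have "\<forall>\<^sub>F k in sequentially. C * a ^ k < \<eta> \<and> C powr s * r ^ k < \<eta>" by eventually_elim auto
    then obtain k where k: "C * a ^ k < \<eta>" "C powr s * r ^ k < \<eta>"
      unfolding eventually_sequentially by blast
    \<comment> \<open>Rounding down gives \<open>a ^ k \<le> b ^ h \<le> a ^ k / b\<close>: the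
      lower bound serves to count the squares, the upper one to bound their size.\<close>
    define h where "h = nat \<lfloor>\<kappa> * real k\<rfloor>"
    have "0 \<le> \<kappa> * real k" using \<kappa>_gt_1 by simp
    then have h: "real h \<le> \<kappa> * real k" "\<kappa> * real k < real h + 1" unfolding h_def by linarith+
    have kh: "k \<le> h"
      using \<kappa>_gt_1 mult_right_mono[of 1 \<kappa> "real k"] unfolding h_def by (simp add: le_nat_floor)
    have ak: "a ^ k = b powr (\<kappa> * real k)" using ab by (simp add: b_powr_\<kappa> powr_realpow)
    have bh: "b ^ h = b powr real h" using ab by (simp add: powr_realpow)
    have bah: "b ^ h \<le> a ^ k / b"
    proof -
      have "b ^ h * b = b powr (real h + 1)" using ab bh by (simp add: powr_add)
      also have "\<dots> \<le> a ^ k" unfolding ak using ab h by (intro powr_mono') auto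
      finally show ?thesis using ab by (simp add: pos_le_divide_eq)
    qed
    have abh: "a ^ k \<le> b ^ h" unfolding ak bh using ab h by (intro powr_mono') auto
    obtain F where F: "finite F" "\<Lambda> \<subseteq> \<Union>F" "\<And>V. V \<in> F \<Longrightarrow> bounded V \<and> diameter V \<le> C * a ^ k"
        "card F \<le> m ^ h * n ^ k"
      using attractor_approximate_squares[OF att kh bah] unfolding C_def by blast
    have "real (card F) \<le> real (m ^ h * n ^ k)" using F(4) by (simp only: of_nat_le_iff)
    also have "\<dots> = (b ^ h) powr (- dim_y) * (a ^ k) powr (- dim_x)"
      using ab by (simp add: powr_minus power_dim_x power_dim_y)
    also have "\<dots> \<le> (a ^ k) powr (- dim_y) * (a ^ k) powr (- dim_x)"
      using abh ab dim_nonneg by (intro mult_right_mono powr_mono2') auto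
    finally have "real (card F) * (C * a ^ k) powr s
        \<le> (a ^ k) powr (- dim_y) * (a ^ k) powr (- dim_x) * (C * a ^ k) powr s"
      by (rule mult_right_mono) auto
    also have "\<dots> = C powr s * ((a ^ k) powr (- dim_y) * (a ^ k) powr (- dim_x) * (a ^ k) powr s)"
      using C ab powr_mult[of C "a ^ k" s] by simp
    also have "\<dots> = C powr s * (a ^ k) powr \<delta>"
      unfolding powr_add[symmetric] by (simp add: \<delta>_def algebra_simps)
    also have "\<dots> = C powr s * r ^ k"
      using ab by (simp add: r_def powr_realpow[symmetric] powr_powr mult.commute)
    finally have "real (card F) * (C * a ^ k) powr s \<le> \<eta>" using k(2) by linarith
    then show "\<exists>F r. finite F \<and> \<Lambda> \<subseteq> \<Union>F \<and> (\<forall>V\<in>F. bounded V \<and> diameter V \<le> r) \<and> r \<le> \<eta> \<and>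
        real (card F) * r powr s \<le> \<eta>"
      using F k(1) by (intro exI[of _ F] exI[of _ "C * a ^ k"]) auto
  qed
qed

lemma projection_measure_pos:
  assumes att: "is_GL_attractor m n a b c d \<Lambda>" and irr: "\<kappa> \<notin> \<rat>"
    and f: "continuous_on \<Lambda> f" "0 < R" "\<And>v w. dist (f v) (f w) = R * \<bar>(fst v + t * snd v) - (fst w + t * snd w)\<bar>"
    and s: "0 \<le> s" "s < \<gamma>"
  shows "hausdorff_measure s (f ` \<Lambda>) \<noteq> 0"
proof -
  \<comment> \<open>Room between the exponents: \<sigma> for near pairs, \<open>s1\<close> after
    Chebyshev's inequality.\<close>
  define s1 where "s1 = (s + \<gamma>) / 2"
  define \<sigma> where "\<sigma> = (s1 + \<gamma>) / 2"
  have "s \<le> s1" "0 < s1" "s1 < \<gamma>" using s by (auto simp: s1_def)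
  moreover from this have "s1 < \<sigma>" "0 < \<sigma>" "\<sigma> < \<gamma>" by (auto simp: \<sigma>_def)
  ultimately have s1: "s \<le> s1" "0 < s1" "s1 < \<sigma>" "0 < \<sigma>" "\<sigma> < \<gamma>" by auto
  have K: "0 < 1 / R" using f by simp
  obtain \<rho> C where \<rho>: "0 < \<rho>" "\<rho> < 1" "0 < C" and fam:
    "\<And>P. \<exists>N \<Omega>. finite \<Omega> \<and> \<Omega> \<noteq> {} \<and> \<Omega> \<subseteq> words m N \<times> words n N \<and>
      (\<forall>p\<le>P. real (card (near_pairs (1 / R * \<rho> ^ p) \<Omega> word_pos \<Omega> word_pos))
        \<le> C * (\<rho> ^ p) powr \<sigma> * real (card \<Omega>) ^ 2)"
    by (rule exists_few_near_pairs[OF irr s1(4,5) K]) (rule that)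
  define D where "D = 2 * C / (1 - \<rho> powr (\<sigma> - s1))"
  have "\<rho> powr (\<sigma> - s1) < 1" using \<rho> s1 powr_less_mono2[of "\<sigma> - s1" \<rho> 1] by simp
  then have D: "0 < D" using \<rho> by (simp add: D_def)
  obtain v where v: "v \<in> \<Lambda>" using att by (auto simp: is_GL_attractor_def)
  have cpt: "compact (f ` \<Lambda>)" using att f(1) by (auto simp: is_GL_attractor_def intro: compact_continuous_image)
  show ?thesis
  proof (rule finitary_mass_distribution[OF cpt \<rho>(1,2) D s(1) s1(1,2)])
    fix P
    obtain N \<Omega> where \<Omega>: "finite \<Omega>" "\<Omega> \<noteq> {}" "\<Omega> \<subseteq> words m N \<times> words n N"
      "\<And>p. p \<le> P \<Longrightarrow> real (card (near_pairs (1 / R * \<rho> ^ p) \<Omega> word_pos \<Omega> word_pos))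
        \<le> C * (\<rho> ^ p) powr \<sigma> * real (card \<Omega>) ^ 2" using fam[of P] by blast
    have "\<exists>G\<subseteq>\<Omega>. card \<Omega> \<le> 2 * card G \<and>
        (\<forall>\<omega>\<in>G. \<forall>p\<le>P. real (card {\<omega>'\<in>\<Omega>. \<bar>word_pos \<omega> - word_pos \<omega>'\<bar> \<le> 1 / R * \<rho> ^ p})
        \<le> D * (\<rho> ^ p) powr s1 * real (card \<Omega>))"
      unfolding D_def by (rule chebyshev_near_pairs[OF \<Omega>(1,2) \<rho> s1(3) \<Omega>(4)])
    then obtain G where G: "G \<subseteq> \<Omega>" "card \<Omega> \<le> 2 * card G"
      "\<forall>\<omega>\<in>G. \<forall>p\<le>P. real (card {\<omega>'\<in>\<Omega>. \<bar>word_pos \<omega> - word_pos \<omega>'\<bar> \<le> 1 / R * \<rho> ^ p})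
        \<le> D * (\<rho> ^ p) powr s1 * real (card \<Omega>)" by blast
    \<comment> \<open>All words are completed by the same \<open>v\<close>, which cancels in
      differences; distances are therefore exactly \<open>R\<close> times differences of
      \<open>word_pos\<close>.\<close>
    define pt where "pt x = f (code_point N v x)" for x
    have dist: "dist (pt x) (pt y) \<le> e \<longleftrightarrow> \<bar>word_pos x - word_pos y\<bar> \<le> 1 / R * e" for x y e
    proof -
      have "dist (pt x) (pt y) = R * \<bar>word_pos x - word_pos y\<bar>"
        unfolding pt_def f(3) code_point_def word_pos_def by (simp add: algebra_simps)
      then show ?thesis using f(2) by (simp add: field_simps)
    qed
    have "pt ` \<Omega> \<subseteq> f ` \<Lambda>"
    proof
      fix y assume "y \<in> pt ` \<Omega>"
      then obtain i j where "(i, j) \<in> \<Omega>" "y = pt (i, j)" by auto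
      then show "y \<in> f ` \<Lambda>"
        using code_point_in_attractor[OF att v, of i N j] \<Omega>(3) by (auto simp: pt_def)
    qed
    then show "\<exists>(\<Omega> :: (nat list \<times> nat list) set) pt G. finite \<Omega> \<and> \<Omega> \<noteq> {} \<and> pt ` \<Omega> \<subseteq> f ` \<Lambda> \<and> G \<subseteq> \<Omega> \<and>
        card \<Omega> \<le> 2 * card G \<and>
        (\<forall>\<omega>\<in>G. \<forall>p\<le>P. real (card {\<omega>'\<in>\<Omega>. dist (pt \<omega>) (pt \<omega>') \<le> \<rho> ^ p})
            \<le> D * (\<rho> ^ p) powr s1 * real (card \<Omega>))"
      using \<Omega>(1,2) G
      by (intro exI[of _ \<Omega>] exI[of _ pt] exI[of _ G] conjI) (simp_all only: dist not_False_eq_True)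
  qed
qed

end

section \<open>Orthogonal projections onto lines\<close>

lemma norm_cos_sin [simp]: "norm (cos \<theta>, sin \<theta> :: real) = 1"
  by (simp add: norm_Pair)

lemma dist_proj_line:
  "dist (proj_line \<theta> v) (proj_line \<theta> w) = \<bar>(v - w) \<bullet> (cos \<theta>, sin \<theta>)\<bar>"
  unfolding proj_line_def dist_norm scaleR_diff_left[symmetric] norm_scaleR inner_diff_left[symmetric]
  by simp

lemma dist_proj_line_le: "dist (proj_line \<theta> v) (proj_line \<theta> w) \<le> dist v w"
  unfolding dist_proj_line
  using Cauchy_Schwarz_ineq2[of "v - w" "(cos \<theta>, sin \<theta>)"] by (simp add: dist_norm)

lemma hausdorff_dim_proj_line_le_1:
  assumes "bounded A"
  shows "hausdorff_dim (proj_line \<theta> ` A) \<le> ennreal 1"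
proof (rule hausdorff_dim_leI)
  fix s :: real assume s: "1 < s"
  obtain B where B: "0 < B" "\<And>v. v \<in> A \<Longrightarrow> norm v \<le> B" using assms bounded_pos by blast
  define u where "u = (cos \<theta>, sin \<theta>)"
  have u: "norm u = 1" by (simp add: u_def)
  show "hausdorff_measure s (proj_line \<theta> ` A) = 0"
  proof (rule hausdorff_measure_eq_0_finite_covers)
    show "0 < s" using s by simp
    fix \<eta> :: real assume \<eta>: "0 < \<eta>"
    have l1: "(\<lambda>k. 2 * B / real (Suc k)) \<longlonglongrightarrow> 0"
      using tendsto_mult[OF tendsto_const[of "2 * B"] LIMSEQ_inverse_real_of_nat] by (simp add: divide_inverse)
    have "(\<lambda>k. 2 * B * (2 * B / real (Suc k)) powr (s - 1)) \<longlonglongrightarrow> 2 * B * 0 powr (s - 1)"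
      using s B by (intro tendsto_intros tendsto_powr' l1) (auto intro!: always_eventually)
    then have "\<forall>\<^sub>F k in sequentially. 2 * B * (2 * B / real (Suc k)) powr (s - 1) < \<eta>"
      using \<eta> by (intro order_tendstoD) auto
    moreover have "\<forall>\<^sub>F k in sequentially. 2 * B / real (Suc k) < \<eta>"
      using l1 \<eta> by (intro order_tendstoD)
    ultimately have "\<forall>\<^sub>F k in sequentially. 2 * B / real (Suc k) < \<eta> \<and>
        2 * B * (2 * B / real (Suc k)) powr (s - 1) < \<eta>" by eventually_elim auto
    then obtain k where k: "2 * B / real (Suc k) < \<eta>" "2 * B * (2 * B / real (Suc k)) powr (s - 1) < \<eta>"
      unfolding eventually_sequentially by blast
    define r where "r = 2 * B / real (Suc k)"
    have r: "0 < r" using B by (simp add: r_def)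
    define V where "V i = (\<lambda>z. z *\<^sub>R u) ` {- B + r * real i..- B + r * (real i + 1)}" for i :: nat
    define F where "F = V ` {..k}"
    have "proj_line \<theta> ` A \<subseteq> \<Union>F"
    proof
      fix y assume "y \<in> proj_line \<theta> ` A"
      then obtain v where v: "v \<in> A" "y = (v \<bullet> u) *\<^sub>R u" by (auto simp: proj_line_def u_def)
      define z where "z = v \<bullet> u"
      have "\<bar>z\<bar> \<le> B" using Cauchy_Schwarz_ineq2[of v u] B(2)[OF v(1)] u by (simp add: z_def)
      then have z: "0 \<le> z + B" "z + B \<le> 2 * B" by auto
      have "\<exists>i\<le>k. r * real i \<le> z + B \<and> z + B \<le> r * (real i + 1)"
      \<comment> \<open>Rounding down would put the right endpoint into segment
        \<open>Suc k\<close>, which does not exist.\<close>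
      proof (cases "z + B = 2 * B")
        case True
        moreover have "r * real (Suc k) = 2 * B" by (simp add: r_def del: of_nat_Suc)
        ultimately have "z + B = r * (real k + 1)" by (simp add: add.commute)
        moreover have "r * real k \<le> r * (real k + 1)" using r by (intro mult_left_mono) auto
        ultimately show ?thesis by (intro exI[of _ k]) simp
      next
        case False
        define i where "i = nat \<lfloor>(z + B) / r\<rfloor>"
        have "0 \<le> (z + B) / r" using z r by simp
        then have i: "real i \<le> (z + B) / r" "(z + B) / r < real i + 1" unfolding i_def by linarith+
        have "r * real i \<le> z + B" "z + B \<le> r * (real i + 1)"
          using i r by (auto simp: pos_le_divide_eq pos_divide_less_eq mult.commute less_imp_le)
        moreover have "i \<le> k"
        proof -
          have "(z + B) / r < real (Suc k)" using False z B r by (simp add: r_def pos_divide_less_eq)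
          then have "real i < real (Suc k)" using i by linarith
          then show ?thesis by simp
        qed
        ultimately show ?thesis by blast
      qed
      then obtain i where "i \<le> k" "z \<in> {- B + r * real i..- B + r * (real i + 1)}" by auto
      then show "y \<in> \<Union>F" using v(2) unfolding F_def V_def z_def by blast
    qed
    moreover have "bounded W \<and> diameter W \<le> r" if W: "W \<in> F" for W
    proof
      obtain i where i: "W = V i" using W by (auto simp: F_def)
      show "bounded W" unfolding i V_def
        by (intro compact_imp_bounded compact_continuous_image continuous_intros) simp
      show "diameter W \<le> r"
      proof (rule diameter_le)
        show "W \<noteq> {} \<or> 0 \<le> r" using r by simp
        fix y z assume "y \<in> W" "z \<in> W"
        then obtain y' z' where yz: "y = y' *\<^sub>R u" "z = z' *\<^sub>R u"
          "y' \<in> {- B + r * real i..- B + r * (real i + 1)}" "z' \<in> {- B + r * real i..- B + r * (real i + 1)}"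
          unfolding i V_def by blast
        have "norm (y - z) = \<bar>y' - z'\<bar>" unfolding yz scaleR_diff_left[symmetric] by (simp add: u)
        also have "\<dots> \<le> r" using yz(3,4) by (simp add: abs_le_iff distrib_left)
        finally show "norm (y - z) \<le> r" .
      qed
    qed
    moreover have "real (card F) * r powr s \<le> \<eta>"
    proof -
      have "card F \<le> Suc k" using card_image_le[of "{..k}" V] by (simp add: F_def)
      then have "real (card F) * r powr s \<le> real (Suc k) * r powr s" by (intro mult_right_mono) auto
      also have "\<dots> = real (Suc k) * (r powr (s - 1) * r powr 1)" unfolding powr_add[symmetric] by simp
      also have "\<dots> = (real (Suc k) * r) * r powr (s - 1)" using r by simp
      also have "real (Suc k) * r = 2 * B" by (simp add: r_def)
      also have "2 * B * r powr (s - 1) \<le> \<eta>" using k(2) by (simp add: r_def)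
      finally show ?thesis .
    qed
    moreover have "finite F" "r \<le> \<eta>" using k(1) by (auto simp: F_def r_def)
    ultimately show "\<exists>F r. finite F \<and> proj_line \<theta> ` A \<subseteq> \<Union>F \<and> (\<forall>V\<in>F. bounded V \<and> diameter V \<le> r) \<and>
        r \<le> \<eta> \<and> real (card F) * r powr s \<le> \<eta>" by blast
  qed
qed simp

theorem proposition1p2:
  fixes m n :: nat and a b :: real and c :: "nat \<Rightarrow> nat \<Rightarrow> real" and d :: "nat \<Rightarrow> real"
    and \<Lambda> :: "(real \<times> real) set"
  assumes "gatzouras_lalley m n a b c d"
    and "is_GL_attractor m n a b c d \<Lambda>"
    and "ln a / ln b \<notin> \<rat>"
  shows "\<forall>\<theta>\<in>{0<..<pi} - {pi / 2}.
           hausdorff_dim (proj_line \<theta> ` \<Lambda>) = min (hausdorff_dim \<Lambda>) 1"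
proof
  fix \<theta> assume \<theta>: "\<theta> \<in> {0<..<pi} - {pi / 2}"
  then have sin: "0 < sin \<theta>" by (simp add: sin_gt_zero)
  have cos: "cos \<theta> \<noteq> 0"
  proof
    assume "cos \<theta> = 0"
    then have "cos \<theta> = cos (pi / 2)" by simp
    then have "\<theta> = pi / 2" using \<theta> cos_inj_pi[of \<theta> "pi / 2"] by simp
    then show False using \<theta> by simp
  qed
  interpret GL_slope m n a b c d "tan \<theta>"
  proof
    show "gatzouras_lalley m n a b c d" by (rule assms(1))
    show "tan \<theta> \<noteq> 0" using sin cos by (simp add: tan_def)
  qed
  have bdd: "bounded \<Lambda>" using assms(2) by (auto simp: is_GL_attractor_def intro: compact_imp_bounded)
  have dist: "dist (proj_line \<theta> v) (proj_line \<theta> w)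
      = \<bar>cos \<theta>\<bar> * \<bar>(fst v + tan \<theta> * snd v) - (fst w + tan \<theta> * snd w)\<bar>" for v w
    unfolding dist_proj_line abs_mult[symmetric] using cos
    by (cases v, cases w) (simp add: tan_def algebra_simps)
  have cont: "continuous_on \<Lambda> (proj_line \<theta>)"
    unfolding proj_line_def by (intro continuous_intros)
  \<comment> \<open>The estimates close into a circle: \<gamma> bounds the dimension of the
    projection from below, that dimension is at most \<open>min (hausdorff_dim \<Lambda>) 1\<close>,
    and the covering bound brings this back to \<gamma>.\<close>
  have "ennreal \<gamma> \<le> hausdorff_dim (proj_line \<theta> ` \<Lambda>)"
    using assms(3) cos
    by (intro hausdorff_dim_geI projection_measure_pos[OF assms(2) _ cont _ dist]) (auto simp: \<kappa>_def)
  moreover have "min (hausdorff_dim \<Lambda>) 1 \<le> ennreal \<gamma>"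
  proof (cases "dim_x + dim_y \<le> 1")
    case True
    then show ?thesis using hausdorff_dim_attractor_le[OF assms(2)] by (simp add: \<gamma>_def min.coboundedI1)
  next
    case False
    then show ?thesis by (simp add: \<gamma>_def min_def)
  qed
  moreover have "hausdorff_dim (proj_line \<theta> ` \<Lambda>) \<le> min (hausdorff_dim \<Lambda>) 1"
    using hausdorff_dim_image_le[of "proj_line \<theta>", OF dist_proj_line_le]
      hausdorff_dim_proj_line_le_1[OF bdd] by simp
  ultimately show "hausdorff_dim (proj_line \<theta> ` \<Lambda>) = min (hausdorff_dim \<Lambda>) 1" by order
qed

end
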